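(* Let $k$ be a field and $X$ a scheme of finite type over $k$. The cyclic operators $T_n:\mathcal{Z}_q(X,n)\to\mathcal{Z}_q(X,n)$ on the higher Chow cycle groups satisfy the cyclic compatibility conditions $$d_0T_n=d_n,\qquad d_iT_n=T_{n-1}d_{i-1}\quad(1\le i\le n)$$ as maps $\mathcal{Z}_q(X,n)\to\mathcal{Z}_{q-1}(X,n-1)$.
   Context: Let $\Delta^n=\mathrm{Spec}\,k[t_0,\dots,t_n]/(\sum t_i-1)$. Coface maps $\partial_j:\Delta^{n-1}\to\Delta^n$ ($0\le j\le n$): $\partial_j^*(t_i)=t_i$ for $i<j$, $0$ for $i=j$, $t_{i-1}$ for $i>j$. A face of $\Delta^n$ is a closed subscheme defined by the vanishing of some of the $t_i$. $\mathcal{Z}_q(X,n)$ is the free abelian group on the irreducible closed subvarieties of $X\times_k\Delta^n$ of dimension $q$ that meet all $X\times F$, $F$ a face, properly (in the right codimension). Pullback of cycles along $\mathrm{id}_X\times\partial_i$ (intersection with the divisor $t_i=0$) gives the face maps $d_i:\mathcal{Z}_q(X,n)\to\mathcal{Z}_{q-1}(X,n-1)$. The ring automorphism $T_n^{-1}$ of $k[t_0,\dots,t_n]/(\sum t_i-1)$ is given by $t_i\mapsto t_{i+1}$ for $0\le i\le n-1$ and $t_n\mapsto t_0$. The operator $T_n:\mathcal{Z}_q(X,n)\to\mathcal{Z}_q(X,n)$ is pullback of cycles along $\mathrm{id}_X\times\mathrm{Spec}(T_n^{-1})$; equivalently, it sends a subvariety to its image under the automorphism of $X\times\Delta^n$ given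 on points of $\Delta^n$ by $(t_0,\dots,t_n)\mapsto(t_n,t_0,\dots,t_{n-1})$. *)

theory Defs
  imports
    "HOL-Analysis.Abstract_Topology"
    "HOL-Library.Extended_Nat"
    "HOL-Library.FuncSet"
    "HOL-Library.Poly_Mapping"
    "HOL-Algebra.QuotRing"
    "HOL-Algebra.Generated_Rings"
    "HOL-Algebra.Free_Abelian_Groups"
begin

section \<open>Ringed spaces\<close>

text \<open>
  A space with a presheaf of rings. The set \<open>carrier (sections X U)\<close> and the map
  \<open>restr X U V\<close> (from sections over \<open>U\<close> to sections over \<open>V \<subseteq> U\<close>) are meaningful for open sets only.
  The sections over all open sets live in one type, which is no restriction up to isomorphism.
\<close>

record ('x, 's) ringed_space =
  space_of :: "'x topology"
  sections :: "'x set \<Rightarrow> 's ring"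
  restr    :: "'x set \<Rightarrow> 'x set \<Rightarrow> 's \<Rightarrow> 's"

abbreviation points :: "('x, 's) ringed_space \<Rightarrow> 'x set" where
  "points X \<equiv> topspace (space_of X)"

abbreviation is_open :: "('x, 's) ringed_space \<Rightarrow> 'x set \<Rightarrow> bool" where
  "is_open X U \<equiv> openin (space_of X) U"

definition presheaf_of_rings :: "('x, 's) ringed_space \<Rightarrow> bool" where
  "presheaf_of_rings X \<longleftrightarrow>
     (\<forall>U. is_open X U \<longrightarrow> cring (sections X U)) \<and>
     (\<forall>U V. is_open X U \<and> is_open X V \<and> V \<subseteq> U \<longrightarrow>
        restr X U V \<in> ring_hom (sections X U) (sections X V)) \<and>
     (\<forall>U. is_open X U \<longrightarrow> (\<forall>s \<in> carrier (sections X U). restr X U U s = s)) \<and>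
     (\<forall>U V W. is_open X U \<and> is_open X V \<and> is_open X W \<and> W \<subseteq> V \<and> V \<subseteq> U \<longrightarrow>
        (\<forall>s \<in> carrier (sections X U). restr X V W (restr X U V s) = restr X U W s))"

definition sheaf_of_rings :: "('x, 's) ringed_space \<Rightarrow> bool" where
  "sheaf_of_rings X \<longleftrightarrow> presheaf_of_rings X \<and>
     (\<forall>\<V> s. (\<forall>V\<in>\<V>. is_open X V \<and> s V \<in> carrier (sections X V)) \<and>
        (\<forall>V\<in>\<V>. \<forall>W\<in>\<V>. restr X V (V \<inter> W) (s V) = restr X W (V \<inter> W) (s W)) \<longrightarrow>
        (\<exists>!t. t \<in> carrier (sections X (\<Union>\<V>)) \<and> (\<forall>V\<in>\<V>. restr X (\<Union>\<V>) V t = s V)))"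

text \<open>A germ at \<open>x\<close> is an equivalence class of pairs \<open>(U, s)\<close> of an open neighbourhood and a section.\<close>

definition germ :: "('x, 's) ringed_space \<Rightarrow> 'x \<Rightarrow> 'x set \<Rightarrow> 's \<Rightarrow> ('x set \<times> 's) set" where
  "germ X x U s =
     {(V, t). is_open X V \<and> x \<in> V \<and> t \<in> carrier (sections X V) \<and>
        (\<exists>W. is_open X W \<and> x \<in> W \<and> W \<subseteq> U \<inter> V \<and> restr X U W s = restr X V W t)}"

definition stalk :: "('x, 's) ringed_space \<Rightarrow> 'x \<Rightarrow> ('x set \<times> 's) set ring" where
  "stalk X x =
     \<lparr>carrier = {germ X x U s | U s. is_open X U \<and> x \<in> U \<and> s \<in> carrier (sections X U)},
      monoid.mult = (\<lambda>c d. \<Union>(U, s)\<in>c. \<Union>(V, t)\<in>d.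
         germ X x (U \<inter> V) (restr X U (U \<inter> V) s \<otimes>\<^bsub>sections X (U \<inter> V)\<^esub> restr X V (U \<inter> V) t)),
      one = germ X x (points X) \<one>\<^bsub>sections X (points X)\<^esub>,
      ring.zero = germ X x (points X) \<zero>\<^bsub>sections X (points X)\<^esub>,
      ring.add = (\<lambda>c d. \<Union>(U, s)\<in>c. \<Union>(V, t)\<in>d.
         germ X x (U \<inter> V) (restr X U (U \<inter> V) s \<oplus>\<^bsub>sections X (U \<inter> V)\<^esub> restr X V (U \<inter> V) t))\<rparr>"

text \<open>The maximal ideal of a local ring \<open>R\<close> is \<open>nonunits R\<close>.\<close>

definition nonunits :: "('a, 'm) ring_scheme \<Rightarrow> 'a set" where
  "nonunits R = carrier R - Units R"

definition local_ring :: "('a, 'm) ring_scheme \<Rightarrow> bool" where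
  "local_ring R \<longleftrightarrow> cring R \<and> ideal (nonunits R) R"

definition locally_ringed_space :: "('x, 's) ringed_space \<Rightarrow> bool" where
  "locally_ringed_space X \<longleftrightarrow> sheaf_of_rings X \<and> (\<forall>x \<in> points X. local_ring (stalk X x))"

definition open_subspace :: "('x, 's) ringed_space \<Rightarrow> 'x set \<Rightarrow> ('x, 's) ringed_space" where
  "open_subspace X U =
     \<lparr>space_of = subtopology (space_of X) U, sections = sections X, restr = restr X\<rparr>"


section \<open>Morphisms\<close>

text \<open>
  For a morphism \<open>f\<close> from \<open>X\<close> to \<open>Y\<close> and \<open>U\<close> open in \<open>Y\<close>, the map \<open>pull f U\<close> takes sections of \<open>Y\<close>
  over \<open>U\<close> to sections of \<open>X\<close> over the preimage of \<open>U\<close>. As these maps are total functions, morphisms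
  are compared with \<open>mor_eq\<close>, which ignores values outside the carriers.
\<close>

record ('x, 's, 'y, 't) mor =
  pt   :: "'x \<Rightarrow> 'y"
  pull :: "'y set \<Rightarrow> 't \<Rightarrow> 's"

definition preim :: "('x, 's) ringed_space \<Rightarrow> ('x, 's, 'y, 't) mor \<Rightarrow> 'y set \<Rightarrow> 'x set" where
  "preim X f U = {x \<in> points X. pt f x \<in> U}"

definition stalk_map ::
  "('x, 's) ringed_space \<Rightarrow> ('x, 's, 'y, 't) mor \<Rightarrow> 'x \<Rightarrow> ('y set \<times> 't) set \<Rightarrow> ('x set \<times> 's) set" where
  "stalk_map X f x c = (\<Union>(U, s)\<in>c. germ X x (preim X f U) (pull f U s))"

definition lrs_morphism ::
  "('x, 's) ringed_space \<Rightarrow> ('y, 't) ringed_space \<Rightarrow> ('x, 's, 'y, 't) mor \<Rightarrow> bool" where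
  "lrs_morphism X Y f \<longleftrightarrow>
     continuous_map (space_of X) (space_of Y) (pt f) \<and>
     (\<forall>U. is_open Y U \<longrightarrow> pull f U \<in> ring_hom (sections Y U) (sections X (preim X f U))) \<and>
     (\<forall>U V. is_open Y U \<and> is_open Y V \<and> V \<subseteq> U \<longrightarrow>
        (\<forall>s \<in> carrier (sections Y U).
           pull f V (restr Y U V s) = restr X (preim X f U) (preim X f V) (pull f U s))) \<and>
     (\<forall>x \<in> points X. \<forall>c \<in> carrier (stalk Y (pt f x)).
        stalk_map X f x c \<in> Units (stalk X x) \<longrightarrow> c \<in> Units (stalk Y (pt f x)))"

definition mor_eq ::
  "('x, 's) ringed_space \<Rightarrow> ('y, 't) ringed_space \<Rightarrow>
   ('x, 's, 'y, 't) mor \<Rightarrow> ('x, 's, 'y, 't) mor \<Rightarrow> bool" where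
  "mor_eq X Y f g \<longleftrightarrow>
     (\<forall>x \<in> points X. pt f x = pt g x) \<and>
     (\<forall>U. is_open Y U \<longrightarrow> (\<forall>s \<in> carrier (sections Y U). pull f U s = pull g U s))"

definition mor_id :: "('x, 's, 'x, 's) mor" where
  "mor_id = \<lparr>pt = (\<lambda>x. x), pull = (\<lambda>U s. s)\<rparr>"

text \<open>\<open>mor_comp Y g f\<close> is \<open>g\<close> after \<open>f\<close>, where \<open>Y\<close> is the target of \<open>f\<close> and the source of \<open>g\<close>.\<close>

definition mor_comp ::
  "('y, 't) ringed_space \<Rightarrow> ('y, 't, 'z, 'u) mor \<Rightarrow> ('x, 's, 'y, 't) mor \<Rightarrow> ('x, 's, 'z, 'u) mor" where
  "mor_comp Y g f = \<lparr>pt = pt g \<circ> pt f, pull = (\<lambda>U. pull f (preim Y g U) \<circ> pull g U)\<rparr>"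

definition lrs_isomorphic :: "('x, 's) ringed_space \<Rightarrow> ('y, 't) ringed_space \<Rightarrow> bool" where
  "lrs_isomorphic X Y \<longleftrightarrow>
     (\<exists>f g. lrs_morphism X Y f \<and> lrs_morphism Y X g \<and>
        mor_eq X X (mor_comp Y g f) mor_id \<and> mor_eq Y Y (mor_comp X f g) mor_id)"


section \<open>Affine schemes\<close>

definition Spec_points :: "('a, 'm) ring_scheme \<Rightarrow> 'a set set" where
  "Spec_points R = {P. primeideal P R}"

definition zariski_open :: "('a, 'm) ring_scheme \<Rightarrow> 'a set set \<Rightarrow> bool" where
  "zariski_open R U \<longleftrightarrow> (\<exists>S \<subseteq> carrier R. U = {P \<in> Spec_points R. \<not> S \<subseteq> P})"

lemma istopology_zariski_open: "istopology (zariski_open R)"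
  unfolding istopology_def
proof (intro conjI allI impI)
  fix U V assume "zariski_open R U" "zariski_open R V"
  then obtain S T where S: "S \<subseteq> carrier R" "U = {P \<in> Spec_points R. \<not> S \<subseteq> P}"
    and T: "T \<subseteq> carrier R" "V = {P \<in> Spec_points R. \<not> T \<subseteq> P}"
    unfolding zariski_open_def by auto
  let ?W = "{w \<in> carrier R. \<exists>s\<in>S. \<exists>t\<in>T. w = s \<otimes>\<^bsub>R\<^esub> t}"
  have "?W \<subseteq> P \<longleftrightarrow> S \<subseteq> P \<or> T \<subseteq> P" if "P \<in> Spec_points R" for P
  proof -
    interpret primeideal P R using that by (simp add: Spec_points_def)
    show ?thesis
    proof
      assume W: "?W \<subseteq> P"
      show "S \<subseteq> P \<or> T \<subseteq> P"
      proof (rule ccontr)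
        assume "\<not> (S \<subseteq> P \<or> T \<subseteq> P)"
        then obtain s t where st: "s \<in> S" "s \<notin> P" "t \<in> T" "t \<notin> P" by blast
        then have c: "s \<in> carrier R" "t \<in> carrier R" using S T by blast+
        then have "s \<otimes>\<^bsub>R\<^esub> t \<in> ?W" using st by blast
        then show False using I_prime[OF c] W st by blast
      qed
    next
      assume "S \<subseteq> P \<or> T \<subseteq> P"
      then show "?W \<subseteq> P" using S T I_l_closed I_r_closed by blast
    qed
  qed
  then have "U \<inter> V = {P \<in> Spec_points R. \<not> ?W \<subseteq> P}"
    unfolding S(2) T(2) by blast
  moreover have "?W \<subseteq> carrier R" by blast
  ultimately show "zariski_open R (U \<inter> V)" unfolding zariski_open_def by blast
next
  fix \<U> assume "\<forall>U\<in>\<U>. zariski_open R U"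
  then have "\<forall>U\<in>\<U>. \<exists>S. S \<subseteq> carrier R \<and> U = {P \<in> Spec_points R. \<not> S \<subseteq> P}"
    unfolding zariski_open_def by fast
  then obtain S where S: "\<forall>U\<in>\<U>. S U \<subseteq> carrier R \<and> U = {P \<in> Spec_points R. \<not> S U \<subseteq> P}"
    by (rule bchoice[THEN exE])
  have mem: "P \<in> U \<longleftrightarrow> P \<in> Spec_points R \<and> \<not> S U \<subseteq> P" if "U \<in> \<U>" for P U
  proof -
    have "P \<in> U \<longleftrightarrow> P \<in> {P \<in> Spec_points R. \<not> S U \<subseteq> P}"
      using S that by (intro arg_cong[where f = "\<lambda>A. P \<in> A"]) simp
    then show ?thesis by simp
  qed
  have "\<Union>\<U> = {P \<in> Spec_points R. \<not> \<Union>(S ` \<U>) \<subseteq> P}"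
  proof (rule Set.set_eqI)
    fix P
    have "P \<in> \<Union>\<U> \<longleftrightarrow> (\<exists>U\<in>\<U>. P \<in> Spec_points R \<and> \<not> S U \<subseteq> P)"
      unfolding Union_iff by (rule bex_cong[OF refl]) (rule mem)
    also have "\<dots> \<longleftrightarrow> P \<in> {P \<in> Spec_points R. \<not> \<Union>(S ` \<U>) \<subseteq> P}"
      by (simp add: UN_subset_iff)
    finally show "P \<in> \<Union>\<U> \<longleftrightarrow> P \<in> {P \<in> Spec_points R. \<not> \<Union>(S ` \<U>) \<subseteq> P}" .
  qed
  moreover have "\<Union>(S ` \<U>) \<subseteq> carrier R" using S by (simp add: UN_subset_iff)
  ultimately show "zariski_open R (\<Union>\<U>)" unfolding zariski_open_def by blast
qed

text \<open>
  \<open>frac R P a s\<close> is the fraction \<open>a / s\<close> in the localization \<open>R\<^sub>P\<close> at a prime ideal \<open>P\<close>, as an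
  equivalence class of pairs.
\<close>

definition frac :: "('a, 'm) ring_scheme \<Rightarrow> 'a set \<Rightarrow> 'a \<Rightarrow> 'a \<Rightarrow> ('a \<times> 'a) set" where
  "frac R P a s =
     {(b, t). b \<in> carrier R \<and> t \<in> carrier R - P \<and>
        (\<exists>u \<in> carrier R - P. u \<otimes>\<^bsub>R\<^esub> (a \<otimes>\<^bsub>R\<^esub> t) = u \<otimes>\<^bsub>R\<^esub> (b \<otimes>\<^bsub>R\<^esub> s))}"

definition localization :: "('a, 'm) ring_scheme \<Rightarrow> 'a set \<Rightarrow> ('a \<times> 'a) set ring" where
  "localization R P =
     \<lparr>carrier = {frac R P a s | a s. a \<in> carrier R \<and> s \<in> carrier R - P},
      monoid.mult = (\<lambda>x y. \<Union>(a, s)\<in>x. \<Union>(b, t)\<in>y. frac R P (a \<otimes>\<^bsub>R\<^esub> b) (s \<otimes>\<^bsub>R\<^esub> t)),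
      one = frac R P \<one>\<^bsub>R\<^esub> \<one>\<^bsub>R\<^esub>,
      ring.zero = frac R P \<zero>\<^bsub>R\<^esub> \<one>\<^bsub>R\<^esub>,
      ring.add = (\<lambda>x y. \<Union>(a, s)\<in>x. \<Union>(b, t)\<in>y.
               frac R P (a \<otimes>\<^bsub>R\<^esub> t \<oplus>\<^bsub>R\<^esub> b \<otimes>\<^bsub>R\<^esub> s) (s \<otimes>\<^bsub>R\<^esub> t))\<rparr>"

definition Spec_sections ::
  "('a, 'm) ring_scheme \<Rightarrow> 'a set set \<Rightarrow> ('a set \<Rightarrow> ('a \<times> 'a) set) ring" where
  "Spec_sections R U =
     \<lparr>carrier = {\<sigma> \<in> (\<Pi>\<^sub>E P\<in>U. carrier (localization R P)).
         \<forall>P\<in>U. \<exists>V a s. zariski_open R V \<and> P \<in> V \<and> V \<subseteq> U \<and> a \<in> carrier R \<and> s \<in> carrier R \<and>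
            (\<forall>Q\<in>V. s \<notin> Q \<and> \<sigma> Q = frac R Q a s)},
      monoid.mult = (\<lambda>\<sigma> \<tau>. \<lambda>P\<in>U. \<sigma> P \<otimes>\<^bsub>localization R P\<^esub> \<tau> P),
      one = (\<lambda>P\<in>U. \<one>\<^bsub>localization R P\<^esub>),
      ring.zero = (\<lambda>P\<in>U. \<zero>\<^bsub>localization R P\<^esub>),
      ring.add = (\<lambda>\<sigma> \<tau>. \<lambda>P\<in>U. \<sigma> P \<oplus>\<^bsub>localization R P\<^esub> \<tau> P)\<rparr>"

definition Spec ::
  "('a, 'm) ring_scheme \<Rightarrow> ('a set, 'a set \<Rightarrow> ('a \<times> 'a) set) ringed_space" where
  "Spec R =
     \<lparr>space_of = topology (zariski_open R),
      sections = Spec_sections R,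
      restr = (\<lambda>U V \<sigma>. restrict \<sigma> V)\<rparr>"

text \<open>The morphism from \<open>Spec B\<close> to \<open>Spec A\<close> induced by a ring homomorphism \<open>h\<close> from \<open>A\<close> to \<open>B\<close>.\<close>

definition Spec_map ::
  "('a, 'm) ring_scheme \<Rightarrow> ('b, 'n) ring_scheme \<Rightarrow> ('a \<Rightarrow> 'b) \<Rightarrow>
   ('b set, 'b set \<Rightarrow> ('b \<times> 'b) set, 'a set, 'a set \<Rightarrow> ('a \<times> 'a) set) mor" where
  "Spec_map A B h =
     (let h_inv = (\<lambda>P. {a \<in> carrier A. h a \<in> P}) in
      \<lparr>pt = h_inv,
       pull = (\<lambda>U \<sigma>. \<lambda>P \<in> {P \<in> Spec_points B. h_inv P \<in> U}.
                 \<Union>(a, s)\<in>\<sigma> (h_inv P). frac B P (h a) (h s))\<rparr>)"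


section \<open>Schemes, schemes of finite type, fibre products\<close>

text \<open>
  The ring \<open>R\<close> with \<open>X|U\<close> isomorphic to \<open>Spec R\<close> may be looked for in the type of the sections of \<open>X\<close>,
  because it is isomorphic to the ring of sections over \<open>U\<close>.
\<close>

definition affine_open :: "('x, 's) ringed_space \<Rightarrow> 'x set \<Rightarrow> bool" where
  "affine_open X U \<longleftrightarrow>
     is_open X U \<and> (\<exists>R :: 's ring. cring R \<and> lrs_isomorphic (open_subspace X U) (Spec R))"

definition scheme :: "('x, 's) ringed_space \<Rightarrow> bool" where
  "scheme X \<longleftrightarrow> locally_ringed_space X \<and> (\<forall>x \<in> points X. \<exists>U. x \<in> U \<and> affine_open X U)"

definition structure_hom ::
  "('a, 'm) ring_scheme \<Rightarrow> ('x, 's) ringed_space \<Rightarrow>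
   ('x, 's, 'a set, 'a set \<Rightarrow> ('a \<times> 'a) set) mor \<Rightarrow> 'x set \<Rightarrow> 'a \<Rightarrow> 's" where
  "structure_hom R X \<pi> U a =
     restr X (points X) U (pull \<pi> (Spec_points R) (\<lambda>P \<in> Spec_points R. frac R P a \<one>\<^bsub>R\<^esub>))"

definition finite_type ::
  "('a, 'm) ring_scheme \<Rightarrow> ('x, 's) ringed_space \<Rightarrow>
   ('x, 's, 'a set, 'a set \<Rightarrow> ('a \<times> 'a) set) mor \<Rightarrow> bool" where
  "finite_type R X \<pi> \<longleftrightarrow>
     (\<exists>\<U>. finite \<U> \<and> \<Union>\<U> = points X \<and>
        (\<forall>U\<in>\<U>. affine_open X U \<and>
           (\<exists>S. finite S \<and> S \<subseteq> carrier (sections X U) \<and>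
              carrier (sections X U) =
                generate_ring (sections X U) (structure_hom R X \<pi> U ` carrier R \<union> S))))"

text \<open>
  \<open>P\<close> with the projections \<open>p\<close> and \<open>q\<close> is a fibre product of \<open>f\<close> (from \<open>X\<close> to \<open>S\<close>) and \<open>g\<close> (from \<open>Z\<close>
  to \<open>S\<close>) in the category of schemes. The test schemes \<open>T\<close> are those with the same point and section
  types as \<open>P\<close>: HOL cannot quantify over types here, so the predicate holds for every genuine fibre
  product and, as a hypothesis, asks for nothing more.
\<close>

definition fibre_product ::
  "('b, 'c) ringed_space \<Rightarrow>
   ('x, 's) ringed_space \<Rightarrow> ('x, 's, 'b, 'c) mor \<Rightarrow>
   ('z, 'r) ringed_space \<Rightarrow> ('z, 'r, 'b, 'c) mor \<Rightarrow>
   ('y, 't) ringed_space \<Rightarrow> ('y, 't, 'x, 's) mor \<Rightarrow> ('y, 't, 'z, 'r) mor \<Rightarrow> bool" where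
  "fibre_product S X f Z g P p q \<longleftrightarrow>
     scheme P \<and> lrs_morphism P X p \<and> lrs_morphism P Z q \<and>
     mor_eq P S (mor_comp X f p) (mor_comp Z g q) \<and>
     (\<forall>(T :: ('y, 't) ringed_space) a b.
        scheme T \<and> lrs_morphism T X a \<and> lrs_morphism T Z b \<and>
        mor_eq T S (mor_comp X f a) (mor_comp Z g b) \<longrightarrow>
        (\<exists>h. lrs_morphism T P h \<and> mor_eq T X (mor_comp P p h) a \<and> mor_eq T Z (mor_comp P q h) b \<and>
           (\<forall>h'. lrs_morphism T P h' \<and> mor_eq T X (mor_comp P p h') a \<and>
                 mor_eq T Z (mor_comp P q h') b \<longrightarrow> mor_eq T P h' h)))"


section \<open>The algebraic simplices\<close>

text \<open>The multivariate polynomials over \<open>'k\<close> in the variables \<open>t\<^sub>0, t\<^sub>1, \<dots>\<close>\<close>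

type_synonym 'k mpoly = "(nat \<Rightarrow>\<^sub>0 nat) \<Rightarrow>\<^sub>0 'k"

definition Const :: "'k::field \<Rightarrow> 'k mpoly" where
  "Const c = Poly_Mapping.single 0 c"

definition Var :: "nat \<Rightarrow> 'k::field mpoly" where
  "Var i = Poly_Mapping.single (Poly_Mapping.single i 1) 1"

definition subst :: "(nat \<Rightarrow> 'k mpoly) \<Rightarrow> 'k::field mpoly \<Rightarrow> 'k mpoly" where
  "subst \<sigma> p =
     (\<Sum>m\<in>Poly_Mapping.keys p. Const (Poly_Mapping.lookup p m) *
        (\<Prod>i\<in>Poly_Mapping.keys m. \<sigma> i ^ Poly_Mapping.lookup m i))"

definition field_ring :: "'k::field ring" where
  "field_ring = \<lparr>carrier = UNIV, monoid.mult = (*), one = 1, ring.zero = 0, ring.add = (+)\<rparr>"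

definition poly_ring :: "nat \<Rightarrow> 'k::field mpoly ring" where
  "poly_ring n =
     \<lparr>carrier = {p. \<forall>m \<in> Poly_Mapping.keys p. Poly_Mapping.keys m \<subseteq> {..n}},
      monoid.mult = (*), one = 1, ring.zero = 0, ring.add = (+)\<rparr>"

definition simplex_ideal :: "nat \<Rightarrow> 'k::field mpoly set" where
  "simplex_ideal n = Idl\<^bsub>poly_ring n\<^esub> {(\<Sum>i\<le>n. Var i) - 1}"

definition simplex_ring :: "nat \<Rightarrow> 'k::field mpoly set ring" where
  "simplex_ring n = poly_ring n Quot simplex_ideal n"

definition residue :: "nat \<Rightarrow> 'k::field mpoly \<Rightarrow> 'k mpoly set" where
  "residue n p = simplex_ideal n +>\<^bsub>poly_ring n\<^esub> p"

type_synonym 'k simplex_point = "'k mpoly set set"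
type_synonym 'k simplex_section = "'k simplex_point \<Rightarrow> ('k mpoly set \<times> 'k mpoly set) set"

definition simplex :: "nat \<Rightarrow> ('k::field simplex_point, 'k simplex_section) ringed_space" where
  "simplex n = Spec (simplex_ring n)"

definition simplex_str ::
  "nat \<Rightarrow> ('k::field simplex_point, 'k simplex_section, 'k set, 'k set \<Rightarrow> ('k \<times> 'k) set) mor" where
  "simplex_str n = Spec_map field_ring (simplex_ring n) (\<lambda>c. residue n (Const c))"

text \<open>
  The homomorphism \<open>simplex_ring n \<rightarrow> simplex_ring m\<close> of \<open>k\<close>-algebras that sends the class of \<open>t\<^sub>i\<close> to the
  class of \<open>\<sigma> i\<close>.
\<close>

definition simplex_hom :: "nat \<Rightarrow> (nat \<Rightarrow> 'k mpoly) \<Rightarrow> 'k::field mpoly set \<Rightarrow> 'k mpoly set" where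
  "simplex_hom m \<sigma> C = (\<Union>p\<in>C. residue m (subst \<sigma> p))"

type_synonym 'k simplex_mor =
  "('k simplex_point, 'k simplex_section, 'k simplex_point, 'k simplex_section) mor"

text \<open>\<open>coface n j\<close> is \<open>\<partial>\<^sub>j\<close> from \<open>\<Delta>\<^bsup>n-1\<^esup>\<close> to \<open>\<Delta>\<^sup>n\<close>, for \<open>n \<ge> 1\<close> and \<open>j \<le> n\<close>.\<close>

definition coface :: "nat \<Rightarrow> nat \<Rightarrow> 'k::field simplex_mor" where
  "coface n j = Spec_map (simplex_ring n) (simplex_ring (n - 1))
     (simplex_hom (n - 1) (\<lambda>i. if i < j then Var i else if i = j then 0 else Var (i - 1)))"

text \<open>\<open>cyclic n\<close> is \<open>Spec (T\<^sub>n\<inverse>)\<close>.\<close>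

definition cyclic :: "nat \<Rightarrow> 'k::field simplex_mor" where
  "cyclic n = Spec_map (simplex_ring n) (simplex_ring n)
     (simplex_hom n (\<lambda>i. if i < n then Var (i + 1) else Var 0))"

definition simplex_face :: "nat \<Rightarrow> nat set \<Rightarrow> 'k::field simplex_point set" where
  "simplex_face n I = {P \<in> points (simplex n). \<forall>i\<in>I. residue n (Var i) \<in> P}"


section \<open>Subvarieties and cycles\<close>

definition irreducible_closedin :: "'x topology \<Rightarrow> 'x set \<Rightarrow> bool" where
  "irreducible_closedin T V \<longleftrightarrow> closedin T V \<and> V \<noteq> {} \<and>
     (\<forall>A B. closedin T A \<and> closedin T B \<and> V \<subseteq> A \<union> B \<longrightarrow> V \<subseteq> A \<or> V \<subseteq> B)"

definition irreducible_components :: "'x topology \<Rightarrow> 'x set \<Rightarrow> 'x set set" where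
  "irreducible_components T C =
     {W. irreducible_closedin T W \<and> W \<subseteq> C \<and>
         (\<forall>W'. irreducible_closedin T W' \<and> W \<subseteq> W' \<and> W' \<subseteq> C \<longrightarrow> W' = W)}"

definition irreducible_chain :: "'x topology \<Rightarrow> nat \<Rightarrow> (nat \<Rightarrow> 'x set) \<Rightarrow> bool" where
  "irreducible_chain T r Z \<longleftrightarrow>
     (\<forall>i\<le>r. irreducible_closedin T (Z i)) \<and> (\<forall>i<r. Z i \<subset> Z (Suc i))"

definition dimension :: "'x topology \<Rightarrow> 'x set \<Rightarrow> enat" where
  "dimension T V = Sup {enat r | r Z. irreducible_chain T r Z \<and> Z r \<subseteq> V}"

definition codimension :: "'x topology \<Rightarrow> 'x set \<Rightarrow> 'x set \<Rightarrow> enat" where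
  "codimension T W V = Sup {enat r | r Z. irreducible_chain T r Z \<and> Z 0 = W \<and> Z r = V}"

definition generic_point :: "'x topology \<Rightarrow> 'x set \<Rightarrow> 'x" where
  "generic_point T W = (THE w. w \<in> topspace T \<and> T closure_of {w} = W)"

text \<open>
  A closed subvariety (integral closed subscheme) of a scheme is represented by its underlying
  irreducible closed set \<open>V\<close>; the scheme structure is the reduced one. Its ideal sheaf consists of the
  functions that vanish on \<open>V\<close>, and \<open>ideal_stalk Y V y\<close> is the stalk of that sheaf.
\<close>

definition ideal_stalk :: "('y, 't) ringed_space \<Rightarrow> 'y set \<Rightarrow> 'y \<Rightarrow> ('y set \<times> 't) set set" where
  "ideal_stalk Y V y =
     {germ Y y U s | U s. is_open Y U \<and> y \<in> U \<and> s \<in> carrier (sections Y U) \<and>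
        (\<forall>v \<in> U \<inter> V. germ Y v U s \<in> nonunits (stalk Y v))}"

definition ring_length :: "('a, 'm) ring_scheme \<Rightarrow> enat" where
  "ring_length R = Sup {enat r | r I. (\<forall>i\<le>r. ideal (I i) R) \<and> (\<forall>i<r. I i \<subset> (I (Suc i) :: 'a set))}"

text \<open>
  The pullback of \<open>[V]\<close> along \<open>f\<close> from \<open>Z\<close> to \<open>Y\<close> is the cycle of the scheme-theoretic preimage of \<open>V\<close>:
  every irreducible component \<open>W\<close>, with generic point \<open>w\<close>, counts with the length of the local ring
  \<open>\<O>\<^bsub>Z,w\<^esub> / I\<^sub>V \<O>\<^bsub>Z,w\<^esub>\<close> of the preimage at \<open>w\<close>. For flat \<open>f\<close> this is flat pullback. For the inclusion of
  an effective Cartier divisor \<open>D\<close> that does not contain \<open>V\<close> it is the intersection cycle \<open>D \<cdot> V\<close>.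
\<close>

definition pullback_subvariety ::
  "('z, 'r) ringed_space \<Rightarrow> ('y, 't) ringed_space \<Rightarrow> ('z, 'r, 'y, 't) mor \<Rightarrow>
   'y set \<Rightarrow> ('z set \<Rightarrow>\<^sub>0 int)" where
  "pullback_subvariety Z Y f V =
     (\<Sum>W \<in> irreducible_components (space_of Z) (preim Z f V).
        let w = generic_point (space_of Z) W;
            J = Idl\<^bsub>stalk Z w\<^esub> (stalk_map Z f w ` ideal_stalk Y V (pt f w))
        in frag_cmul (int (the_enat (ring_length (stalk Z w Quot J)))) (frag_of W))"

definition pullback_cycle ::
  "('z, 'r) ringed_space \<Rightarrow> ('y, 't) ringed_space \<Rightarrow> ('z, 'r, 'y, 't) mor \<Rightarrow>
   ('y set \<Rightarrow>\<^sub>0 int) \<Rightarrow> ('z set \<Rightarrow>\<^sub>0 int)" where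
  "pullback_cycle Z Y f = frag_extend (pullback_subvariety Z Y f)"


section \<open>Higher Chow cycle groups\<close>

text \<open>
  Below, \<open>Y n\<close> is the product \<open>X \<times>\<^sub>k \<Delta>\<^sup>n\<close> with projections \<open>p n\<close> to \<open>X\<close> and \<open>q n\<close> to \<open>\<Delta>\<^sup>n\<close>, so that
  \<open>preim (Y n) (q n) (simplex_face n I)\<close> is \<open>X \<times> F\<close> for the face \<open>F\<close> given by \<open>t\<^sub>i = 0\<close> for \<open>i \<in> I\<close>.
  The codimension of \<open>F\<close> in \<open>\<Delta>\<^sup>n\<close> is \<open>card I\<close>, unless \<open>F\<close> is empty.
\<close>

definition meets_faces_properly ::
  "(nat \<Rightarrow> ('y, 't) ringed_space) \<Rightarrow>
   (nat \<Rightarrow> ('y, 't, 'k::field simplex_point, 'k simplex_section) mor) \<Rightarrow>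
   nat \<Rightarrow> 'y set \<Rightarrow> bool" where
  "meets_faces_properly Y q n V \<longleftrightarrow>
     (\<forall>I \<subseteq> {..n}.
        \<forall>W \<in> irreducible_components (space_of (Y n)) (V \<inter> preim (Y n) (q n) (simplex_face n I)).
          codimension (space_of (Y n)) W V = enat (card I))"

text \<open>The group \<open>Z\<^sub>r(X, n)\<close>\<close>

definition higher_cycles ::
  "(nat \<Rightarrow> ('y, 't) ringed_space) \<Rightarrow>
   (nat \<Rightarrow> ('y, 't, 'k::field simplex_point, 'k simplex_section) mor) \<Rightarrow>
   int \<Rightarrow> nat \<Rightarrow> ('y set \<Rightarrow>\<^sub>0 int) monoid" where
  "higher_cycles Y q r n =
     free_Abelian_group
       {V. irreducible_closedin (space_of (Y n)) V \<and>
           (\<exists>d. dimension (space_of (Y n)) V = enat d \<and> r = int d) \<and>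
           meets_faces_properly Y q n V}"

text \<open>\<open>id_times X Y p q m n h\<close> is \<open>id\<^sub>X \<times> h\<close> from \<open>X \<times>\<^sub>k \<Delta>\<^sup>m\<close> to \<open>X \<times>\<^sub>k \<Delta>\<^sup>n\<close>, unique up to \<open>mor_eq\<close>.\<close>

definition id_times ::
  "('x, 's) ringed_space \<Rightarrow> (nat \<Rightarrow> ('y, 't) ringed_space) \<Rightarrow>
   (nat \<Rightarrow> ('y, 't, 'x, 's) mor) \<Rightarrow>
   (nat \<Rightarrow> ('y, 't, 'k::field simplex_point, 'k simplex_section) mor) \<Rightarrow>
   nat \<Rightarrow> nat \<Rightarrow> 'k simplex_mor \<Rightarrow> ('y, 't, 'y, 't) mor" where
  "id_times X Y p q m n h =
     (SOME g. lrs_morphism (Y m) (Y n) g \<and>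
        mor_eq (Y m) X (mor_comp (Y n) (p n) g) (p m) \<and>
        mor_eq (Y m) (simplex n) (mor_comp (Y n) (q n) g) (mor_comp (simplex m) h (q m)))"

text \<open>The face map \<open>d\<^sub>i\<close> on \<open>Z\<^sub>r(X, n)\<close>, for \<open>n \<ge> 1\<close> and \<open>i \<le> n\<close>, and the cyclic operator \<open>T\<^sub>n\<close>\<close>

definition face_map ::
  "('x, 's) ringed_space \<Rightarrow> (nat \<Rightarrow> ('y, 't) ringed_space) \<Rightarrow>
   (nat \<Rightarrow> ('y, 't, 'x, 's) mor) \<Rightarrow>
   (nat \<Rightarrow> ('y, 't, 'k::field simplex_point, 'k simplex_section) mor) \<Rightarrow>
   nat \<Rightarrow> nat \<Rightarrow> ('y set \<Rightarrow>\<^sub>0 int) \<Rightarrow> ('y set \<Rightarrow>\<^sub>0 int)" where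
  "face_map X Y p q n i =
     pullback_cycle (Y (n - 1)) (Y n) (id_times X Y p q (n - 1) n (coface n i))"

definition cyclic_op ::
  "('x, 's) ringed_space \<Rightarrow> (nat \<Rightarrow> ('y, 't) ringed_space) \<Rightarrow>
   (nat \<Rightarrow> ('y, 't, 'x, 's) mor) \<Rightarrow>
   (nat \<Rightarrow> ('y, 't, 'k::field simplex_point, 'k simplex_section) mor) \<Rightarrow>
   nat \<Rightarrow> ('y set \<Rightarrow>\<^sub>0 int) \<Rightarrow> ('y set \<Rightarrow>\<^sub>0 int)" where
  "cyclic_op X Y p q n = pullback_cycle (Y n) (Y n) (id_times X Y p q n n (cyclic n))"

end

theory Submission
  imports Defs
begin

text \<open>
  The maps \<open>id\<^sub>X \<times> h\<close> are determined by the universal property of the fibre product, so that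
  composites of them are governed by the cosimplicial identities between the ring homomorphisms
  \<open>t\<^sub>i \<mapsto> \<sigma>\<^sub>i\<close>. It remains to see that pullback of cycles respects the composites in question, which
  holds because one factor, \<open>id\<^sub>X \<times> Spec (T\<^sub>n\<inverse>)\<close>, is an isomorphism: the pullback of a subvariety \<open>V\<close>
  along an isomorphism is its preimage with multiplicity one, since \<open>V\<close> has a generic point and its
  ideal there is the maximal ideal of the local ring.
\<close>

section \<open>Stalks\<close>

text \<open>
  The ring axioms for the sections are not demanded, so that the results apply to spectra without
  a proof that their sections satisfy them.
\<close>

locale section_presheaf =
  fixes X :: "('x, 's) ringed_space"
  assumes mult_closed: "is_open X U \<Longrightarrow> s \<in> carrier (sections X U) \<Longrightarrow> t \<in> carrier (sections X U) \<Longrightarrow>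
      s \<otimes>\<^bsub>sections X U\<^esub> t \<in> carrier (sections X U)"
    and add_closed: "is_open X U \<Longrightarrow> s \<in> carrier (sections X U) \<Longrightarrow> t \<in> carrier (sections X U) \<Longrightarrow>
      s \<oplus>\<^bsub>sections X U\<^esub> t \<in> carrier (sections X U)"
    and one_closed: "is_open X U \<Longrightarrow> \<one>\<^bsub>sections X U\<^esub> \<in> carrier (sections X U)"
    and restr_hom: "is_open X U \<Longrightarrow> is_open X V \<Longrightarrow> V \<subseteq> U \<Longrightarrow>
      restr X U V \<in> ring_hom (sections X U) (sections X V)"
    and restr_id: "is_open X U \<Longrightarrow> s \<in> carrier (sections X U) \<Longrightarrow> restr X U U s = s"
    and restr_restr: "is_open X U \<Longrightarrow> is_open X V \<Longrightarrow> is_open X W \<Longrightarrow> W \<subseteq> V \<Longrightarrow> V \<subseteq> U \<Longrightarrow>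
      s \<in> carrier (sections X U) \<Longrightarrow> restr X V W (restr X U V s) = restr X U W s"

lemma section_presheafI:
  assumes "presheaf_of_rings X"
  shows "section_presheaf X"
proof
  have cring: "cring (sections X U)" if "is_open X U" for U
    using assms that by (simp add: presheaf_of_rings_def)
  fix U s t
  assume U: "is_open X U"
  then interpret cring "sections X U" by (rule cring)
  show "\<one>\<^bsub>sections X U\<^esub> \<in> carrier (sections X U)" by simp
  assume "s \<in> carrier (sections X U)" "t \<in> carrier (sections X U)"
  then show "s \<otimes>\<^bsub>sections X U\<^esub> t \<in> carrier (sections X U)"
    "s \<oplus>\<^bsub>sections X U\<^esub> t \<in> carrier (sections X U)" by simp_all
next
  show "is_open X U \<Longrightarrow> is_open X V \<Longrightarrow> V \<subseteq> U \<Longrightarrow>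
      restr X U V \<in> ring_hom (sections X U) (sections X V)" for U V
    using assms by (simp add: presheaf_of_rings_def)
  show "is_open X U \<Longrightarrow> s \<in> carrier (sections X U) \<Longrightarrow> restr X U U s = s" for U s
    using assms by (simp add: presheaf_of_rings_def)
  show "is_open X U \<Longrightarrow> is_open X V \<Longrightarrow> is_open X W \<Longrightarrow> W \<subseteq> V \<Longrightarrow> V \<subseteq> U \<Longrightarrow>
      s \<in> carrier (sections X U) \<Longrightarrow> restr X V W (restr X U V s) = restr X U W s" for U V W s
    using assms unfolding presheaf_of_rings_def by blast
qed

lemma scheme_section_presheaf: "scheme X \<Longrightarrow> section_presheaf X"
  by (simp add: scheme_def locally_ringed_space_def sheaf_of_rings_def section_presheafI)

lemma scheme_local_ring_stalk: "scheme X \<Longrightarrow> x \<in> points X \<Longrightarrow> local_ring (stalk X x)"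
  by (simp add: scheme_def locally_ringed_space_def)

lemma mem_germ_self:
  assumes "is_open X U" "x \<in> U" "s \<in> carrier (sections X U)"
  shows "(U, s) \<in> germ X x U s"
  using assms by (auto simp: germ_def)

lemma mem_germD:
  assumes "(V, t) \<in> germ X x U s"
  shows "is_open X V" "x \<in> V" "t \<in> carrier (sections X V)"
    "\<exists>W. is_open X W \<and> x \<in> W \<and> W \<subseteq> U \<inter> V \<and> restr X U W s = restr X V W t"
  using assms by (auto simp: germ_def)

lemma germ_eqD:
  assumes "germ X x U s = germ X x V t" "is_open X V" "x \<in> V" "t \<in> carrier (sections X V)"
  shows "\<exists>W. is_open X W \<and> x \<in> W \<and> W \<subseteq> U \<inter> V \<and> restr X U W s = restr X V W t"
  using mem_germD(4)[of V t X x U s] mem_germ_self[OF assms(2-4)] by (simp only: assms(1))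

lemma germ_in_stalk:
  "is_open X U \<Longrightarrow> x \<in> U \<Longrightarrow> s \<in> carrier (sections X U) \<Longrightarrow> germ X x U s \<in> carrier (stalk X x)"
  by (auto simp: stalk_def)

lemma stalkE:
  assumes "c \<in> carrier (stalk X x)"
  obtains U s where "c = germ X x U s" "is_open X U" "x \<in> U" "s \<in> carrier (sections X U)"
  using assms by (auto simp: stalk_def)

lemma one_stalk: "\<one>\<^bsub>stalk X x\<^esub> = germ X x (points X) \<one>\<^bsub>sections X (points X)\<^esub>"
  by (simp add: stalk_def)

lemma UN_pairs_eq:
  assumes "(a, b) \<in> A" "\<And>a b. (a, b) \<in> A \<Longrightarrow> F a b = C"
  shows "(\<Union>(a, b)\<in>A. F a b) = C"
proof
  show "(\<Union>(a, b)\<in>A. F a b) \<subseteq> C" using assms(2) by auto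
  show "C \<subseteq> (\<Union>(a, b)\<in>A. F a b)" using assms(2)[OF assms(1)] assms(1) by auto
qed

context section_presheaf
begin

lemma restr_closed:
  "is_open X U \<Longrightarrow> is_open X V \<Longrightarrow> V \<subseteq> U \<Longrightarrow> s \<in> carrier (sections X U) \<Longrightarrow>
    restr X U V s \<in> carrier (sections X V)"
  by (rule ring_hom_closed[OF restr_hom])

lemma restr_mult:
  "is_open X U \<Longrightarrow> is_open X V \<Longrightarrow> V \<subseteq> U \<Longrightarrow> s \<in> carrier (sections X U) \<Longrightarrow>
    t \<in> carrier (sections X U) \<Longrightarrow>
    restr X U V (s \<otimes>\<^bsub>sections X U\<^esub> t) = restr X U V s \<otimes>\<^bsub>sections X V\<^esub> restr X U V t"
  by (rule ring_hom_mult[OF restr_hom])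

lemma restr_add:
  "is_open X U \<Longrightarrow> is_open X V \<Longrightarrow> V \<subseteq> U \<Longrightarrow> s \<in> carrier (sections X U) \<Longrightarrow>
    t \<in> carrier (sections X U) \<Longrightarrow>
    restr X U V (s \<oplus>\<^bsub>sections X U\<^esub> t) = restr X U V s \<oplus>\<^bsub>sections X V\<^esub> restr X U V t"
  by (rule ring_hom_add[OF restr_hom])

lemma restr_one:
  "is_open X U \<Longrightarrow> is_open X V \<Longrightarrow> V \<subseteq> U \<Longrightarrow> restr X U V \<one>\<^bsub>sections X U\<^esub> = \<one>\<^bsub>sections X V\<^esub>"
  by (rule ring_hom_one[OF restr_hom])

lemma germ_subset:
  assumes U: "is_open X U" "s \<in> carrier (sections X U)"
    and V: "is_open X V" "t \<in> carrier (sections X V)"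
    and W: "is_open X W" "x \<in> W" "W \<subseteq> U" "W \<subseteq> V" "restr X U W s = restr X V W t"
  shows "germ X x U s \<subseteq> germ X x V t"
proof clarify
  fix V' t' assume "(V', t') \<in> germ X x U s"
  note d = mem_germD[OF this]
  then obtain W' where W': "is_open X W'" "x \<in> W'" "W' \<subseteq> U" "W' \<subseteq> V'"
    "restr X U W' s = restr X V' W' t'" by auto
  have op: "is_open X (W \<inter> W')" using W W' by (simp add: openin_Int)
  have "restr X V (W \<inter> W') t = restr X W (W \<inter> W') (restr X V W t)"
    using V W op by (simp add: restr_restr)
  also have "\<dots> = restr X U (W \<inter> W') s"
    using U W op by (simp add: restr_restr flip: W(5))
  also have "\<dots> = restr X W' (W \<inter> W') (restr X U W' s)"
    using restr_restr[of U W' "W \<inter> W'" s] U W' op by simp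
  also have "\<dots> = restr X V' (W \<inter> W') t'"
    using d W' op by (simp add: restr_restr)
  finally have "restr X V (W \<inter> W') t = restr X V' (W \<inter> W') t'" .
  then show "(V', t') \<in> germ X x V t"
    using d(1-3) op W W' unfolding germ_def by blast
qed

lemma germ_eqI:
  assumes "is_open X U" "s \<in> carrier (sections X U)"
    and "is_open X V" "t \<in> carrier (sections X V)"
    and "is_open X W" "x \<in> W" "W \<subseteq> U" "W \<subseteq> V" "restr X U W s = restr X V W t"
  shows "germ X x U s = germ X x V t"
  using assms by (intro equalityI germ_subset[where W = W]) auto

lemma germ_restr:
  assumes "is_open X U" "s \<in> carrier (sections X U)" "is_open X V" "V \<subseteq> U" "x \<in> V"
  shows "germ X x V (restr X U V s) = germ X x U s"
  using assms restr_closed by (intro germ_eqI[where W = V]) (auto simp: restr_restr)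

lemma UN_germ_binop:
  assumes op_closed: "\<And>U a b. is_open X U \<Longrightarrow> a \<in> carrier (sections X U) \<Longrightarrow> b \<in> carrier (sections X U) \<Longrightarrow>
      f U a b \<in> carrier (sections X U)"
    and op_restr: "\<And>U V a b. is_open X U \<Longrightarrow> is_open X V \<Longrightarrow> V \<subseteq> U \<Longrightarrow> a \<in> carrier (sections X U) \<Longrightarrow>
      b \<in> carrier (sections X U) \<Longrightarrow> restr X U V (f U a b) = f V (restr X U V a) (restr X U V b)"
    and U: "is_open X U" "x \<in> U" "s \<in> carrier (sections X U)"
    and V: "is_open X V" "x \<in> V" "t \<in> carrier (sections X V)"
  shows "(\<Union>(U', s')\<in>germ X x U s. \<Union>(V', t')\<in>germ X x V t.
           germ X x (U' \<inter> V') (f (U' \<inter> V') (restr X U' (U' \<inter> V') s') (restr X V' (U' \<inter> V') t'))) =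
         germ X x (U \<inter> V) (f (U \<inter> V) (restr X U (U \<inter> V) s) (restr X V (U \<inter> V) t))"
proof -
  let ?g = "\<lambda>U' s' V' t'.
    germ X x (U' \<inter> V') (f (U' \<inter> V') (restr X U' (U' \<inter> V') s') (restr X V' (U' \<inter> V') t'))"
  have eq: "?g U' s' V' t' = ?g U s V t"
    if "(U', s') \<in> germ X x U s" "(V', t') \<in> germ X x V t" for U' s' V' t'
  proof -
    note d = mem_germD[OF that(1)] and e = mem_germD[OF that(2)]
    obtain W1 where W1: "is_open X W1" "x \<in> W1" "W1 \<subseteq> U \<inter> U'" "restr X U W1 s = restr X U' W1 s'"
      using d(4) by blast
    obtain W2 where W2: "is_open X W2" "x \<in> W2" "W2 \<subseteq> V \<inter> V'" "restr X V W2 t = restr X V' W2 t'"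
      using e(4) by blast
    let ?W = "W1 \<inter> W2"
    have op: "is_open X ?W" "is_open X (U \<inter> V)" "is_open X (U' \<inter> V')"
      using W1 W2 U V d e by (auto simp: openin_Int)
    have r: "restr X (A \<inter> B) ?W (f (A \<inter> B) (restr X A (A \<inter> B) a) (restr X B (A \<inter> B) b)) =
        f ?W (restr X A ?W a) (restr X B ?W b)"
      if "is_open X A" "is_open X B" "a \<in> carrier (sections X A)" "b \<in> carrier (sections X B)"
        "?W \<subseteq> A \<inter> B" for A B a b
    proof -
      have "is_open X (A \<inter> B)" using that by (simp add: openin_Int)
      then show ?thesis using that op by (simp add: op_restr restr_closed restr_restr)
    qed
    have "restr X U ?W s = restr X U' ?W s'"
      using restr_restr[of U W1 ?W s] restr_restr[of U' W1 ?W s'] U d W1 op by auto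
    moreover have "restr X V ?W t = restr X V' ?W t'"
      using restr_restr[of V W2 ?W t] restr_restr[of V' W2 ?W t'] V e W2 op by auto
    moreover have "?W \<subseteq> U \<inter> V" "?W \<subseteq> U' \<inter> V'" "x \<in> ?W" using W1 W2 by auto
    ultimately show ?thesis
      using U V d e op
      by (intro germ_eqI[where W = ?W]) (auto simp: r op_closed restr_closed)
  qed
  have "(\<Union>(V', t')\<in>germ X x V t. ?g U' s' V' t') = ?g U s V t"
    if "(U', s') \<in> germ X x U s" for U' s'
    by (rule UN_pairs_eq[OF mem_germ_self[OF V]]) (rule eq[OF that])
  then show ?thesis
    by (rule UN_pairs_eq[OF mem_germ_self[OF U]])
qed

lemma stalk_mult:
  assumes "is_open X U" "x \<in> U" "s \<in> carrier (sections X U)"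
    and "is_open X V" "x \<in> V" "t \<in> carrier (sections X V)"
  shows "germ X x U s \<otimes>\<^bsub>stalk X x\<^esub> germ X x V t =
    germ X x (U \<inter> V) (restr X U (U \<inter> V) s \<otimes>\<^bsub>sections X (U \<inter> V)\<^esub> restr X V (U \<inter> V) t)"
  using UN_germ_binop[of "\<lambda>U. (\<otimes>\<^bsub>sections X U\<^esub>)", OF _ _ assms]
  by (simp add: stalk_def mult_closed restr_mult)

lemma stalk_add:
  assumes "is_open X U" "x \<in> U" "s \<in> carrier (sections X U)"
    and "is_open X V" "x \<in> V" "t \<in> carrier (sections X V)"
  shows "germ X x U s \<oplus>\<^bsub>stalk X x\<^esub> germ X x V t =
    germ X x (U \<inter> V) (restr X U (U \<inter> V) s \<oplus>\<^bsub>sections X (U \<inter> V)\<^esub> restr X V (U \<inter> V) t)"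
  using UN_germ_binop[of "\<lambda>U. (\<oplus>\<^bsub>sections X U\<^esub>)", OF _ _ assms]
  by (simp add: stalk_def add_closed restr_add)

lemma germ_one:
  assumes "is_open X U" "x \<in> U"
  shows "germ X x U \<one>\<^bsub>sections X U\<^esub> = \<one>\<^bsub>stalk X x\<^esub>"
proof -
  have "U \<subseteq> points X" using assms by (simp add: openin_subset)
  then show ?thesis
    using assms unfolding one_stalk by (intro germ_eqI[where W = U]) (auto simp: one_closed restr_one)
qed

lemma germ_mult_germ:
  assumes "is_open X U" "x \<in> U" "s \<in> carrier (sections X U)" "t \<in> carrier (sections X U)"
  shows "germ X x U s \<otimes>\<^bsub>stalk X x\<^esub> germ X x U t = germ X x U (s \<otimes>\<^bsub>sections X U\<^esub> t)"
  using assms by (simp add: stalk_mult restr_id)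

lemma germ_add_germ:
  assumes "is_open X U" "x \<in> U" "s \<in> carrier (sections X U)" "t \<in> carrier (sections X U)"
  shows "germ X x U s \<oplus>\<^bsub>stalk X x\<^esub> germ X x U t = germ X x U (s \<oplus>\<^bsub>sections X U\<^esub> t)"
  using assms by (simp add: stalk_add restr_id)

lemma germ_eq_one:
  assumes U: "is_open X U" "x \<in> U" "s \<in> carrier (sections X U)"
    and eq: "germ X x U s = \<one>\<^bsub>stalk X x\<^esub>"
  shows "\<exists>W. is_open X W \<and> x \<in> W \<and> W \<subseteq> U \<and> restr X U W s = \<one>\<^bsub>sections X W\<^esub>"
proof -
  have "U \<subseteq> points X" using U by (simp add: openin_subset)
  then obtain W where W: "is_open X W" "x \<in> W" "W \<subseteq> U"
    "restr X U W s = restr X (points X) W \<one>\<^bsub>sections X (points X)\<^esub>"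
    using germ_eqD[OF eq[unfolded one_stalk]] one_closed U(2) by auto
  then have "restr X U W s = \<one>\<^bsub>sections X W\<^esub>"
    by (simp add: restr_one openin_subset)
  with W show ?thesis by blast
qed

lemma common_germs:
  assumes "c \<in> carrier (stalk X x)" "d \<in> carrier (stalk X x)"
  obtains U s t where "is_open X U" "x \<in> U" "s \<in> carrier (sections X U)" "t \<in> carrier (sections X U)"
    "c = germ X x U s" "d = germ X x U t"
proof -
  obtain U s where U: "c = germ X x U s" "is_open X U" "x \<in> U" "s \<in> carrier (sections X U)"
    using assms(1) by (rule stalkE)
  obtain V t where V: "d = germ X x V t" "is_open X V" "x \<in> V" "t \<in> carrier (sections X V)"
    using assms(2) by (rule stalkE)
  show ?thesis
  proof (rule that)
    show op: "is_open X (U \<inter> V)" using U V by (simp add: openin_Int)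
    show "restr X U (U \<inter> V) s \<in> carrier (sections X (U \<inter> V))"
      "restr X V (U \<inter> V) t \<in> carrier (sections X (U \<inter> V))"
      using U V op by (auto simp: restr_closed)
    show "c = germ X x (U \<inter> V) (restr X U (U \<inter> V) s)" "d = germ X x (U \<inter> V) (restr X V (U \<inter> V) t)"
      using U V op by (auto simp: germ_restr)
  qed (use U V in auto)
qed

lemma germ_Units_iff:
  assumes U: "is_open X U" "x \<in> U" "s \<in> carrier (sections X U)"
  shows "germ X x U s \<in> Units (stalk X x) \<longleftrightarrow>
    (\<exists>W. is_open X W \<and> x \<in> W \<and> W \<subseteq> U \<and> restr X U W s \<in> Units (sections X W))"
proof
  assume "germ X x U s \<in> Units (stalk X x)"
  then obtain d where d: "d \<in> carrier (stalk X x)"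
    "d \<otimes>\<^bsub>stalk X x\<^esub> germ X x U s = \<one>\<^bsub>stalk X x\<^esub>" "germ X x U s \<otimes>\<^bsub>stalk X x\<^esub> d = \<one>\<^bsub>stalk X x\<^esub>"
    by (auto simp: Units_def)
  obtain V t where V: "d = germ X x V t" "is_open X V" "x \<in> V" "t \<in> carrier (sections X V)"
    using d(1) by (rule stalkE)
  let ?s = "restr X U (U \<inter> V) s" and ?t = "restr X V (U \<inter> V) t"
  have op: "is_open X (U \<inter> V)" using U V by (simp add: openin_Int)
  have c: "?s \<in> carrier (sections X (U \<inter> V))" "?t \<in> carrier (sections X (U \<inter> V))"
    using U V op by (auto simp: restr_closed)
  have g: "germ X x U s = germ X x (U \<inter> V) ?s" "d = germ X x (U \<inter> V) ?t"
    using U V op by (auto simp: germ_restr)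
  have x: "x \<in> U \<inter> V" using U V by auto
  obtain W1 where W1: "is_open X W1" "x \<in> W1" "W1 \<subseteq> U \<inter> V"
    "restr X (U \<inter> V) W1 (?t \<otimes>\<^bsub>sections X (U \<inter> V)\<^esub> ?s) = \<one>\<^bsub>sections X W1\<^esub>"
    using germ_eq_one[OF op x mult_closed[OF op c(2,1)]] d(2) g c op x by (auto simp: germ_mult_germ)
  obtain W2 where W2: "is_open X W2" "x \<in> W2" "W2 \<subseteq> U \<inter> V"
    "restr X (U \<inter> V) W2 (?s \<otimes>\<^bsub>sections X (U \<inter> V)\<^esub> ?t) = \<one>\<^bsub>sections X W2\<^esub>"
    using germ_eq_one[OF op x mult_closed[OF op c]] d(3) g c op x by (auto simp: germ_mult_germ)
  let ?W = "W1 \<inter> W2"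
  have W: "is_open X ?W" "x \<in> ?W" "?W \<subseteq> U \<inter> V" using W1 W2 by (auto simp: openin_Int)
  have "restr X (U \<inter> V) ?W (?t \<otimes>\<^bsub>sections X (U \<inter> V)\<^esub> ?s) = \<one>\<^bsub>sections X ?W\<^esub>"
    using restr_restr[OF op W1(1) W(1) Int_lower1 W1(3) mult_closed[OF op c(2,1)]] W1 W(1)
    by (simp add: restr_one)
  moreover have "restr X (U \<inter> V) ?W (?s \<otimes>\<^bsub>sections X (U \<inter> V)\<^esub> ?t) = \<one>\<^bsub>sections X ?W\<^esub>"
    using restr_restr[OF op W2(1) W(1) Int_lower2 W2(3) mult_closed[OF op c]] W2 W(1)
    by (simp add: restr_one)
  ultimately have "restr X (U \<inter> V) ?W ?s \<in> Units (sections X ?W)"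
    using W c op restr_closed[OF op W(1,3)] by (auto simp: Units_def restr_mult)
  moreover have "restr X (U \<inter> V) ?W ?s = restr X U ?W s"
    using U W op by (simp add: restr_restr)
  ultimately show "\<exists>W. is_open X W \<and> x \<in> W \<and> W \<subseteq> U \<and> restr X U W s \<in> Units (sections X W)"
    using W by auto
next
  assume "\<exists>W. is_open X W \<and> x \<in> W \<and> W \<subseteq> U \<and> restr X U W s \<in> Units (sections X W)"
  then obtain W t where W: "is_open X W" "x \<in> W" "W \<subseteq> U" and
    t: "t \<in> carrier (sections X W)" "t \<otimes>\<^bsub>sections X W\<^esub> restr X U W s = \<one>\<^bsub>sections X W\<^esub>"
      "restr X U W s \<otimes>\<^bsub>sections X W\<^esub> t = \<one>\<^bsub>sections X W\<^esub>"
    by (auto simp: Units_def)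
  have s: "restr X U W s \<in> carrier (sections X W)" using U W by (simp add: restr_closed)
  have "germ X x W (restr X U W s) \<in> Units (stalk X x)"
    using t s W unfolding Units_def
    by (auto simp: germ_in_stalk germ_mult_germ germ_one intro!: bexI[of _ "germ X x W t"])
  then show "germ X x U s \<in> Units (stalk X x)" using U W by (simp add: germ_restr)
qed

end

section \<open>Morphisms\<close>

lemma mem_preim: "x \<in> preim X f U \<longleftrightarrow> x \<in> points X \<and> pt f x \<in> U"
  by (simp add: preim_def)

lemma preim_mono: "U \<subseteq> V \<Longrightarrow> preim X f U \<subseteq> preim X f V"
  by (auto simp: preim_def)

locale ringed_morphism = X: section_presheaf X
  for X :: "('x, 's) ringed_space" +
  fixes Y :: "('y, 't) ringed_space" and f :: "('x, 's, 'y, 't) mor"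
  assumes cont: "continuous_map (space_of X) (space_of Y) (pt f)"
    and pull_hom: "is_open Y U \<Longrightarrow> pull f U \<in> ring_hom (sections Y U) (sections X (preim X f U))"
    and pull_restr: "is_open Y U \<Longrightarrow> is_open Y V \<Longrightarrow> V \<subseteq> U \<Longrightarrow> s \<in> carrier (sections Y U) \<Longrightarrow>
      pull f V (restr Y U V s) = restr X (preim X f U) (preim X f V) (pull f U s)"
begin

lemma pt_in: "x \<in> points X \<Longrightarrow> pt f x \<in> points Y"
  using cont by (auto simp: continuous_map_def)

lemma open_preim: "is_open Y U \<Longrightarrow> is_open X (preim X f U)"
  unfolding preim_def using cont by (rule openin_continuous_map_preimage)

lemma pull_closed:
  "is_open Y U \<Longrightarrow> s \<in> carrier (sections Y U) \<Longrightarrow> pull f U s \<in> carrier (sections X (preim X f U))"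
  by (rule ring_hom_closed[OF pull_hom])

lemma pull_mult:
  "is_open Y U \<Longrightarrow> s \<in> carrier (sections Y U) \<Longrightarrow> t \<in> carrier (sections Y U) \<Longrightarrow>
    pull f U (s \<otimes>\<^bsub>sections Y U\<^esub> t) = pull f U s \<otimes>\<^bsub>sections X (preim X f U)\<^esub> pull f U t"
  by (rule ring_hom_mult[OF pull_hom])

lemma pull_add:
  "is_open Y U \<Longrightarrow> s \<in> carrier (sections Y U) \<Longrightarrow> t \<in> carrier (sections Y U) \<Longrightarrow>
    pull f U (s \<oplus>\<^bsub>sections Y U\<^esub> t) = pull f U s \<oplus>\<^bsub>sections X (preim X f U)\<^esub> pull f U t"
  by (rule ring_hom_add[OF pull_hom])

lemma pull_one: "is_open Y U \<Longrightarrow> pull f U \<one>\<^bsub>sections Y U\<^esub> = \<one>\<^bsub>sections X (preim X f U)\<^esub>"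
  by (rule ring_hom_one[OF pull_hom])

lemma stalk_map_germ:
  assumes x: "x \<in> points X" and U: "is_open Y U" "pt f x \<in> U" "s \<in> carrier (sections Y U)"
  shows "stalk_map X f x (germ Y (pt f x) U s) = germ X x (preim X f U) (pull f U s)"
  unfolding stalk_map_def
proof (rule UN_pairs_eq[OF mem_germ_self[OF U]])
  fix V t assume "(V, t) \<in> germ Y (pt f x) U s"
  note d = mem_germD[OF this]
  then obtain W where W: "is_open Y W" "pt f x \<in> W" "W \<subseteq> U" "W \<subseteq> V" "restr Y U W s = restr Y V W t"
    by auto
  show "germ X x (preim X f V) (pull f V t) = germ X x (preim X f U) (pull f U s)"
  proof (rule X.germ_eqI[where W = "preim X f W"])
    show "restr X (preim X f V) (preim X f W) (pull f V t) = restr X (preim X f U) (preim X f W) (pull f U s)"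
      using U W d pull_restr[of U W s] pull_restr[of V W t] by simp
  qed (use x U W d in \<open>simp_all add: open_preim pull_closed mem_preim preim_mono\<close>)
qed

lemma stalk_map_closed:
  assumes "x \<in> points X" "c \<in> carrier (stalk Y (pt f x))"
  shows "stalk_map X f x c \<in> carrier (stalk X x)"
  using assms(2)
proof (rule stalkE)
  fix U s assume "c = germ Y (pt f x) U s" "is_open Y U" "pt f x \<in> U" "s \<in> carrier (sections Y U)"
  then show ?thesis
    using assms(1) by (simp add: stalk_map_germ mem_preim germ_in_stalk open_preim pull_closed)
qed

lemma stalk_map_hom:
  assumes "section_presheaf Y" and x: "x \<in> points X"
  shows "stalk_map X f x \<in> ring_hom (stalk Y (pt f x)) (stalk X x)"
proof (rule ring_hom_memI)
  interpret Y: section_presheaf Y by fact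
  have xp: "x \<in> preim X f U" if "pt f x \<in> U" for U
    using x that by (simp add: preim_def)
  fix c assume c: "c \<in> carrier (stalk Y (pt f x))"
  then show "stalk_map X f x c \<in> carrier (stalk X x)" by (rule stalk_map_closed[OF x])
  fix d assume d: "d \<in> carrier (stalk Y (pt f x))"
  obtain U s t where *: "is_open Y U" "pt f x \<in> U" "s \<in> carrier (sections Y U)"
    "t \<in> carrier (sections Y U)" "c = germ Y (pt f x) U s" "d = germ Y (pt f x) U t"
    using Y.common_germs[OF c d] .
  show "stalk_map X f x (c \<otimes>\<^bsub>stalk Y (pt f x)\<^esub> d) = stalk_map X f x c \<otimes>\<^bsub>stalk X x\<^esub> stalk_map X f x d"
    using * by (simp add: x xp Y.germ_mult_germ X.germ_mult_germ stalk_map_germ Y.mult_closed pull_mult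
      open_preim pull_closed)
  show "stalk_map X f x (c \<oplus>\<^bsub>stalk Y (pt f x)\<^esub> d) = stalk_map X f x c \<oplus>\<^bsub>stalk X x\<^esub> stalk_map X f x d"
    using * by (simp add: x xp Y.germ_add_germ X.germ_add_germ stalk_map_germ Y.add_closed pull_add
      open_preim pull_closed)
next
  interpret Y: section_presheaf Y by fact
  have "pt f x \<in> points Y" using x by (rule pt_in)
  moreover have "preim X f (points Y) = points X" using pt_in by (auto simp: preim_def)
  ultimately show "stalk_map X f x \<one>\<^bsub>stalk Y (pt f x)\<^esub> = \<one>\<^bsub>stalk X x\<^esub>"
    using x pull_one[of "points Y"] by (simp add: one_stalk stalk_map_germ Y.one_closed)
qed

end

lemma lrs_morphism_iff:
  assumes "section_presheaf X"
  shows "lrs_morphism X Y f \<longleftrightarrow> ringed_morphism X Y f \<and>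
     (\<forall>x \<in> points X. \<forall>c \<in> carrier (stalk Y (pt f x)).
        stalk_map X f x c \<in> Units (stalk X x) \<longrightarrow> c \<in> Units (stalk Y (pt f x)))"
  using assms unfolding lrs_morphism_def ringed_morphism_def ringed_morphism_axioms_def Ball_def by auto

lemma lrs_morphism_ringed:
  "section_presheaf X \<Longrightarrow> lrs_morphism X Y f \<Longrightarrow> ringed_morphism X Y f"
  by (simp add: lrs_morphism_iff)

lemma lrs_morphism_reflects_Units:
  "lrs_morphism X Y f \<Longrightarrow> x \<in> points X \<Longrightarrow> c \<in> carrier (stalk Y (pt f x)) \<Longrightarrow>
    stalk_map X f x c \<in> Units (stalk X x) \<Longrightarrow> c \<in> Units (stalk Y (pt f x))"
  by (simp add: lrs_morphism_def)

lemma pt_mor_comp [simp]: "pt (mor_comp Y g f) x = pt g (pt f x)"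
  by (simp add: mor_comp_def)

lemma pull_mor_comp [simp]: "pull (mor_comp Y g f) U s = pull f (preim Y g U) (pull g U s)"
  by (simp add: mor_comp_def)

lemma preim_mor_comp:
  assumes "\<And>x. x \<in> points X \<Longrightarrow> pt f x \<in> points Y"
  shows "preim X (mor_comp Y g f) U = preim X f (preim Y g U)"
  using assms by (auto simp: preim_def)

lemma ringed_morphism_comp:
  assumes "ringed_morphism X Y f" "ringed_morphism Y Z g"
  shows "ringed_morphism X Z (mor_comp Y g f)"
proof -
  interpret f: ringed_morphism X Y f by fact
  interpret g: ringed_morphism Y Z g by fact
  have p: "preim X (mor_comp Y g f) U = preim X f (preim Y g U)" for U
    by (rule preim_mor_comp) (rule f.pt_in)
  show ?thesis
  proof
    show "continuous_map (space_of X) (space_of Z) (pt (mor_comp Y g f))"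
      using f.cont g.cont by (simp add: mor_comp_def continuous_map_compose)
    show "pull (mor_comp Y g f) U \<in> ring_hom (sections Z U) (sections X (preim X (mor_comp Y g f) U))"
      if "is_open Z U" for U
      unfolding p using ring_hom_trans[OF g.pull_hom[OF that] f.pull_hom[OF g.open_preim[OF that]]]
      by (simp add: mor_comp_def)
    show "pull (mor_comp Y g f) V (restr Z U V s) =
        restr X (preim X (mor_comp Y g f) U) (preim X (mor_comp Y g f) V) (pull (mor_comp Y g f) U s)"
      if "is_open Z U" "is_open Z V" "V \<subseteq> U" "s \<in> carrier (sections Z U)" for U V s
    proof -
      have "preim Y g V \<subseteq> preim Y g U" using that(3) by (auto simp: preim_def)
      then show ?thesis
        using that by (simp add: p g.pull_restr f.pull_restr g.open_preim g.pull_closed)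
    qed
  qed
qed

lemma stalk_map_comp:
  assumes f: "ringed_morphism X Y f" and g: "ringed_morphism Y Z g"
    and x: "x \<in> points X" and c: "c \<in> carrier (stalk Z (pt g (pt f x)))"
  shows "stalk_map X (mor_comp Y g f) x c = stalk_map X f x (stalk_map Y g (pt f x) c)"
proof -
  interpret f: ringed_morphism X Y f by fact
  interpret g: ringed_morphism Y Z g by fact
  interpret gf: ringed_morphism X Z "mor_comp Y g f" by (rule ringed_morphism_comp) fact+
  obtain U s where U: "c = germ Z (pt g (pt f x)) U s" "is_open Z U" "pt g (pt f x) \<in> U"
    "s \<in> carrier (sections Z U)"
    using c by (rule stalkE)
  have "pt f x \<in> points Y" using x by (rule f.pt_in)
  moreover from this have "pt f x \<in> preim Y g U" using U by (simp add: preim_def)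
  ultimately have "stalk_map X f x (stalk_map Y g (pt f x) c) =
      germ X x (preim X f (preim Y g U)) (pull f (preim Y g U) (pull g U s))"
    using U x by (simp add: g.stalk_map_germ f.stalk_map_germ g.open_preim g.pull_closed)
  moreover have "preim X (mor_comp Y g f) U = preim X f (preim Y g U)"
    by (rule preim_mor_comp) (rule f.pt_in)
  ultimately show ?thesis using gf.stalk_map_germ[of x U s] U x by simp
qed

lemma lrs_morphism_comp:
  assumes "section_presheaf X" "section_presheaf Y" and f: "lrs_morphism X Y f" and g: "lrs_morphism Y Z g"
  shows "lrs_morphism X Z (mor_comp Y g f)"
proof -
  interpret f: ringed_morphism X Y f using assms by (simp add: lrs_morphism_ringed)
  interpret g: ringed_morphism Y Z g using assms by (simp add: lrs_morphism_ringed)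
  note rm = f.ringed_morphism_axioms g.ringed_morphism_axioms
  have "c \<in> Units (stalk Z (pt g (pt f x)))"
    if "x \<in> points X" "c \<in> carrier (stalk Z (pt g (pt f x)))"
      "stalk_map X (mor_comp Y g f) x c \<in> Units (stalk X x)" for x c
  proof (rule lrs_morphism_reflects_Units[OF g f.pt_in[OF that(1)] that(2)])
    show "stalk_map Y g (pt f x) c \<in> Units (stalk Y (pt f x))"
      using that stalk_map_comp[OF rm] by (intro lrs_morphism_reflects_Units[OF f])
        (simp_all add: g.stalk_map_closed f.pt_in)
  qed
  then show ?thesis
    using assms ringed_morphism_comp[OF rm] by (simp add: lrs_morphism_iff)
qed

lemma mor_eq_sym: "mor_eq X Y f g \<Longrightarrow> mor_eq X Y g f"
  by (simp add: mor_eq_def)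

lemma mor_eq_trans: "mor_eq X Y f g \<Longrightarrow> mor_eq X Y g h \<Longrightarrow> mor_eq X Y f h"
  by (simp add: mor_eq_def)

lemma mor_eq_preim: "mor_eq X Y f g \<Longrightarrow> preim X f U = preim X g U"
  by (auto simp: mor_eq_def preim_def)

lemma mor_eq_comp_left:
  assumes f: "ringed_morphism X Y f" and eq: "mor_eq Y Z g g'"
  shows "mor_eq X Z (mor_comp Y g f) (mor_comp Y g' f)"
proof -
  interpret ringed_morphism X Y f by fact
  show ?thesis using eq mor_eq_preim[OF eq] pt_in by (simp add: mor_eq_def)
qed

lemma mor_eq_comp_right:
  assumes g: "ringed_morphism Y Z g" and eq: "mor_eq X Y f f'"
  shows "mor_eq X Z (mor_comp Y g f) (mor_comp Y g f')"
proof -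
  interpret ringed_morphism Y Z g by fact
  show ?thesis using eq open_preim pull_closed by (simp add: mor_eq_def)
qed

lemma mor_comp_assoc:
  assumes "ringed_morphism Y Z g"
  shows "mor_comp Z h (mor_comp Y g f) = mor_comp Y (mor_comp Z h g) f"
proof -
  interpret ringed_morphism Y Z g by fact
  have "preim Y (mor_comp Z h g) U = preim Y g (preim Z h U)" for U
    by (rule preim_mor_comp) (rule pt_in)
  then show ?thesis by (simp add: mor_comp_def fun_eq_iff)
qed

lemma stalk_map_mor_eq:
  assumes f: "ringed_morphism X Y f" and g: "ringed_morphism X Y g" and eq: "mor_eq X Y f g"
    and x: "x \<in> points X" and c: "c \<in> carrier (stalk Y (pt f x))"
  shows "stalk_map X f x c = stalk_map X g x c"
proof -
  interpret f: ringed_morphism X Y f by fact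
  interpret g: ringed_morphism X Y g by fact
  have pt: "pt g x = pt f x" using eq x by (simp add: mor_eq_def)
  obtain U s where U: "c = germ Y (pt f x) U s" "is_open Y U" "pt f x \<in> U" "s \<in> carrier (sections Y U)"
    using c by (rule stalkE)
  moreover have "pull f U s = pull g U s" using eq U by (simp add: mor_eq_def)
  moreover have "preim X f U = preim X g U" using eq by (rule mor_eq_preim)
  ultimately show ?thesis
    using x f.stalk_map_germ[of x U s] g.stalk_map_germ[of x U s] by (simp add: pt)
qed

lemma pt_mor_id [simp]: "pt mor_id x = x"
  by (simp add: mor_id_def)

lemma pull_mor_id [simp]: "pull mor_id U s = s"
  by (simp add: mor_id_def)

lemma preim_mor_id: "U \<subseteq> points X \<Longrightarrow> preim X mor_id U = U"
  by (auto simp: preim_def)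

lemma ringed_morphism_id:
  assumes "section_presheaf X"
  shows "ringed_morphism X X mor_id"
proof -
  interpret section_presheaf X by fact
  have p: "is_open X U \<Longrightarrow> preim X mor_id U = U" for U
    by (simp add: preim_mor_id openin_subset)
  have "continuous_map (space_of X) (space_of X) (pt mor_id)"
    by (simp add: mor_id_def)
  then show ?thesis
    by unfold_locales (auto simp: p ring_hom_def)
qed

lemma stalk_map_id:
  assumes X: "section_presheaf X" and x: "x \<in> points X" and c: "c \<in> carrier (stalk X x)"
  shows "stalk_map X mor_id x c = c"
proof -
  interpret ringed_morphism X X mor_id using X by (rule ringed_morphism_id)
  obtain U s where U: "c = germ X x U s" "is_open X U" "x \<in> U" "s \<in> carrier (sections X U)"
    using c by (rule stalkE)
  then show ?thesis using stalk_map_germ[of x U s] x by (simp add: preim_mor_id openin_subset)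
qed

lemma lrs_morphism_id: "section_presheaf X \<Longrightarrow> lrs_morphism X X mor_id"
  by (simp add: lrs_morphism_iff ringed_morphism_id stalk_map_id)

section \<open>Spectra\<close>

context primeideal
begin

lemma compl_mult_closed: "s \<in> carrier R - I \<Longrightarrow> t \<in> carrier R - I \<Longrightarrow> s \<otimes> t \<in> carrier R - I"
  using I_prime by auto

lemma one_notin: "\<one> \<notin> I"
  using I_notcarr one_imp_carrier by blast

lemma mem_frac_self: "a \<in> carrier R \<Longrightarrow> s \<in> carrier R - I \<Longrightarrow> (a, s) \<in> frac R I a s"
  using one_notin by (auto simp: frac_def)

lemma mem_fracE:
  assumes "(b, t) \<in> frac R I a s"
  obtains u where "b \<in> carrier R" "t \<in> carrier R - I" "u \<in> carrier R - I" "u \<otimes> (a \<otimes> t) = u \<otimes> (b \<otimes> s)"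
  using assms by (auto simp: frac_def)

lemma frac_subset:
  assumes a: "a \<in> carrier R" "s \<in> carrier R - I" and b: "b \<in> carrier R" "t \<in> carrier R - I"
    and u: "u \<in> carrier R - I" "u \<otimes> (a \<otimes> t) = u \<otimes> (b \<otimes> s)"
  shows "frac R I a s \<subseteq> frac R I b t"
proof clarify
  fix c v assume "(c, v) \<in> frac R I a s"
  then obtain w where w: "c \<in> carrier R" "v \<in> carrier R - I" "w \<in> carrier R - I"
    "w \<otimes> (a \<otimes> v) = w \<otimes> (c \<otimes> s)"
    by (rule mem_fracE)
  have cl: "u \<in> carrier R" "w \<in> carrier R" "s \<in> carrier R" "t \<in> carrier R" "v \<in> carrier R"
    using assms w by auto
  have "(u \<otimes> w \<otimes> s) \<otimes> (b \<otimes> v) = (w \<otimes> v) \<otimes> (u \<otimes> (b \<otimes> s))"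
    using a b w(1) cl by (simp add: m_ac)
  also have "\<dots> = (u \<otimes> t) \<otimes> (w \<otimes> (a \<otimes> v))"
    unfolding u(2)[symmetric] using a b w(1) cl by (simp add: m_ac)
  also have "\<dots> = (u \<otimes> w \<otimes> s) \<otimes> (c \<otimes> t)"
    unfolding w(4) using a b w(1) cl by (simp add: m_ac)
  finally have "(u \<otimes> w \<otimes> s) \<otimes> (b \<otimes> v) = (u \<otimes> w \<otimes> s) \<otimes> (c \<otimes> t)" .
  moreover have "u \<otimes> w \<otimes> s \<in> carrier R - I"
    using u w a by (intro compl_mult_closed) auto
  ultimately show "(c, v) \<in> frac R I b t"
    using w unfolding frac_def by blast
qed

lemma frac_eqI:
  assumes "a \<in> carrier R" "s \<in> carrier R - I" "b \<in> carrier R" "t \<in> carrier R - I"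
    and "u \<in> carrier R - I" "u \<otimes> (a \<otimes> t) = u \<otimes> (b \<otimes> s)"
  shows "frac R I a s = frac R I b t"
  using assms by (intro equalityI frac_subset[where u = u]) auto

lemma frac_mult:
  assumes a: "a \<in> carrier R" "s \<in> carrier R - I" and b: "b \<in> carrier R" "t \<in> carrier R - I"
  shows "frac R I a s \<otimes>\<^bsub>localization R I\<^esub> frac R I b t = frac R I (a \<otimes> b) (s \<otimes> t)"
proof -
  have eq: "frac R I (a' \<otimes> b') (s' \<otimes> t') = frac R I (a \<otimes> b) (s \<otimes> t)"
    if h: "(a', s') \<in> frac R I a s" "(b', t') \<in> frac R I b t" for a' s' b' t'
  proof -
    obtain u where u: "a' \<in> carrier R" "s' \<in> carrier R - I" "u \<in> carrier R - I"
      "u \<otimes> (a \<otimes> s') = u \<otimes> (a' \<otimes> s)" using h(1) by (rule mem_fracE)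
    obtain v where v: "b' \<in> carrier R" "t' \<in> carrier R - I" "v \<in> carrier R - I"
      "v \<otimes> (b \<otimes> t') = v \<otimes> (b' \<otimes> t)" using h(2) by (rule mem_fracE)
    have cl: "u \<in> carrier R" "v \<in> carrier R" "s \<in> carrier R" "t \<in> carrier R" "s' \<in> carrier R" "t' \<in> carrier R"
      using a b u v by auto
    have "(u \<otimes> v) \<otimes> ((a' \<otimes> b') \<otimes> (s \<otimes> t)) = (u \<otimes> (a' \<otimes> s)) \<otimes> (v \<otimes> (b' \<otimes> t))"
      using a(1) b(1) u(1) v(1) cl by (simp add: m_ac)
    also have "\<dots> = (u \<otimes> v) \<otimes> ((a \<otimes> b) \<otimes> (s' \<otimes> t'))"
      unfolding u(4)[symmetric] v(4)[symmetric] using a(1) b(1) u(1) v(1) cl by (simp add: m_ac)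
    finally show ?thesis
      using a b u v compl_mult_closed by (intro frac_eqI[where u = "u \<otimes> v"]) auto
  qed
  have "(\<Union>(b', t')\<in>frac R I b t. frac R I (a' \<otimes> b') (s' \<otimes> t')) = frac R I (a \<otimes> b) (s \<otimes> t)"
    if "(a', s') \<in> frac R I a s" for a' s'
    by (rule UN_pairs_eq[OF mem_frac_self[OF b]]) (rule eq[OF that])
  then have "(\<Union>(a', s')\<in>frac R I a s. \<Union>(b', t')\<in>frac R I b t. frac R I (a' \<otimes> b') (s' \<otimes> t')) =
      frac R I (a \<otimes> b) (s \<otimes> t)"
    by (rule UN_pairs_eq[OF mem_frac_self[OF a]])
  then show ?thesis by (simp add: localization_def)
qed

lemma frac_add:
  assumes a: "a \<in> carrier R" "s \<in> carrier R - I" and b: "b \<in> carrier R" "t \<in> carrier R - I"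
  shows "frac R I a s \<oplus>\<^bsub>localization R I\<^esub> frac R I b t = frac R I (a \<otimes> t \<oplus> b \<otimes> s) (s \<otimes> t)"
proof -
  have eq: "frac R I (a' \<otimes> t' \<oplus> b' \<otimes> s') (s' \<otimes> t') = frac R I (a \<otimes> t \<oplus> b \<otimes> s) (s \<otimes> t)"
    if h: "(a', s') \<in> frac R I a s" "(b', t') \<in> frac R I b t" for a' s' b' t'
  proof -
    obtain u where u: "a' \<in> carrier R" "s' \<in> carrier R - I" "u \<in> carrier R - I"
      "u \<otimes> (a \<otimes> s') = u \<otimes> (a' \<otimes> s)" using h(1) by (rule mem_fracE)
    obtain v where v: "b' \<in> carrier R" "t' \<in> carrier R - I" "v \<in> carrier R - I"
      "v \<otimes> (b \<otimes> t') = v \<otimes> (b' \<otimes> t)" using h(2) by (rule mem_fracE)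
    have cl: "u \<in> carrier R" "v \<in> carrier R" "s \<in> carrier R" "t \<in> carrier R" "s' \<in> carrier R" "t' \<in> carrier R"
      using a b u v by auto
    have "(u \<otimes> v) \<otimes> ((a' \<otimes> t' \<oplus> b' \<otimes> s') \<otimes> (s \<otimes> t)) =
        (u \<otimes> (a' \<otimes> s)) \<otimes> (v \<otimes> (t \<otimes> t')) \<oplus> (v \<otimes> (b' \<otimes> t)) \<otimes> (u \<otimes> (s \<otimes> s'))"
      using a(1) b(1) u(1) v(1) cl by (simp add: l_distr r_distr m_ac)
    also have "\<dots> = (u \<otimes> v) \<otimes> ((a \<otimes> t \<oplus> b \<otimes> s) \<otimes> (s' \<otimes> t'))"
      unfolding u(4)[symmetric] v(4)[symmetric]
      using a(1) b(1) u(1) v(1) cl by (simp add: l_distr r_distr m_ac)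
    finally show ?thesis
      using a b u v compl_mult_closed by (intro frac_eqI[where u = "u \<otimes> v"]) auto
  qed
  have "(\<Union>(b', t')\<in>frac R I b t. frac R I (a' \<otimes> t' \<oplus> b' \<otimes> s') (s' \<otimes> t')) =
      frac R I (a \<otimes> t \<oplus> b \<otimes> s) (s \<otimes> t)"
    if "(a', s') \<in> frac R I a s" for a' s'
    by (rule UN_pairs_eq[OF mem_frac_self[OF b]]) (rule eq[OF that])
  then have "(\<Union>(a', s')\<in>frac R I a s. \<Union>(b', t')\<in>frac R I b t. frac R I (a' \<otimes> t' \<oplus> b' \<otimes> s') (s' \<otimes> t')) =
      frac R I (a \<otimes> t \<oplus> b \<otimes> s) (s \<otimes> t)"
    by (rule UN_pairs_eq[OF mem_frac_self[OF a]])
  then show ?thesis by (simp add: localization_def)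
qed

lemma frac_self_eq_one:
  assumes "s \<in> carrier R - I"
  shows "frac R I s s = \<one>\<^bsub>localization R I\<^esub>"
  using assms one_notin by (simp add: localization_def) (intro frac_eqI[where u = \<one>]; simp)

end

lemma is_open_Spec [simp]: "is_open (Spec R) U \<longleftrightarrow> zariski_open R U"
  by (simp add: Spec_def topology_inverse' istopology_zariski_open)

lemma sections_Spec [simp]: "sections (Spec R) = Spec_sections R"
  by (simp add: Spec_def)

lemma restr_Spec [simp]: "restr (Spec R) U V \<sigma> = restrict \<sigma> V"
  by (simp add: Spec_def)

lemma zariski_open_subset: "zariski_open R U \<Longrightarrow> U \<subseteq> Spec_points R"
  by (auto simp: zariski_open_def)

lemma zariski_open_Int: "zariski_open R U \<Longrightarrow> zariski_open R V \<Longrightarrow> zariski_open R (U \<inter> V)"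
  using openin_Int[of "space_of (Spec R)" U V] by simp

lemma zariski_open_Spec_points: "zariski_open R (Spec_points R)"
  unfolding zariski_open_def
proof (intro exI conjI)
  have "\<not> carrier R \<subseteq> P" if "primeideal P R" for P
  proof -
    interpret primeideal P R by fact
    show ?thesis using I_notcarr a_subset by blast
  qed
  then show "Spec_points R = {P \<in> Spec_points R. \<not> carrier R \<subseteq> P}" by (auto simp: Spec_points_def)
qed simp

lemma points_Spec [simp]: "points (Spec R) = Spec_points R"
  using zariski_open_Spec_points zariski_open_subset
  by (metis is_open_Spec openin_subset openin_topspace subset_antisym)

lemma zariski_open_basic:
  assumes "a \<in> carrier R"
  shows "zariski_open R {P \<in> Spec_points R. a \<notin> P}"
  unfolding zariski_open_def using assms by (intro exI[of _ "{a}"]) auto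

lemma Spec_section_local:
  assumes "\<sigma> \<in> carrier (Spec_sections R U)" "P \<in> U"
  obtains V a s where "zariski_open R V" "P \<in> V" "V \<subseteq> U" "a \<in> carrier R" "s \<in> carrier R"
    "\<And>Q. Q \<in> V \<Longrightarrow> s \<notin> Q" "\<And>Q. Q \<in> V \<Longrightarrow> \<sigma> Q = frac R Q a s"
  using assms by (auto simp: Spec_sections_def)

lemma Spec_sectionI:
  assumes U: "zariski_open R U" and ext: "\<sigma> \<in> extensional U"
    and loc: "\<And>P. P \<in> U \<Longrightarrow> \<exists>V a s. zariski_open R V \<and> P \<in> V \<and> V \<subseteq> U \<and> a \<in> carrier R \<and> s \<in> carrier R \<and>
            (\<forall>Q\<in>V. s \<notin> Q \<and> \<sigma> Q = frac R Q a s)"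
  shows "\<sigma> \<in> carrier (Spec_sections R U)"
proof -
  have "\<sigma> P \<in> carrier (localization R P)" if P: "P \<in> U" for P
  proof -
    obtain a s where "\<sigma> P = frac R P a s" "a \<in> carrier R" "s \<in> carrier R" "s \<notin> P"
      using loc[OF P] by blast
    then show ?thesis by (auto simp: localization_def)
  qed
  then have "\<sigma> \<in> (\<Pi>\<^sub>E P\<in>U. carrier (localization R P))" using ext by (auto simp: PiE_def)
  then show ?thesis using loc by (simp add: Spec_sections_def)
qed

lemma Spec_section_ext: "\<sigma> \<in> carrier (Spec_sections R U) \<Longrightarrow> \<sigma> \<in> extensional U"
  by (auto simp: Spec_sections_def PiE_def)

lemma Spec_section_value:
  assumes "\<sigma> \<in> carrier (Spec_sections R U)" "P \<in> U"
  obtains a s where "a \<in> carrier R" "s \<in> carrier R" "s \<notin> P" "\<sigma> P = frac R P a s"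
proof -
  obtain V a s where "P \<in> V" "a \<in> carrier R" "s \<in> carrier R"
    "\<And>Q. Q \<in> V \<Longrightarrow> s \<notin> Q" "\<And>Q. Q \<in> V \<Longrightarrow> \<sigma> Q = frac R Q a s"
    using assms by (rule Spec_section_local) blast
  then show ?thesis by (intro that[of a s]) auto
qed

lemma Spec_sections_local2:
  assumes \<sigma>: "\<sigma> \<in> carrier (Spec_sections R U)" and \<tau>: "\<tau> \<in> carrier (Spec_sections R U)" and P: "P \<in> U"
  obtains V a s b t where "zariski_open R V" "P \<in> V" "V \<subseteq> U" "a \<in> carrier R" "s \<in> carrier R"
    "b \<in> carrier R" "t \<in> carrier R" "\<And>Q. Q \<in> V \<Longrightarrow> s \<notin> Q" "\<And>Q. Q \<in> V \<Longrightarrow> \<sigma> Q = frac R Q a s"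
    "\<And>Q. Q \<in> V \<Longrightarrow> t \<notin> Q" "\<And>Q. Q \<in> V \<Longrightarrow> \<tau> Q = frac R Q b t"
proof -
  obtain V a s where V: "zariski_open R V" "P \<in> V" "V \<subseteq> U" "a \<in> carrier R" "s \<in> carrier R"
    "\<And>Q. Q \<in> V \<Longrightarrow> s \<notin> Q" "\<And>Q. Q \<in> V \<Longrightarrow> \<sigma> Q = frac R Q a s"
    using \<sigma> P by (rule Spec_section_local) blast
  obtain W b t where W: "zariski_open R W" "P \<in> W" "W \<subseteq> U" "b \<in> carrier R" "t \<in> carrier R"
    "\<And>Q. Q \<in> W \<Longrightarrow> t \<notin> Q" "\<And>Q. Q \<in> W \<Longrightarrow> \<tau> Q = frac R Q b t"
    using \<tau> P by (rule Spec_section_local) blast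
  show ?thesis
    by (rule that[of "V \<inter> W" a s b t]) (use V W in \<open>auto intro: zariski_open_Int\<close>)
qed

lemma mult_Spec_sections:
  "\<sigma> \<otimes>\<^bsub>Spec_sections R U\<^esub> \<tau> = (\<lambda>P\<in>U. \<sigma> P \<otimes>\<^bsub>localization R P\<^esub> \<tau> P)"
  by (simp add: Spec_sections_def)

lemma add_Spec_sections:
  "\<sigma> \<oplus>\<^bsub>Spec_sections R U\<^esub> \<tau> = (\<lambda>P\<in>U. \<sigma> P \<oplus>\<^bsub>localization R P\<^esub> \<tau> P)"
  by (simp add: Spec_sections_def)

lemma one_Spec_sections: "\<one>\<^bsub>Spec_sections R U\<^esub> = (\<lambda>P\<in>U. \<one>\<^bsub>localization R P\<^esub>)"
  by (simp add: Spec_sections_def)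

lemma one_localization: "\<one>\<^bsub>localization R P\<^esub> = frac R P \<one>\<^bsub>R\<^esub> \<one>\<^bsub>R\<^esub>"
  by (simp add: localization_def)

lemma Spec_sections_mult_closed:
  assumes R: "cring R" and U: "zariski_open R U"
    and \<sigma>: "\<sigma> \<in> carrier (Spec_sections R U)" and \<tau>: "\<tau> \<in> carrier (Spec_sections R U)"
  shows "\<sigma> \<otimes>\<^bsub>Spec_sections R U\<^esub> \<tau> \<in> carrier (Spec_sections R U)"
  unfolding mult_Spec_sections
proof (rule Spec_sectionI[OF U])
  interpret cring R by fact
  fix P assume P: "P \<in> U"
  obtain V a s b t where *: "zariski_open R V" "P \<in> V" "V \<subseteq> U" "a \<in> carrier R" "s \<in> carrier R"
    "b \<in> carrier R" "t \<in> carrier R" "\<And>Q. Q \<in> V \<Longrightarrow> s \<notin> Q" "\<And>Q. Q \<in> V \<Longrightarrow> \<sigma> Q = frac R Q a s"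
    "\<And>Q. Q \<in> V \<Longrightarrow> t \<notin> Q" "\<And>Q. Q \<in> V \<Longrightarrow> \<tau> Q = frac R Q b t"
    using Spec_sections_local2[OF \<sigma> \<tau> P] by blast
  have "s \<otimes>\<^bsub>R\<^esub> t \<notin> Q \<and> (\<lambda>P\<in>U. \<sigma> P \<otimes>\<^bsub>localization R P\<^esub> \<tau> P) Q = frac R Q (a \<otimes>\<^bsub>R\<^esub> b) (s \<otimes>\<^bsub>R\<^esub> t)"
    if "Q \<in> V" for Q
  proof -
    have "Q \<in> U" using that *(3) by blast
    then interpret Q: primeideal Q R
      using zariski_open_subset[OF U] by (auto simp: Spec_points_def)
    show ?thesis using * that \<open>Q \<in> U\<close> Q.compl_mult_closed[of s t] by (simp add: Q.frac_mult)
  qed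
  then show "\<exists>V a s. zariski_open R V \<and> P \<in> V \<and> V \<subseteq> U \<and> a \<in> carrier R \<and> s \<in> carrier R \<and>
      (\<forall>Q\<in>V. s \<notin> Q \<and> (\<lambda>P\<in>U. \<sigma> P \<otimes>\<^bsub>localization R P\<^esub> \<tau> P) Q = frac R Q a s)"
    using * by (intro exI[of _ V] exI[of _ "a \<otimes>\<^bsub>R\<^esub> b"] exI[of _ "s \<otimes>\<^bsub>R\<^esub> t"]) auto
qed auto

lemma Spec_sections_add_closed:
  assumes R: "cring R" and U: "zariski_open R U"
    and \<sigma>: "\<sigma> \<in> carrier (Spec_sections R U)" and \<tau>: "\<tau> \<in> carrier (Spec_sections R U)"
  shows "\<sigma> \<oplus>\<^bsub>Spec_sections R U\<^esub> \<tau> \<in> carrier (Spec_sections R U)"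
  unfolding add_Spec_sections
proof (rule Spec_sectionI[OF U])
  interpret cring R by fact
  fix P assume P: "P \<in> U"
  obtain V a s b t where *: "zariski_open R V" "P \<in> V" "V \<subseteq> U" "a \<in> carrier R" "s \<in> carrier R"
    "b \<in> carrier R" "t \<in> carrier R" "\<And>Q. Q \<in> V \<Longrightarrow> s \<notin> Q" "\<And>Q. Q \<in> V \<Longrightarrow> \<sigma> Q = frac R Q a s"
    "\<And>Q. Q \<in> V \<Longrightarrow> t \<notin> Q" "\<And>Q. Q \<in> V \<Longrightarrow> \<tau> Q = frac R Q b t"
    using Spec_sections_local2[OF \<sigma> \<tau> P] by blast
  have "s \<otimes>\<^bsub>R\<^esub> t \<notin> Q \<and> (\<lambda>P\<in>U. \<sigma> P \<oplus>\<^bsub>localization R P\<^esub> \<tau> P) Q =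
      frac R Q (a \<otimes>\<^bsub>R\<^esub> t \<oplus>\<^bsub>R\<^esub> b \<otimes>\<^bsub>R\<^esub> s) (s \<otimes>\<^bsub>R\<^esub> t)"
    if "Q \<in> V" for Q
  proof -
    have "Q \<in> U" using that *(3) by blast
    then interpret Q: primeideal Q R
      using zariski_open_subset[OF U] by (auto simp: Spec_points_def)
    show ?thesis using * that \<open>Q \<in> U\<close> Q.compl_mult_closed[of s t] by (simp add: Q.frac_add)
  qed
  then show "\<exists>V a s. zariski_open R V \<and> P \<in> V \<and> V \<subseteq> U \<and> a \<in> carrier R \<and> s \<in> carrier R \<and>
      (\<forall>Q\<in>V. s \<notin> Q \<and> (\<lambda>P\<in>U. \<sigma> P \<oplus>\<^bsub>localization R P\<^esub> \<tau> P) Q = frac R Q a s)"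
    using * by (intro exI[of _ V] exI[of _ "a \<otimes>\<^bsub>R\<^esub> t \<oplus>\<^bsub>R\<^esub> b \<otimes>\<^bsub>R\<^esub> s"] exI[of _ "s \<otimes>\<^bsub>R\<^esub> t"]) auto
qed auto

lemma Spec_sections_one_closed:
  assumes R: "cring R" and U: "zariski_open R U"
  shows "\<one>\<^bsub>Spec_sections R U\<^esub> \<in> carrier (Spec_sections R U)"
  unfolding one_Spec_sections
proof (rule Spec_sectionI[OF U])
  interpret cring R by fact
  have "\<one>\<^bsub>R\<^esub> \<notin> Q" if "Q \<in> U" for Q
  proof -
    interpret Q: primeideal Q R
      using that zariski_open_subset[OF U] by (auto simp: Spec_points_def)
    show ?thesis by (rule Q.one_notin)
  qed
  then show "\<exists>V a s. zariski_open R V \<and> P \<in> V \<and> V \<subseteq> U \<and> a \<in> carrier R \<and> s \<in> carrier R \<and>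
      (\<forall>Q\<in>V. s \<notin> Q \<and> (\<lambda>P\<in>U. \<one>\<^bsub>localization R P\<^esub>) Q = frac R Q a s)" if "P \<in> U" for P
    using that U one_closed
    by (intro exI[of _ U] exI[of _ "\<one>\<^bsub>R\<^esub>"]) (auto simp: one_localization)
qed auto

lemma Spec_sections_restrict:
  assumes "zariski_open R V" "V \<subseteq> U" "\<sigma> \<in> carrier (Spec_sections R U)"
  shows "restrict \<sigma> V \<in> carrier (Spec_sections R V)"
proof (rule Spec_sectionI[OF assms(1)])
  fix P assume P: "P \<in> V"
  with assms(2) have "P \<in> U" by blast
  with assms(3) obtain W a s where W: "zariski_open R W" "P \<in> W" "W \<subseteq> U" "a \<in> carrier R" "s \<in> carrier R"
    "\<And>Q. Q \<in> W \<Longrightarrow> s \<notin> Q" "\<And>Q. Q \<in> W \<Longrightarrow> \<sigma> Q = frac R Q a s"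
    by (rule Spec_section_local) blast
  show "\<exists>W a s. zariski_open R W \<and> P \<in> W \<and> W \<subseteq> V \<and> a \<in> carrier R \<and> s \<in> carrier R \<and>
      (\<forall>Q\<in>W. s \<notin> Q \<and> restrict \<sigma> V Q = frac R Q a s)"
    using W P assms(1) by (intro exI[of _ "W \<inter> V"] exI[of _ a] exI[of _ s]) (auto intro: zariski_open_Int)
qed auto

lemma section_presheaf_Spec:
  assumes R: "cring R"
  shows "section_presheaf (Spec R)"
proof
  show "restr (Spec R) U V \<in> ring_hom (sections (Spec R) U) (sections (Spec R) V)"
    if "is_open (Spec R) U" "is_open (Spec R) V" "V \<subseteq> U" for U V
    using that by (intro ring_hom_memI) (auto simp: Spec_sections_restrict mult_Spec_sections
        add_Spec_sections one_Spec_sections fun_eq_iff)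
  show "restr (Spec R) U U \<sigma> = \<sigma>" if "\<sigma> \<in> carrier (sections (Spec R) U)" for U \<sigma>
    using that Spec_section_ext[of \<sigma> R U] by (simp add: extensional_restrict)
  show "restr (Spec R) V W (restr (Spec R) U V \<sigma>) = restr (Spec R) U W \<sigma>" if "W \<subseteq> V" for U V W \<sigma>
    using that by (simp add: restrict_restrict Int_absorb1)
qed (use R in \<open>simp_all add: Spec_sections_mult_closed Spec_sections_add_closed Spec_sections_one_closed\<close>)

context ring_hom_cring
begin

lemma pt_Spec_map: "pt (Spec_map R S h) P = {a \<in> carrier R. h a \<in> P}"
  by (simp add: Spec_map_def Let_def)

lemma pull_Spec_map:
  "pull (Spec_map R S h) U \<sigma> = (\<lambda>P \<in> preim (Spec S) (Spec_map R S h) U.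
     \<Union>(a, s)\<in>\<sigma> (pt (Spec_map R S h) P). frac S P (h a) (h s))"
  by (simp add: preim_def pt_Spec_map) (simp add: Spec_map_def Let_def)

lemma pt_Spec_map_in: "P \<in> Spec_points S \<Longrightarrow> pt (Spec_map R S h) P \<in> Spec_points R"
  using ring_hom_ring.primeideal_vimage[OF ring_hom_ringI2[OF R.ring_axioms S.ring_axioms homh] R.is_cring]
  by (simp add: Spec_points_def pt_Spec_map)

lemma notin_pt_Spec_map: "a \<in> carrier R \<Longrightarrow> a \<notin> pt (Spec_map R S h) P \<longleftrightarrow> h a \<notin> P"
  by (simp add: pt_Spec_map)

lemma UN_frac_hom:
  assumes P: "P \<in> Spec_points S" and a: "a \<in> carrier R" "s \<in> carrier R" "h s \<notin> P"
  shows "(\<Union>(b, t)\<in>frac R (pt (Spec_map R S h) P) a s. frac S P (h b) (h t)) = frac S P (h a) (h s)"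
proof -
  interpret Q: primeideal "pt (Spec_map R S h) P" R
    using pt_Spec_map_in[OF P] by (simp add: Spec_points_def)
  interpret P: primeideal P S
    using P by (simp add: Spec_points_def)
  show ?thesis
  proof (rule UN_pairs_eq[OF Q.mem_frac_self])
    fix b t assume "(b, t) \<in> frac R (pt (Spec_map R S h) P) a s"
    then obtain u where u: "b \<in> carrier R" "t \<in> carrier R - pt (Spec_map R S h) P"
      "u \<in> carrier R - pt (Spec_map R S h) P" "u \<otimes> (a \<otimes> t) = u \<otimes> (b \<otimes> s)"
      by (rule Q.mem_fracE)
    have eq: "h u \<otimes>\<^bsub>S\<^esub> (h b \<otimes>\<^bsub>S\<^esub> h s) = h u \<otimes>\<^bsub>S\<^esub> (h a \<otimes>\<^bsub>S\<^esub> h t)"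
    proof -
      have "h (u \<otimes> (a \<otimes> t)) = h (u \<otimes> (b \<otimes> s))" by (simp only: u(4))
      then show ?thesis using u(1-3) a by simp
    qed
    have "h t \<in> carrier S - P" "h u \<in> carrier S - P" "h s \<in> carrier S - P"
      using u(2,3) a(2,3) notin_pt_Spec_map hom_closed by blast+
    then show "frac S P (h b) (h t) = frac S P (h a) (h s)"
      by (intro P.frac_eqI[OF _ _ _ _ _ eq]) (use u(1) a(1) in simp_all)
  qed (use a notin_pt_Spec_map in blast)+
qed

lemma pull_Spec_map_frac:
  assumes "P \<in> Spec_points S" "pt (Spec_map R S h) P \<in> U"
    and "\<sigma> (pt (Spec_map R S h) P) = frac R (pt (Spec_map R S h) P) a s"
    and "a \<in> carrier R" "s \<in> carrier R" "h s \<notin> P"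
  shows "pull (Spec_map R S h) U \<sigma> P = frac S P (h a) (h s)"
  using assms by (simp add: pull_Spec_map mem_preim UN_frac_hom)

lemma preim_Spec_map_open:
  assumes "zariski_open R U"
  shows "zariski_open S (preim (Spec S) (Spec_map R S h) U)"
proof -
  obtain T where T: "T \<subseteq> carrier R" "U = {P \<in> Spec_points R. \<not> T \<subseteq> P}"
    using assms by (auto simp: zariski_open_def)
  have "preim (Spec S) (Spec_map R S h) U = {P \<in> Spec_points S. \<not> h ` T \<subseteq> P}"
    using T pt_Spec_map_in by (auto simp: preim_def pt_Spec_map)
  moreover have "h ` T \<subseteq> carrier S" using T by auto
  ultimately show ?thesis by (auto simp: zariski_open_def)
qed

lemma pull_Spec_map_in:
  assumes U: "zariski_open R U" and \<sigma>: "\<sigma> \<in> carrier (Spec_sections R U)"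
  shows "pull (Spec_map R S h) U \<sigma> \<in> carrier (Spec_sections S (preim (Spec S) (Spec_map R S h) U))"
proof (rule Spec_sectionI[OF preim_Spec_map_open[OF U]])
  fix P assume P: "P \<in> preim (Spec S) (Spec_map R S h) U"
  then have "pt (Spec_map R S h) P \<in> U" by (simp add: mem_preim)
  with \<sigma> obtain V a s where V: "zariski_open R V" "pt (Spec_map R S h) P \<in> V" "V \<subseteq> U" "a \<in> carrier R"
    "s \<in> carrier R" "\<And>Q. Q \<in> V \<Longrightarrow> s \<notin> Q" "\<And>Q. Q \<in> V \<Longrightarrow> \<sigma> Q = frac R Q a s"
    by (rule Spec_section_local) blast
  let ?V = "preim (Spec S) (Spec_map R S h) V"
  have *: "h s \<notin> Q \<and> pull (Spec_map R S h) U \<sigma> Q = frac S Q (h a) (h s)" if "Q \<in> ?V" for Q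
  proof -
    have Q: "Q \<in> Spec_points S" "pt (Spec_map R S h) Q \<in> V" using that by (auto simp: mem_preim)
    then have "h s \<notin> Q" using V(5,6) notin_pt_Spec_map by blast
    then show ?thesis using V Q by (intro conjI pull_Spec_map_frac) auto
  qed
  show "\<exists>V a s. zariski_open S V \<and> P \<in> V \<and> V \<subseteq> preim (Spec S) (Spec_map R S h) U \<and> a \<in> carrier S \<and>
      s \<in> carrier S \<and> (\<forall>Q\<in>V. s \<notin> Q \<and> pull (Spec_map R S h) U \<sigma> Q = frac S Q a s)"
  proof (intro exI conjI ballI)
    show "zariski_open S ?V" using V by (intro preim_Spec_map_open)
    show "P \<in> ?V" using P V by (simp add: mem_preim)
    show "?V \<subseteq> preim (Spec S) (Spec_map R S h) U" using V by (intro preim_mono)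
    show "h a \<in> carrier S" "h s \<in> carrier S" using V by auto
  qed (use * in auto)
qed (simp add: pull_Spec_map)

lemma pull_Spec_map_hom:
  assumes U: "zariski_open R U"
  shows "pull (Spec_map R S h) U \<in> ring_hom (Spec_sections R U)
    (Spec_sections S (preim (Spec S) (Spec_map R S h) U))"
proof (rule ring_hom_memI)
  let ?f = "Spec_map R S h"
  fix \<sigma> assume \<sigma>: "\<sigma> \<in> carrier (Spec_sections R U)"
  then show "pull ?f U \<sigma> \<in> carrier (Spec_sections S (preim (Spec S) ?f U))"
    using U by (rule pull_Spec_map_in[rotated])
  fix \<tau> assume \<tau>: "\<tau> \<in> carrier (Spec_sections R U)"
  have *: "pull ?f U (\<sigma> \<otimes>\<^bsub>Spec_sections R U\<^esub> \<tau>) P =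
        pull ?f U \<sigma> P \<otimes>\<^bsub>localization S P\<^esub> pull ?f U \<tau> P \<and>
      pull ?f U (\<sigma> \<oplus>\<^bsub>Spec_sections R U\<^esub> \<tau>) P =
        pull ?f U \<sigma> P \<oplus>\<^bsub>localization S P\<^esub> pull ?f U \<tau> P"
    if "P \<in> preim (Spec S) ?f U" for P
  proof -
    have P: "P \<in> Spec_points S" "pt ?f P \<in> U" using that by (auto simp: mem_preim)
    interpret Q: primeideal "pt ?f P" R
      using pt_Spec_map_in[OF P(1)] by (simp add: Spec_points_def)
    interpret P: primeideal P S
      using P by (simp add: Spec_points_def)
    obtain a s where a: "a \<in> carrier R" "s \<in> carrier R" "s \<notin> pt ?f P" "\<sigma> (pt ?f P) = frac R (pt ?f P) a s"
      using \<sigma> P(2) by (rule Spec_section_value)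
    obtain b t where b: "b \<in> carrier R" "t \<in> carrier R" "t \<notin> pt ?f P" "\<tau> (pt ?f P) = frac R (pt ?f P) b t"
      using \<tau> P(2) by (rule Spec_section_value)
    have n: "h s \<notin> P" "h t \<notin> P" using a b by (simp_all add: notin_pt_Spec_map)
    have st: "h (s \<otimes> t) \<notin> P" using P.compl_mult_closed[of "h s" "h t"] n a b by simp
    have "pull ?f U (\<sigma> \<otimes>\<^bsub>Spec_sections R U\<^esub> \<tau>) P = frac S P (h (a \<otimes> b)) (h (s \<otimes> t))"
      using P a b st by (intro pull_Spec_map_frac) (auto simp: mult_Spec_sections Q.frac_mult)
    moreover have "pull ?f U (\<sigma> \<oplus>\<^bsub>Spec_sections R U\<^esub> \<tau>) P = frac S P (h (a \<otimes> t \<oplus> b \<otimes> s)) (h (s \<otimes> t))"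
      using P a b st by (intro pull_Spec_map_frac) (auto simp: add_Spec_sections Q.frac_add)
    moreover have "pull ?f U \<sigma> P = frac S P (h a) (h s)" "pull ?f U \<tau> P = frac S P (h b) (h t)"
      
      by (rule pull_Spec_map_frac, fact P(1), fact P(2), fact a(4), fact a(1), fact a(2), fact n(1),
        rule pull_Spec_map_frac, fact P(1), fact P(2), fact b(4), fact b(1), fact b(2), fact n(2))
    ultimately show ?thesis using a b n by (simp add: P.frac_mult P.frac_add)
  qed
  have undef: "pull ?f U \<sigma> P = undefined" if "P \<notin> preim (Spec S) ?f U" for P \<sigma>
    using that by (simp add: pull_Spec_map)
  show "pull ?f U (\<sigma> \<otimes>\<^bsub>Spec_sections R U\<^esub> \<tau>) =
      pull ?f U \<sigma> \<otimes>\<^bsub>Spec_sections S (preim (Spec S) ?f U)\<^esub> pull ?f U \<tau>"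
    by (rule ext) (simp add: mult_Spec_sections[where R = S] * undef)
  show "pull ?f U (\<sigma> \<oplus>\<^bsub>Spec_sections R U\<^esub> \<tau>) =
      pull ?f U \<sigma> \<oplus>\<^bsub>Spec_sections S (preim (Spec S) ?f U)\<^esub> pull ?f U \<tau>"
    by (rule ext) (simp add: add_Spec_sections[where R = S] * undef)
next
  let ?f = "Spec_map R S h"
  have "pull ?f U \<one>\<^bsub>Spec_sections R U\<^esub> P = \<one>\<^bsub>localization S P\<^esub>" if "P \<in> preim (Spec S) ?f U" for P
  proof -
    have P: "P \<in> Spec_points S" "pt ?f P \<in> U" using that by (auto simp: mem_preim)
    interpret P: primeideal P S
      using P by (simp add: Spec_points_def)
    have "pull ?f U \<one>\<^bsub>Spec_sections R U\<^esub> P = frac S P (h \<one>) (h \<one>)"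
      using P P.one_notin by (intro pull_Spec_map_frac) (auto simp: one_Spec_sections one_localization)
    then show ?thesis by (simp add: one_localization)
  qed
  moreover have "pull ?f U \<one>\<^bsub>Spec_sections R U\<^esub> P = undefined" if "P \<notin> preim (Spec S) ?f U" for P
    using that by (simp add: pull_Spec_map)
  ultimately show "pull ?f U \<one>\<^bsub>Spec_sections R U\<^esub> = \<one>\<^bsub>Spec_sections S (preim (Spec S) ?f U)\<^esub>"
    by (simp add: one_Spec_sections[where R = S] fun_eq_iff)
qed

lemma ringed_morphism_Spec_map: "ringed_morphism (Spec S) (Spec R) (Spec_map R S h)"
proof -
  interpret section_presheaf "Spec S" by (rule section_presheaf_Spec) (rule S.is_cring)
  let ?f = "Spec_map R S h"
  show ?thesis
  proof
    show "continuous_map (space_of (Spec S)) (space_of (Spec R)) (pt ?f)"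
      unfolding continuous_map_def using pt_Spec_map_in preim_Spec_map_open by (simp add: preim_def)
    show "pull ?f U \<in> ring_hom (sections (Spec R) U) (sections (Spec S) (preim (Spec S) ?f U))"
      if "is_open (Spec R) U" for U
      using that pull_Spec_map_hom by simp
    show "pull ?f V (restr (Spec R) U V s) =
        restr (Spec S) (preim (Spec S) ?f U) (preim (Spec S) ?f V) (pull ?f U s)"
      if "V \<subseteq> U" for U V s
      using that by (auto simp: pull_Spec_map fun_eq_iff mem_preim)
  qed
qed

text \<open>
  If the image of the germ of \<open>a / s\<close> is invertible, then \<open>h a\<close> is not in \<open>P\<close>, so that \<open>s / a\<close> is a
  section near the image of \<open>P\<close>.
\<close>

lemma stalk_map_Spec_map_reflects_Units:
  assumes P: "P \<in> Spec_points S"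
    and c: "c \<in> carrier (stalk (Spec R) (pt (Spec_map R S h) P))"
    and unit: "stalk_map (Spec S) (Spec_map R S h) P c \<in> Units (stalk (Spec S) P)"
  shows "c \<in> Units (stalk (Spec R) (pt (Spec_map R S h) P))"
proof -
  let ?f = "Spec_map R S h"
  interpret f: ringed_morphism "Spec S" "Spec R" ?f by (rule ringed_morphism_Spec_map)
  interpret SR: section_presheaf "Spec R" by (rule section_presheaf_Spec) (rule R.is_cring)
  interpret P: primeideal P S using P by (simp add: Spec_points_def)
  obtain U \<sigma> where U: "c = germ (Spec R) (pt ?f P) U \<sigma>" "zariski_open R U" "pt ?f P \<in> U"
    "\<sigma> \<in> carrier (Spec_sections R U)"
    using c by (auto elim: stalkE)
  obtain V a s where V: "zariski_open R V" "pt ?f P \<in> V" "V \<subseteq> U" "a \<in> carrier R" "s \<in> carrier R"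
    "\<And>Q. Q \<in> V \<Longrightarrow> s \<notin> Q" "\<And>Q. Q \<in> V \<Longrightarrow> \<sigma> Q = frac R Q a s"
    using U(4,3) by (rule Spec_section_local) blast
  have hs: "h s \<notin> P" using V(2,5,6) notin_pt_Spec_map by blast
  have "germ (Spec S) P (preim (Spec S) ?f U) (pull ?f U \<sigma>) \<in> Units (stalk (Spec S) P)"
    using unit U P by (simp add: f.stalk_map_germ)
  then obtain W where W: "zariski_open S W" "P \<in> W" "W \<subseteq> preim (Spec S) ?f U"
    "restrict (pull ?f U \<sigma>) W \<in> Units (Spec_sections S W)"
    using f.X.germ_Units_iff[of "preim (Spec S) ?f U" P "pull ?f U \<sigma>"] U P f.open_preim f.pull_closed
    by (auto simp: mem_preim)
  then obtain \<tau> where \<tau>: "\<tau> \<in> carrier (Spec_sections S W)"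
    "restrict (pull ?f U \<sigma>) W \<otimes>\<^bsub>Spec_sections S W\<^esub> \<tau> = \<one>\<^bsub>Spec_sections S W\<^esub>"
    by (auto simp: Units_def)
  obtain b t where b: "b \<in> carrier S" "t \<in> carrier S" "t \<notin> P" "\<tau> P = frac S P b t"
    using \<tau>(1) W(2) by (rule Spec_section_value)
  have "pull ?f U \<sigma> P = frac S P (h a) (h s)"
    using P U V hs by (intro pull_Spec_map_frac) auto
  then have "frac S P (h a \<otimes>\<^bsub>S\<^esub> b) (h s \<otimes>\<^bsub>S\<^esub> t) = frac S P \<one>\<^bsub>S\<^esub> \<one>\<^bsub>S\<^esub>"
    using fun_cong[OF \<tau>(2), of P] W(2) b V hs
    by (simp add: mult_Spec_sections one_Spec_sections one_localization P.frac_mult)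
  moreover have "(h a \<otimes>\<^bsub>S\<^esub> b, h s \<otimes>\<^bsub>S\<^esub> t) \<in> frac S P (h a \<otimes>\<^bsub>S\<^esub> b) (h s \<otimes>\<^bsub>S\<^esub> t)"
    using V b hs P.compl_mult_closed by (intro P.mem_frac_self) auto
  ultimately obtain u where u: "u \<in> carrier S - P" "h s \<otimes>\<^bsub>S\<^esub> t \<in> carrier S - P"
    "u \<otimes>\<^bsub>S\<^esub> (\<one>\<^bsub>S\<^esub> \<otimes>\<^bsub>S\<^esub> (h s \<otimes>\<^bsub>S\<^esub> t)) = u \<otimes>\<^bsub>S\<^esub> (h a \<otimes>\<^bsub>S\<^esub> b \<otimes>\<^bsub>S\<^esub> \<one>\<^bsub>S\<^esub>)"
    by (auto elim: P.mem_fracE)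
  have ha: "h a \<notin> P"
  proof
    assume "h a \<in> P"
    then have "u \<otimes>\<^bsub>S\<^esub> (h a \<otimes>\<^bsub>S\<^esub> b \<otimes>\<^bsub>S\<^esub> \<one>\<^bsub>S\<^esub>) \<in> P"
      using u b by (simp add: P.I_l_closed P.I_r_closed)
    then show False using P.compl_mult_closed[OF u(1,2)] u b V by simp
  qed
  let ?V = "V \<inter> {Q \<in> Spec_points R. a \<notin> Q}"
  have V': "zariski_open R ?V" using V by (intro zariski_open_Int zariski_open_basic)
  have V'U: "?V \<subseteq> U" using V by blast
  let ?\<rho> = "\<lambda>Q\<in>?V. frac R Q s a"
  have \<rho>: "?\<rho> \<in> carrier (Spec_sections R ?V)"
  proof (rule Spec_sectionI[OF V'])
    show "\<exists>W b t. zariski_open R W \<and> Q \<in> W \<and> W \<subseteq> ?V \<and> b \<in> carrier R \<and> t \<in> carrier R \<and>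
        (\<forall>Q\<in>W. t \<notin> Q \<and> ?\<rho> Q = frac R Q b t)" if "Q \<in> ?V" for Q
      using that V' V by (intro exI[of _ ?V] exI[of _ s] exI[of _ a]) auto
  qed simp
  have inv: "\<sigma> Q \<otimes>\<^bsub>localization R Q\<^esub> ?\<rho> Q = \<one>\<^bsub>localization R Q\<^esub>"
    "?\<rho> Q \<otimes>\<^bsub>localization R Q\<^esub> \<sigma> Q = \<one>\<^bsub>localization R Q\<^esub>" if "Q \<in> ?V" for Q
  proof -
    interpret Q: primeideal Q R using that by (simp add: Spec_points_def)
    have Q: "s \<in> carrier R - Q" "a \<in> carrier R - Q" "\<sigma> Q = frac R Q a s" "?\<rho> Q = frac R Q s a"
      using that V(4-7) by auto
    have "a \<otimes> s = s \<otimes> a" using V(4,5) by (rule R.m_comm)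
    then show "\<sigma> Q \<otimes>\<^bsub>localization R Q\<^esub> ?\<rho> Q = \<one>\<^bsub>localization R Q\<^esub>"
      "?\<rho> Q \<otimes>\<^bsub>localization R Q\<^esub> \<sigma> Q = \<one>\<^bsub>localization R Q\<^esub>"
      using Q(1,2) V(4,5) Q.frac_self_eq_one[OF Q.compl_mult_closed[OF Q(1,2)]]
      unfolding Q(3,4) by (simp_all add: Q.frac_mult)
  qed
  have "restrict \<sigma> ?V \<in> carrier (Spec_sections R ?V)"
    using V' V'U U(4) by (rule Spec_sections_restrict)
  moreover have "restrict \<sigma> ?V \<otimes>\<^bsub>Spec_sections R ?V\<^esub> ?\<rho> = \<one>\<^bsub>Spec_sections R ?V\<^esub>"
    "?\<rho> \<otimes>\<^bsub>Spec_sections R ?V\<^esub> restrict \<sigma> ?V = \<one>\<^bsub>Spec_sections R ?V\<^esub>"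
    unfolding mult_Spec_sections one_Spec_sections using inv
    by (intro restrict_ext; simp only: restrict_apply' if_True)+
  ultimately have "restrict \<sigma> ?V \<in> Units (Spec_sections R ?V)"
    using \<rho> unfolding Units_def by blast
  moreover have "pt ?f P \<in> ?V"
    using V(2) ha pt_Spec_map_in[OF P] by (simp add: pt_Spec_map)
  ultimately show ?thesis
    using U V' V'U unfolding U(1) by (subst SR.germ_Units_iff) auto
qed

lemma lrs_morphism_Spec_map: "lrs_morphism (Spec S) (Spec R) (Spec_map R S h)"
  using ringed_morphism_Spec_map stalk_map_Spec_map_reflects_Units
  by (simp add: lrs_morphism_iff[OF section_presheaf_Spec[OF S.is_cring]])

end

lemma Spec_map_comp:
  assumes g: "ring_hom_cring A B g" and h: "ring_hom_cring B C h" and k: "ring_hom_cring A C k"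
    and k_eq: "\<And>a. a \<in> carrier A \<Longrightarrow> k a = h (g a)"
  shows "mor_eq (Spec C) (Spec A) (mor_comp (Spec B) (Spec_map A B g) (Spec_map B C h)) (Spec_map A C k)"
proof -
  interpret g: ring_hom_cring A B g by fact
  interpret h: ring_hom_cring B C h by fact
  interpret k: ring_hom_cring A C k by fact
  have pt: "pt (Spec_map A C k) P = pt (Spec_map A B g) (pt (Spec_map B C h) P)" for P
    using k_eq by (auto simp: g.pt_Spec_map h.pt_Spec_map k.pt_Spec_map)
  have "pull (Spec_map B C h) (preim (Spec B) (Spec_map A B g) U) (pull (Spec_map A B g) U \<sigma>) P =
      pull (Spec_map A C k) U \<sigma> P"
    if \<sigma>: "\<sigma> \<in> carrier (Spec_sections A U)" for U \<sigma> P
  proof (cases "P \<in> Spec_points C \<and> pt (Spec_map A C k) P \<in> U")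
    case True
    then obtain a s where a: "a \<in> carrier A" "s \<in> carrier A" "s \<notin> pt (Spec_map A C k) P"
      "\<sigma> (pt (Spec_map A C k) P) = frac A (pt (Spec_map A C k) P) a s"
      using \<sigma> by (auto elim: Spec_section_value)
    then have s: "k s \<notin> P" "g s \<notin> pt (Spec_map B C h) P" "h (g s) \<notin> P"
      by (simp_all add: k.notin_pt_Spec_map h.notin_pt_Spec_map k_eq)
    have "pull (Spec_map A C k) U \<sigma> P = frac C P (k a) (k s)"
      using True a s by (intro k.pull_Spec_map_frac) auto
    moreover have "pull (Spec_map A B g) U \<sigma> (pt (Spec_map B C h) P) =
        frac B (pt (Spec_map B C h) P) (g a) (g s)"
      using True a s h.pt_Spec_map_in by (intro g.pull_Spec_map_frac) (auto simp: pt)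
    then have "pull (Spec_map B C h) (preim (Spec B) (Spec_map A B g) U) (pull (Spec_map A B g) U \<sigma>) P =
        frac C P (h (g a)) (h (g s))"
      using True a s h.pt_Spec_map_in by (intro h.pull_Spec_map_frac) (auto simp: pt mem_preim)
    ultimately show ?thesis using a by (simp add: k_eq)
  next
    case False
    then have "P \<notin> preim (Spec C) (Spec_map A C k) U"
      "P \<notin> preim (Spec C) (Spec_map B C h) (preim (Spec B) (Spec_map A B g) U)"
      by (auto simp: mem_preim pt)
    then show ?thesis
      by (simp add: k.pull_Spec_map h.pull_Spec_map)
  qed
  then show ?thesis by (simp add: mor_eq_def pt fun_eq_iff)
qed

lemma Spec_map_id:
  assumes h: "ring_hom_cring A A h" and h_eq: "\<And>a. a \<in> carrier A \<Longrightarrow> h a = a"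
  shows "mor_eq (Spec A) (Spec A) (Spec_map A A h) mor_id"
proof -
  interpret h: ring_hom_cring A A h by fact
  have pt: "pt (Spec_map A A h) P = P" if "P \<in> Spec_points A" for P
  proof -
    interpret primeideal P A using that by (simp add: Spec_points_def)
    show ?thesis using h_eq a_subset by (auto simp: h.pt_Spec_map)
  qed
  have "pull (Spec_map A A h) U \<sigma> P = \<sigma> P"
    if U: "zariski_open A U" and \<sigma>: "\<sigma> \<in> carrier (Spec_sections A U)" for U \<sigma> P
  proof (cases "P \<in> U")
    case True
    then have P: "P \<in> Spec_points A" using zariski_open_subset[OF U] by blast
    obtain a s where a: "a \<in> carrier A" "s \<in> carrier A" "s \<notin> P" "\<sigma> P = frac A P a s"
      using \<sigma> True by (rule Spec_section_value)
    then have "pull (Spec_map A A h) U \<sigma> P = frac A P (h a) (h s)"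
      using P True by (intro h.pull_Spec_map_frac) (auto simp: pt h_eq)
    then show ?thesis using a by (simp add: h_eq)
  next
    case False
    then have "P \<notin> preim (Spec A) (Spec_map A A h) U" by (auto simp: mem_preim pt)
    then show ?thesis
      using extensional_arb[OF Spec_section_ext[OF \<sigma>] False] by (simp add: h.pull_Spec_map)
  qed
  then show ?thesis by (simp add: mor_eq_def pt fun_eq_iff)
qed

section \<open>Generic points\<close>

text \<open>The clash with the topological \<open>closure_of\<close> makes terms ambiguous.\<close>

no_notation eq_closure_of (\<open>closure'_of\<index>\<close>)

definition sober :: "'x topology \<Rightarrow> bool" where
  "sober T \<longleftrightarrow> (\<forall>V. irreducible_closedin T V \<longrightarrow> (\<exists>!w. w \<in> topspace T \<and> T closure_of {w} = V))"

lemma generic_point: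
  assumes "sober T" "irreducible_closedin T W"
  shows "generic_point T W \<in> topspace T" "T closure_of {generic_point T W} = W"
proof -
  have "\<exists>!w. w \<in> topspace T \<and> T closure_of {w} = W" using assms by (simp add: sober_def)
  from theI'[OF this] show "generic_point T W \<in> topspace T" "T closure_of {generic_point T W} = W"
    by (simp_all add: generic_point_def)
qed

lemma generic_point_eqI:
  assumes "sober T" "irreducible_closedin T W" "w \<in> topspace T" "T closure_of {w} = W"
  shows "generic_point T W = w"
  unfolding generic_point_def
proof (rule the1_equality)
  show "\<exists>!w. w \<in> topspace T \<and> T closure_of {w} = W" using assms by (simp add: sober_def)
qed (use assms in simp)

lemma irreducible_closedin_subset: "irreducible_closedin T V \<Longrightarrow> V \<subseteq> topspace T"
  by (simp add: irreducible_closedin_def closedin_subset)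

lemma irreducible_closedin_or:
  "irreducible_closedin T V \<Longrightarrow> closedin T A \<Longrightarrow> closedin T B \<Longrightarrow> V \<subseteq> A \<union> B \<Longrightarrow> V \<subseteq> A \<or> V \<subseteq> B"
  by (simp add: irreducible_closedin_def)

lemma homeomorphic_maps_image_cancel:
  assumes "homeomorphic_maps S T f g" "V \<subseteq> topspace S"
  shows "g ` f ` V = V"
proof -
  have "g (f x) = x" if "x \<in> V" for x
    using assms that by (auto simp: homeomorphic_maps_def)
  then show ?thesis by (simp add: image_image)
qed

lemma homeomorphic_maps_closedin_image:
  assumes "homeomorphic_maps S T f g" "closedin S V"
  shows "closedin T (f ` V)"
  using assms closedin_subset homeomorphic_map_closedness homeomorphic_maps_map by metis

lemma irreducible_closedin_image:
  assumes fg: "homeomorphic_maps S T f g" and V: "irreducible_closedin S V"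
  shows "irreducible_closedin T (f ` V)"
  unfolding irreducible_closedin_def
proof (intro conjI allI impI)
  have gf: "homeomorphic_maps T S g f" using fg by (rule homeomorphic_maps_sym[THEN iffD1])
  have Vs: "closedin S V" "V \<subseteq> topspace S" "V \<noteq> {}"
    using V irreducible_closedin_subset by (auto simp: irreducible_closedin_def)
  show "closedin T (f ` V)" using fg Vs(1) by (rule homeomorphic_maps_closedin_image)
  show "f ` V \<noteq> {}" using Vs by simp
  fix A B assume AB: "closedin T A \<and> closedin T B \<and> f ` V \<subseteq> A \<union> B"
  then have "g ` f ` V \<subseteq> g ` (A \<union> B)" by (intro image_mono) simp
  then have "V \<subseteq> g ` A \<union> g ` B"
    using homeomorphic_maps_image_cancel[OF fg Vs(2)] by (simp add: image_Un)
  moreover have "closedin S (g ` A)" "closedin S (g ` B)"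
    using AB homeomorphic_maps_closedin_image[OF gf] by blast+
  ultimately have "V \<subseteq> g ` A \<or> V \<subseteq> g ` B"
    using V by (intro irreducible_closedin_or)
  then have "f ` V \<subseteq> f ` g ` A \<or> f ` V \<subseteq> f ` g ` B" by blast
  then show "f ` V \<subseteq> A \<or> f ` V \<subseteq> B"
    using homeomorphic_maps_image_cancel[OF gf] AB by (simp add: closedin_subset)
qed

lemma homeomorphic_maps_closure_of_singleton:
  assumes "homeomorphic_maps S T f g" "w \<in> topspace S"
  shows "T closure_of {f w} = f ` (S closure_of {w})"
  using homeomorphic_map_closure_of[of S T f "{w}"] assms by (simp add: homeomorphic_maps_map)

lemma sober_homeomorphic:
  assumes fg: "homeomorphic_maps S T f g" and S: "sober S"
  shows "sober T"
  unfolding sober_def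
proof (intro allI impI)
  have gf: "homeomorphic_maps T S g f" using fg by (rule homeomorphic_maps_sym[THEN iffD1])
  fix V assume V: "irreducible_closedin T V"
  have "irreducible_closedin S (g ` V)" using gf V by (rule irreducible_closedin_image)
  note irr = S this
  define w where "w = generic_point S (g ` V)"
  have w: "w \<in> topspace S" "S closure_of {w} = g ` V"
    unfolding w_def by (rule generic_point[OF irr])+
  have fw: "f w \<in> topspace T" using fg w by (auto simp: homeomorphic_maps_def continuous_map_def)
  show "\<exists>!w. w \<in> topspace T \<and> T closure_of {w} = V"
  proof (rule ex1I[of _ "f w"])
    show "f w \<in> topspace T \<and> T closure_of {f w} = V"
      using fw homeomorphic_maps_closure_of_singleton[OF fg w(1)] w(2)
        homeomorphic_maps_image_cancel[OF gf irreducible_closedin_subset[OF V]] by simp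
    fix v assume v: "v \<in> topspace T \<and> T closure_of {v} = V"
    then have "g v \<in> topspace S" using gf by (auto simp: homeomorphic_maps_def continuous_map_def)
    then have "g v = w"
      unfolding w_def using homeomorphic_maps_closure_of_singleton[OF gf, of v] v
      by (intro generic_point_eqI[OF irr, symmetric]) auto
    then show "v = f w" using fg v by (auto simp: homeomorphic_maps_def)
  qed
qed

lemma closure_of_singleton_Int_open:
  assumes "openin T U" "x \<in> U" "x \<in> T closure_of {w}"
  shows "w \<in> U"
  using assms by (auto simp: in_closure_of)

lemma sober_locally:
  assumes loc: "\<And>x. x \<in> topspace T \<Longrightarrow> \<exists>U. openin T U \<and> x \<in> U \<and> sober (subtopology T U)"
  shows "sober T"
  unfolding sober_def
proof (intro allI impI)
  fix V assume V: "irreducible_closedin T V"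
  have "V \<noteq> {}" using V by (simp add: irreducible_closedin_def)
  then obtain x where x: "x \<in> V" "x \<in> topspace T"
    using irreducible_closedin_subset[OF V] by blast
  then obtain U where U: "openin T U" "x \<in> U" "sober (subtopology T U)" using loc by blast
  let ?S = "subtopology T U"
  have V': "closedin T V" using V by (simp add: irreducible_closedin_def)
  have compl: "closedin T (topspace T - U)" using U by blast
  have through: "V \<subseteq> C" if "closedin T C" "V \<inter> U \<subseteq> C" for C
  proof -
    have "V \<subseteq> C \<union> (topspace T - U)" using that(2) irreducible_closedin_subset[OF V] by blast
    then have "V \<subseteq> C \<or> V \<subseteq> topspace T - U"
      using V that(1) compl by (intro irreducible_closedin_or) auto
    then show ?thesis using x U(2) by blast
  qed
  have "irreducible_closedin ?S (V \<inter> U)"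
    unfolding irreducible_closedin_def
  proof (intro conjI allI impI)
    show "closedin ?S (V \<inter> U)" using V' by (auto simp: closedin_subtopology)
    show "V \<inter> U \<noteq> {}" using x U by blast
    fix A B assume "closedin ?S A \<and> closedin ?S B \<and> V \<inter> U \<subseteq> A \<union> B"
    then obtain A' B' where AB: "closedin T A'" "A = A' \<inter> U" "closedin T B'" "B = B' \<inter> U"
      "V \<inter> U \<subseteq> A \<union> B"
      by (auto simp: closedin_subtopology)
    then have "V \<subseteq> A' \<union> B'" by (intro through) (auto intro: closedin_Un)
    then have "V \<subseteq> A' \<or> V \<subseteq> B'" using V AB by (intro irreducible_closedin_or) auto
    then show "V \<inter> U \<subseteq> A \<or> V \<inter> U \<subseteq> B" using AB by blast
  qed
  note irr = U(3) this
  define w where "w = generic_point ?S (V \<inter> U)"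
  have w: "w \<in> topspace ?S" "?S closure_of {w} = V \<inter> U"
    unfolding w_def by (rule generic_point[OF irr])+
  have cl: "?S closure_of {v} = U \<inter> T closure_of {v}" for v
    using U(1) by (simp add: closure_of_subtopology_open)
  have wT: "w \<in> topspace T" "w \<in> U" using w by auto
  show "\<exists>!w. w \<in> topspace T \<and> T closure_of {w} = V"
  proof (rule ex1I[of _ w])
    have "w \<in> V" using w wT closure_of_subset[of "{w}" ?S] by auto
    then have "T closure_of {w} \<subseteq> V" using V' by (intro closure_of_minimal) auto
    moreover have "V \<subseteq> T closure_of {w}" using w(2) cl by (intro through) auto
    ultimately show "w \<in> topspace T \<and> T closure_of {w} = V" using wT by blast
    fix v assume v: "v \<in> topspace T \<and> T closure_of {v} = V"
    then have "v \<in> U" using closure_of_singleton_Int_open[OF U(1,2), of v] x by simp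
    then show "v = w" unfolding w_def using v cl
      by (intro generic_point_eqI[OF irr, symmetric]) auto
  qed
qed

lemma closedin_Spec:
  "closedin (space_of (Spec R)) V \<longleftrightarrow> (\<exists>S \<subseteq> carrier R. V = {P \<in> Spec_points R. S \<subseteq> P})"
proof
  assume "closedin (space_of (Spec R)) V"
  then have V: "V \<subseteq> Spec_points R" "zariski_open R (Spec_points R - V)"
    by (simp_all add: closedin_def)
  then obtain S where "S \<subseteq> carrier R" "Spec_points R - V = {P \<in> Spec_points R. \<not> S \<subseteq> P}"
    by (auto simp: zariski_open_def)
  then show "\<exists>S \<subseteq> carrier R. V = {P \<in> Spec_points R. S \<subseteq> P}"
    using V(1) by (intro exI[of _ S]) blast
next
  assume "\<exists>S \<subseteq> carrier R. V = {P \<in> Spec_points R. S \<subseteq> P}"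
  then obtain S where "S \<subseteq> carrier R" "V = {P \<in> Spec_points R. S \<subseteq> P}" by blast
  then have "zariski_open R (Spec_points R - V)"
    unfolding zariski_open_def by (intro exI[of _ S]) auto
  then show "closedin (space_of (Spec R)) V"
    using \<open>V = _\<close> by (auto simp: closedin_def)
qed

lemma closure_of_point_Spec:
  assumes "P \<in> Spec_points R"
  shows "(space_of (Spec R)) closure_of {P} = {Q \<in> Spec_points R. P \<subseteq> Q}"
proof (rule closure_of_unique)
  have "P \<subseteq> carrier R"
    using assms by (auto simp: Spec_points_def dest: primeideal.axioms(1) ideal.Icarr)
  then show "closedin (space_of (Spec R)) {Q \<in> Spec_points R. P \<subseteq> Q}"
    unfolding closedin_Spec by blast
  show "{P} \<subseteq> {Q \<in> Spec_points R. P \<subseteq> Q}" using assms by simp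
  show "{Q \<in> Spec_points R. P \<subseteq> Q} \<subseteq> T" if "{P} \<subseteq> T" "closedin (space_of (Spec R)) T" for T
    using that unfolding closedin_Spec by auto
qed

text \<open>The generic point of an irreducible closed set of primes is the intersection of its elements.\<close>

lemma sober_Spec:
  assumes R: "cring R"
  shows "sober (space_of (Spec R))"
  unfolding sober_def
proof (intro allI impI)
  interpret cring R by fact
  fix V assume V: "irreducible_closedin (space_of (Spec R)) V"
  then obtain S where S: "S \<subseteq> carrier R" "V = {P \<in> Spec_points R. S \<subseteq> P}"
    unfolding irreducible_closedin_def closedin_Spec by blast
  have ne: "V \<noteq> {}" using V by (simp add: irreducible_closedin_def)
  have prime: "primeideal P R" if "P \<in> V" for P using that S by (simp add: Spec_points_def)
  have "primeideal (\<Inter>V) R"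
  proof (rule primeidealI)
    show ideal: "ideal (\<Inter>V) R"
      using prime ne by (intro i_Intersect) (auto dest: primeideal.axioms(1))
    obtain P where P: "P \<in> V" using ne by blast
    interpret P: primeideal P R using P by (rule prime)
    show "carrier R \<noteq> \<Inter>V" using P P.I_notcarr P.a_subset by blast
    fix a b assume ab: "a \<in> carrier R" "b \<in> carrier R" "a \<otimes>\<^bsub>R\<^esub> b \<in> \<Inter>V"
    let ?C = "\<lambda>c. {P \<in> Spec_points R. {c} \<subseteq> P}"
    have "closedin (space_of (Spec R)) (?C a)" "closedin (space_of (Spec R)) (?C b)"
      unfolding closedin_Spec using ab by blast+
    moreover have "V \<subseteq> ?C a \<union> ?C b"
    proof
      fix Q assume Q: "Q \<in> V"
      interpret Q: primeideal Q R using Q by (rule prime)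
      show "Q \<in> ?C a \<union> ?C b" using Q ab Q.I_prime S by auto
    qed
    ultimately have "V \<subseteq> ?C a \<or> V \<subseteq> ?C b" using V by (intro irreducible_closedin_or) auto
    then show "a \<in> \<Inter>V \<or> b \<in> \<Inter>V" by blast
  qed (fact R)
  then have I: "\<Inter>V \<in> Spec_points R" by (simp add: Spec_points_def)
  have "S \<subseteq> \<Inter>V" using S by blast
  then have eq: "{Q \<in> Spec_points R. \<Inter>V \<subseteq> Q} = V" using S(2) by blast
  show "\<exists>!w. w \<in> topspace (space_of (Spec R)) \<and> (space_of (Spec R)) closure_of {w} = V"
  proof (rule ex1I[of _ "\<Inter>V"])
    show "\<Inter>V \<in> topspace (space_of (Spec R)) \<and> (space_of (Spec R)) closure_of {\<Inter>V} = V"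
      using I eq by (simp add: closure_of_point_Spec)
    fix P assume P: "P \<in> topspace (space_of (Spec R)) \<and> (space_of (Spec R)) closure_of {P} = V"
    then have "P \<in> Spec_points R" by simp
    moreover from this have "{Q \<in> Spec_points R. P \<subseteq> Q} = V"
      using P closure_of_point_Spec by blast
    ultimately show "P = \<Inter>V" by blast
  qed
qed

lemma lrs_isomorphic_homeomorphic:
  assumes "lrs_isomorphic X Y"
  shows "\<exists>f g. homeomorphic_maps (space_of X) (space_of Y) f g"
proof -
  obtain f g where fg: "lrs_morphism X Y f" "lrs_morphism Y X g"
    "mor_eq X X (mor_comp Y g f) mor_id" "mor_eq Y Y (mor_comp X f g) mor_id"
    using assms by (auto simp: lrs_isomorphic_def)
  then have "homeomorphic_maps (space_of X) (space_of Y) (pt f) (pt g)"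
    by (auto simp: homeomorphic_maps_def lrs_morphism_def mor_eq_def)
  then show ?thesis by blast
qed

lemma sober_scheme:
  assumes "scheme X"
  shows "sober (space_of X)"
proof (rule sober_locally)
  fix x assume "x \<in> points X"
  then obtain U where U: "x \<in> U" "affine_open X U" using assms by (auto simp: scheme_def)
  then obtain R :: "'b ring" where R: "cring R" "lrs_isomorphic (open_subspace X U) (Spec R)"
    by (auto simp: affine_open_def)
  then obtain f g where "homeomorphic_maps (subtopology (space_of X) U) (space_of (Spec R)) f g"
    using lrs_isomorphic_homeomorphic[OF R(2)] by (auto simp: open_subspace_def)
  then have "homeomorphic_maps (space_of (Spec R)) (subtopology (space_of X) U) g f"
    by (rule homeomorphic_maps_sym[THEN iffD1])
  then have "sober (subtopology (space_of X) U)"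
    using sober_Spec[OF R(1)] by (rule sober_homeomorphic)
  then show "\<exists>U. is_open X U \<and> x \<in> U \<and> sober (subtopology (space_of X) U)"
    using U by (auto simp: affine_open_def)
qed

section \<open>Pullback of cycles\<close>

lemma ring_length_upper:
  assumes "\<And>i. i \<le> r \<Longrightarrow> ideal (I i) R" "\<And>i. i < r \<Longrightarrow> I i \<subset> I (Suc i)"
  shows "enat r \<le> ring_length R"
  unfolding ring_length_def using assms by (intro Sup_upper CollectI exI[of _ r] exI[of _ I]) simp

lemma ring_length_least:
  assumes "\<And>r I. (\<And>i. i \<le> r \<Longrightarrow> ideal (I i) R) \<Longrightarrow> (\<And>i. i < r \<Longrightarrow> I i \<subset> I (Suc i)) \<Longrightarrow> enat r \<le> e"
  shows "ring_length R \<le> e"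
  unfolding ring_length_def
proof (rule Sup_least)
  fix x assume "x \<in> {enat r |r I. (\<forall>i\<le>r. ideal (I i) R) \<and> (\<forall>i<r. I i \<subset> I (Suc i))}"
  then obtain r I where I: "x = enat r" "\<forall>i\<le>r. ideal (I i) R" "\<forall>i<r. I i \<subset> I (Suc i)"
    by (elim CollectE exE conjE)
  show "x \<le> e" unfolding I(1) by (rule assms[of r I]) (simp_all add: I(2,3))
qed

lemma ring_length_field:
  assumes "field F"
  shows "ring_length F = 1"
proof -
  interpret field F by fact
  have ideals: "ideal I F \<longleftrightarrow> I = {\<zero>\<^bsub>F\<^esub>} \<or> I = carrier F" for I
    using all_ideals by blast
  have strict: "{\<zero>\<^bsub>F\<^esub>} \<subset> carrier F" using one_closed zero_closed one_not_zero by blast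
  show ?thesis
  proof (rule antisym)
    show "ring_length F \<le> 1"
    proof (rule ring_length_least)
      fix r and I :: "nat \<Rightarrow> 'a set"
      assume I: "\<And>i. i \<le> r \<Longrightarrow> ideal (I i) F" "\<And>i. i < r \<Longrightarrow> I i \<subset> I (Suc i)"
      have "r < 2"
      proof (rule ccontr)
        assume "\<not> r < 2"
        then have "ideal (I 0) F" "ideal (I 1) F" "ideal (I 2) F" "I 0 \<subset> I 1" "I 1 \<subset> I 2"
          using I(1)[of 0] I(1)[of 1] I(1)[of 2] I(2)[of 0] I(2)[of 1] by (simp_all add: numeral_2_eq_2)
        then show False using strict unfolding ideals by auto
      qed
      then show "enat r \<le> 1" by (simp add: one_enat_def)
    qed
    have "enat 1 \<le> ring_length F"
      by (rule ring_length_upper[where I = "\<lambda>i. if i = 0 then {\<zero>\<^bsub>F\<^esub>} else carrier F"])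
        (use strict in \<open>auto simp: ideals\<close>)
    then show "1 \<le> ring_length F" by (simp add: one_enat_def)
  qed
qed

lemma ring_length_local_ring:
  assumes "local_ring R"
  shows "ring_length (R Quot nonunits R) = 1"
proof -
  interpret cring R using assms by (simp add: local_ring_def)
  have id: "ideal (nonunits R) R" using assms by (simp add: local_ring_def)
  have "maximalideal (nonunits R) R"
  proof (rule maximalidealI[OF id])
    show "carrier R \<noteq> nonunits R" using Units_one_closed one_closed by (auto simp: nonunits_def)
    fix J assume J: "ideal J R" "nonunits R \<subseteq> J" "J \<subseteq> carrier R"
    show "J = nonunits R \<or> J = carrier R"
    proof (cases "J \<subseteq> nonunits R")
      case False
      then obtain u where "u \<in> J" "u \<in> Units R" using J(3) by (auto simp: nonunits_def)
      then show ?thesis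
        using ideal.I_r_closed[OF J(1), of u "inv\<^bsub>R\<^esub> u"] ideal.one_imp_carrier[OF J(1)] by simp
    qed (use J in auto)
  qed
  then show ?thesis
    using cring_axioms by (intro ring_length_field maximalideal.quotient_is_field)
qed

lemma ring_length_surj:
  assumes h: "ring_hom_ring R S h" and surj: "h ` carrier R = carrier S"
  shows "ring_length S \<le> ring_length R"
proof (rule ring_length_least)
  interpret ring_hom_ring R S h by fact
  fix r I assume I: "\<And>i. i \<le> r \<Longrightarrow> ideal (I i) S" "\<And>i. i < r \<Longrightarrow> I i \<subset> I (Suc i)"
  show "enat r \<le> ring_length R"
  proof (rule ring_length_upper)
    fix i
    show "ideal {x \<in> carrier R. h x \<in> I i} R" if "i \<le> r"
      using I(1)[OF that] by (rule ideal_vimage)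
    assume i: "i < r"
    obtain y where y: "y \<in> I (Suc i)" "y \<notin> I i" using I(2)[OF i] by blast
    have "y \<in> carrier S" using I(1)[of "Suc i"] i y(1) ideal.Icarr by fastforce
    then have "y \<in> h ` carrier R" unfolding surj .
    then obtain x where x: "y = h x" "x \<in> carrier R" by (rule imageE)
    show "{x \<in> carrier R. h x \<in> I i} \<subset> {x \<in> carrier R. h x \<in> I (Suc i)}"
    proof (rule psubsetI)
      show "{x \<in> carrier R. h x \<in> I i} \<subseteq> {x \<in> carrier R. h x \<in> I (Suc i)}"
        using I(2)[OF i] by (intro Collect_mono) auto
      have "x \<in> {x \<in> carrier R. h x \<in> I (Suc i)}" "x \<notin> {x \<in> carrier R. h x \<in> I i}"
        using x y by simp_all
      then show "{x \<in> carrier R. h x \<in> I i} \<noteq> {x \<in> carrier R. h x \<in> I (Suc i)}"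
        by metis
    qed
  qed
qed

lemma ring_length_quot_genideal_le:
  assumes R: "ring R" and S: "ring S" and h: "h \<in> ring_hom R S" and k: "k \<in> ring_hom S R"
    and hk: "\<And>x. x \<in> carrier R \<Longrightarrow> k (h x) = x" "\<And>y. y \<in> carrier S \<Longrightarrow> h (k y) = y"
    and A: "A \<subseteq> carrier R"
  shows "ring_length (S Quot Idl\<^bsub>S\<^esub> (h ` A)) \<le> ring_length (R Quot Idl\<^bsub>R\<^esub> A)"
proof -
  let ?I = "Idl\<^bsub>R\<^esub> A" and ?J = "Idl\<^bsub>S\<^esub> (h ` A)"
  note hring = ring_hom_ringI2[OF R S h] and kring = ring_hom_ringI2[OF S R k]
  have hA: "h ` A \<subseteq> carrier S" using A ring_hom_closed[OF h] by blast
  have I: "ideal ?I R" using R A by (rule ring.genideal_ideal)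
  have J: "ideal ?J S" using S hA by (rule ring.genideal_ideal)
  let ?g = "\<lambda>x. ?J +>\<^bsub>S\<^esub> h x"
  have "?g \<in> ring_hom R (S Quot ?J)"
    using ring_hom_trans[OF h ideal.rcos_ring_hom[OF J]] unfolding comp_def .
  then have g: "ring_hom_ring R (S Quot ?J) ?g"
    by (rule ring_hom_ringI2[OF R ideal.quotient_is_ring[OF J]])
  have "h ` carrier R = carrier S"
  proof
    show "h ` carrier R \<subseteq> carrier S" using ring_hom_closed[OF h] by blast
    show "carrier S \<subseteq> h ` carrier R"
    proof
      fix y assume "y \<in> carrier S"
      then show "y \<in> h ` carrier R"
        using hk(2)[of y] ring_hom_closed[OF k, of y] by (intro image_eqI[of y h "k y"]) simp_all
    qed
  qed
  then have "?g ` carrier R = (\<lambda>y. ?J +>\<^bsub>S\<^esub> y) ` carrier S"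
    by (metis image_image)
  then have surj: "?g ` carrier R = carrier (S Quot ?J)"
    by (auto simp: FactRing_def A_RCOSETS_defs a_r_coset_def)
  have mem: "?J +>\<^bsub>S\<^esub> y = ?J \<longleftrightarrow> y \<in> ?J" if y: "y \<in> carrier S" for y
  proof
    interpret J: ideal ?J S by (rule J)
    show "y \<in> ?J" if "?J +>\<^bsub>S\<^esub> y = ?J" using J.a_rcos_self[OF y] that by simp
    show "?J +>\<^bsub>S\<^esub> y = ?J" if "y \<in> ?J" using that by (rule J.a_rcos_const)
  qed
  have "a_kernel R (S Quot ?J) ?g = {x \<in> carrier R. ?g x = ?J}"
    by (simp add: a_kernel_def' FactRing_def)
  also have "\<dots> = {x \<in> carrier R. h x \<in> ?J}"
    using mem ring_hom_closed[OF h] by blast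
  also have "\<dots> = ?I"
  proof
    have "h ` A \<subseteq> {y \<in> carrier S. k y \<in> ?I}"
    proof
      fix y assume "y \<in> h ` A"
      then obtain x where "y = h x" "x \<in> A" by (rule imageE)
      moreover from this have "x \<in> carrier R" "x \<in> ?I" using A ring.genideal_self[OF R A] by blast+
      ultimately show "y \<in> {y \<in> carrier S. k y \<in> ?I}"
        using hk(1)[of x] ring_hom_closed[OF h, of x] by simp
    qed
    then have "?J \<subseteq> {y \<in> carrier S. k y \<in> ?I}"
      by (rule ring.genideal_minimal[OF S ring_hom_ring.ideal_vimage[OF kring I]])
    then show "{x \<in> carrier R. h x \<in> ?J} \<subseteq> ?I" using hk(1) by force
    have "A \<subseteq> {x \<in> carrier R. h x \<in> ?J}"
      using A ring.genideal_self[OF S hA] by auto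
    then show "?I \<subseteq> {x \<in> carrier R. h x \<in> ?J}"
      by (rule ring.genideal_minimal[OF R ring_hom_ring.ideal_vimage[OF hring J]])
  qed
  finally have ker: "a_kernel R (S Quot ?J) ?g = ?I" .
  let ?\<theta> = "\<lambda>X. the_elem (?g ` X)"
  have \<theta>: "?\<theta> \<in> ring_iso (R Quot ?I) (S Quot ?J)"
    using ring_hom_ring.FactRing_iso_set[OF g surj] unfolding ker .
  show ?thesis
  proof (rule ring_length_surj)
    show "ring_hom_ring (R Quot ?I) (S Quot ?J) ?\<theta>"
      using \<theta> by (intro ring_hom_ringI2 ideal.quotient_is_ring I J) (simp add: ring_iso_def)
    show "?\<theta> ` carrier (R Quot ?I) = carrier (S Quot ?J)"
      using \<theta> by (simp add: ring_iso_def bij_betw_def)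
  qed
qed

lemma ring_length_quot_genideal:
  assumes "ring R" "ring S" "h \<in> ring_hom R S" "k \<in> ring_hom S R"
    and hk: "\<And>x. x \<in> carrier R \<Longrightarrow> k (h x) = x" "\<And>y. y \<in> carrier S \<Longrightarrow> h (k y) = y"
    and A: "A \<subseteq> carrier R"
  shows "ring_length (S Quot Idl\<^bsub>S\<^esub> (h ` A)) = ring_length (R Quot Idl\<^bsub>R\<^esub> A)"
proof (rule antisym)
  show "ring_length (S Quot Idl\<^bsub>S\<^esub> (h ` A)) \<le> ring_length (R Quot Idl\<^bsub>R\<^esub> A)"
    using assms by (rule ring_length_quot_genideal_le)
  have "k ` h ` A = A"
  proof -
    have "k (h x) = x" if "x \<in> A" for x using that A hk(1) by blast
    then show ?thesis by (simp add: image_image)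
  qed
  moreover have "h ` A \<subseteq> carrier S" using A assms(3) by (auto simp: ring_hom_closed)
  ultimately show "ring_length (R Quot Idl\<^bsub>R\<^esub> A) \<le> ring_length (S Quot Idl\<^bsub>S\<^esub> (h ` A))"
    using ring_length_quot_genideal_le[of S R k h "h ` A"] assms by simp
qed

lemma ideal_stalkE:
  assumes "c \<in> ideal_stalk Y V y"
  obtains U s where "c = germ Y y U s" "is_open Y U" "y \<in> U" "s \<in> carrier (sections Y U)"
    "\<And>v. v \<in> U \<Longrightarrow> v \<in> V \<Longrightarrow> germ Y v U s \<in> nonunits (stalk Y v)"
  using assms by (auto simp: ideal_stalk_def)

lemma ideal_stalk_subset: "ideal_stalk Y V y \<subseteq> carrier (stalk Y y)"
  by (auto elim!: ideal_stalkE intro: germ_in_stalk)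

lemma ideal_stalk_generic:
  assumes Y: "section_presheaf Y" and y: "y \<in> points Y" "(space_of Y) closure_of {y} = V"
  shows "ideal_stalk Y V y = nonunits (stalk Y y)"
proof
  interpret section_presheaf Y by fact
  have yV: "y \<in> V" using y closure_of_subset[of "{y}" "space_of Y"] by auto
  show "ideal_stalk Y V y \<subseteq> nonunits (stalk Y y)"
    using yV by (auto elim!: ideal_stalkE)
  show "nonunits (stalk Y y) \<subseteq> ideal_stalk Y V y"
  proof
    fix c assume c: "c \<in> nonunits (stalk Y y)"
    then obtain U s where U: "c = germ Y y U s" "is_open Y U" "y \<in> U" "s \<in> carrier (sections Y U)"
      by (auto simp: nonunits_def elim: stalkE)
    have "germ Y v U s \<in> nonunits (stalk Y v)" if v: "v \<in> U" "v \<in> V" for v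
    proof (rule ccontr)
      assume "germ Y v U s \<notin> nonunits (stalk Y v)"
      then have "germ Y v U s \<in> Units (stalk Y v)"
        using germ_in_stalk[of Y U v s] U v by (simp add: nonunits_def)
      then obtain W where W: "is_open Y W" "v \<in> W" "W \<subseteq> U" "restr Y U W s \<in> Units (sections Y W)"
        using U v by (auto simp: germ_Units_iff)
      then have "y \<in> W" using closure_of_singleton_Int_open[OF W(1,2)] v y(2) by simp
      then have "c \<in> Units (stalk Y y)" using U W by (auto simp: germ_Units_iff)
      then show False using c by (simp add: nonunits_def)
    qed
    then show "c \<in> ideal_stalk Y V y"
      unfolding ideal_stalk_def using U by (intro CollectI exI[of _ U] exI[of _ s]) simp
  qed
qed

lemma stalk_map_ideal_stalk:
  assumes X: "section_presheaf X" and f: "lrs_morphism X Y f" and x: "x \<in> points X"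
    and c: "c \<in> ideal_stalk Y V (pt f x)"
  shows "stalk_map X f x c \<in> ideal_stalk X (preim X f V) x"
proof -
  interpret ringed_morphism X Y f using X f by (rule lrs_morphism_ringed)
  obtain U s where U: "c = germ Y (pt f x) U s" "is_open Y U" "pt f x \<in> U" "s \<in> carrier (sections Y U)"
    "\<And>v. v \<in> U \<Longrightarrow> v \<in> V \<Longrightarrow> germ Y v U s \<in> nonunits (stalk Y v)"
    using c by (rule ideal_stalkE) blast
  have "germ X v (preim X f U) (pull f U s) \<in> nonunits (stalk X v)"
    if "v \<in> preim X f U" "v \<in> preim X f V" for v
  proof -
    have v: "v \<in> points X" "pt f v \<in> U" "pt f v \<in> V" using that by (simp_all add: mem_preim)
    let ?g = "germ Y (pt f v) U s"
    have g: "?g \<in> nonunits (stalk Y (pt f v))" using U(5) v by blast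
    have "stalk_map X f v ?g \<in> carrier (stalk X v)"
      using v g by (intro stalk_map_closed) (auto simp: nonunits_def)
    moreover have "stalk_map X f v ?g \<notin> Units (stalk X v)"
      using lrs_morphism_reflects_Units[OF f v(1)] g by (auto simp: nonunits_def)
    ultimately show ?thesis using U v by (simp add: nonunits_def stalk_map_germ)
  qed
  then show ?thesis
    unfolding ideal_stalk_def U(1) stalk_map_germ[OF x U(2-4)]
    by (intro CollectI exI[of _ "preim X f U"] exI[of _ "pull f U s"])
      (simp add: x U(2-4) open_preim pull_closed mem_preim)
qed

definition pullback_mult ::
  "('z, 'r) ringed_space \<Rightarrow> ('y, 't) ringed_space \<Rightarrow> ('z, 'r, 'y, 't) mor \<Rightarrow> 'y set \<Rightarrow> 'z set \<Rightarrow> int" where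
  "pullback_mult Z Y f V W =
     (let w = generic_point (space_of Z) W in
      int (the_enat (ring_length (stalk Z w Quot
        Idl\<^bsub>stalk Z w\<^esub> (stalk_map Z f w ` ideal_stalk Y V (pt f w))))))"

lemma pullback_subvariety_eq:
  "pullback_subvariety Z Y f V =
     (\<Sum>W \<in> irreducible_components (space_of Z) (preim Z f V).
        frag_cmul (pullback_mult Z Y f V W) (frag_of W))"
  by (simp add: pullback_subvariety_def pullback_mult_def Let_def)

lemma irreducible_components_irreducible:
  "W \<in> irreducible_components T C \<Longrightarrow> irreducible_closedin T W"
  by (simp add: irreducible_components_def)

lemma irreducible_components_of_irreducible:
  assumes "irreducible_closedin T V"
  shows "irreducible_components T V = {V}"
  using assms by (auto simp: irreducible_components_def)

lemma irreducible_components_image_subset: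
  assumes fg: "homeomorphic_maps S T f g" and C: "C \<subseteq> topspace S"
  shows "(`) f ` irreducible_components S C \<subseteq> irreducible_components T (f ` C)"
proof clarify
  have gf: "homeomorphic_maps T S g f" using fg by (rule homeomorphic_maps_sym[THEN iffD1])
  fix W assume W: "W \<in> irreducible_components S C"
  then have W': "irreducible_closedin S W" "W \<subseteq> C"
    "\<And>W'. irreducible_closedin S W' \<Longrightarrow> W \<subseteq> W' \<Longrightarrow> W' \<subseteq> C \<Longrightarrow> W' = W"
    by (auto simp: irreducible_components_def)
  have "W' = f ` W" if h: "irreducible_closedin T W'" "f ` W \<subseteq> W'" "W' \<subseteq> f ` C" for W'
  proof -
    have c: "g ` f ` W = W" "g ` f ` C = C"
      using W'(2) C by (auto intro!: homeomorphic_maps_image_cancel[OF fg])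
    have c': "f ` g ` W' = W'"
      by (rule homeomorphic_maps_image_cancel[OF gf irreducible_closedin_subset[OF h(1)]])
    from c have "W \<subseteq> g ` W'" "g ` W' \<subseteq> C" using image_mono[OF h(2), of g] image_mono[OF h(3), of g] by auto
    then have "g ` W' = W" by (intro W'(3) irreducible_closedin_image[OF gf h(1)])
    then show ?thesis using c' by simp
  qed
  then show "f ` W \<in> irreducible_components T (f ` C)"
    using W'(2) irreducible_closedin_image[OF fg W'(1)] unfolding irreducible_components_def
    by (intro CollectI conjI image_mono allI impI) auto
qed

lemma irreducible_components_image:
  assumes fg: "homeomorphic_maps S T f g" and C: "C \<subseteq> topspace S"
  shows "irreducible_components T (f ` C) = (`) f ` irreducible_components S C"
proof
  have gf: "homeomorphic_maps T S g f" using fg by (rule homeomorphic_maps_sym[THEN iffD1])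
  have fC: "f ` C \<subseteq> topspace T" using fg C by (auto simp: homeomorphic_maps_def continuous_map_def)
  show "irreducible_components T (f ` C) \<subseteq> (`) f ` irreducible_components S C"
  proof
    fix W assume W: "W \<in> irreducible_components T (f ` C)"
    then have "g ` W \<in> irreducible_components S (g ` f ` C)"
      by (intro subsetD[OF irreducible_components_image_subset[OF gf fC]] imageI)
    then have "g ` W \<in> irreducible_components S C"
      by (simp only: homeomorphic_maps_image_cancel[OF fg C])
    moreover have "f ` g ` W = W"
      using irreducible_components_irreducible[OF W]
      by (intro homeomorphic_maps_image_cancel[OF gf] irreducible_closedin_subset)
    ultimately show "W \<in> (`) f ` irreducible_components S C" by (intro image_eqI[of _ _ "g ` W"]) simp
  qed
qed (rule irreducible_components_image_subset[OF assms])

locale scheme_iso =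
  fixes Z :: "('z, 'r) ringed_space" and Y :: "('y, 't) ringed_space"
    and f :: "('z, 'r, 'y, 't) mor" and g :: "('y, 't, 'z, 'r) mor"
  assumes Z: "scheme Z" and Y: "scheme Y"
    and f: "lrs_morphism Z Y f" and g: "lrs_morphism Y Z g"
    and gf: "mor_eq Z Z (mor_comp Y g f) mor_id" and fg: "mor_eq Y Y (mor_comp Z f g) mor_id"
begin

sublocale f: ringed_morphism Z Y f
  by (rule lrs_morphism_ringed[OF scheme_section_presheaf[OF Z] f])

sublocale g: ringed_morphism Y Z g
  by (rule lrs_morphism_ringed[OF scheme_section_presheaf[OF Y] g])

lemma pt_gf: "z \<in> points Z \<Longrightarrow> pt g (pt f z) = z"
  using gf by (simp add: mor_eq_def)

lemma pt_fg: "y \<in> points Y \<Longrightarrow> pt f (pt g y) = y"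
  using fg by (simp add: mor_eq_def)

lemma homeo: "homeomorphic_maps (space_of Y) (space_of Z) (pt g) (pt f)"
  using f.cont g.cont pt_gf pt_fg by (simp add: homeomorphic_maps_def)

lemma preim_eq_image: "V \<subseteq> points Y \<Longrightarrow> preim Z f V = pt g ` V"
  using pt_gf pt_fg g.pt_in by (force simp: mem_preim)

lemma preim_preim: "V \<subseteq> points Y \<Longrightarrow> preim Y g (preim Z f V) = V"
  using pt_fg g.pt_in by (auto simp: mem_preim)

lemma irreducible_preim: "irreducible_closedin (space_of Y) V \<Longrightarrow> irreducible_closedin (space_of Z) (preim Z f V)"
  using irreducible_closedin_image[OF homeo] by (simp add: preim_eq_image irreducible_closedin_subset)

lemma stalk_map_gf:
  assumes z: "z \<in> points Z" and c: "c \<in> carrier (stalk Z z)"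
  shows "stalk_map Z f z (stalk_map Y g (pt f z) c) = c"
proof -
  note rm = f.ringed_morphism_axioms g.ringed_morphism_axioms
  have "stalk_map Z f z (stalk_map Y g (pt f z) c) = stalk_map Z (mor_comp Y g f) z c"
    using stalk_map_comp[OF rm z] c pt_gf[OF z] by simp
  also have "\<dots> = stalk_map Z mor_id z c"
    using z c pt_gf[OF z] by (intro stalk_map_mor_eq[OF ringed_morphism_comp[OF rm]
      ringed_morphism_id[OF f.X.section_presheaf_axioms] gf]) auto
  also have "\<dots> = c"
    using f.X.section_presheaf_axioms z c by (rule stalk_map_id)
  finally show ?thesis .
qed

lemma stalk_map_fg:
  assumes z: "z \<in> points Z" and c: "c \<in> carrier (stalk Y (pt f z))"
  shows "stalk_map Y g (pt f z) (stalk_map Z f z c) = c"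
proof -
  note rm = g.ringed_morphism_axioms f.ringed_morphism_axioms
  have y: "pt f z \<in> points Y" using z by (rule f.pt_in)
  have "stalk_map Y g (pt f z) (stalk_map Z f z c) = stalk_map Y (mor_comp Z f g) (pt f z) c"
    using stalk_map_comp[OF rm y] c pt_gf[OF z] by simp
  also have "\<dots> = stalk_map Y mor_id (pt f z) c"
    using y c pt_gf[OF z] by (intro stalk_map_mor_eq[OF ringed_morphism_comp[OF rm]
      ringed_morphism_id[OF g.X.section_presheaf_axioms] fg]) auto
  also have "\<dots> = c"
    using g.X.section_presheaf_axioms y c by (rule stalk_map_id)
  finally show ?thesis .
qed

lemma stalk_map_image_ideal_stalk:
  assumes V: "V \<subseteq> points Y" and z: "z \<in> points Z"
  shows "stalk_map Z f z ` ideal_stalk Y V (pt f z) = ideal_stalk Z (preim Z f V) z"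
proof
  show "stalk_map Z f z ` ideal_stalk Y V (pt f z) \<subseteq> ideal_stalk Z (preim Z f V) z"
    using stalk_map_ideal_stalk[OF f.X.section_presheaf_axioms f z] by blast
  show "ideal_stalk Z (preim Z f V) z \<subseteq> stalk_map Z f z ` ideal_stalk Y V (pt f z)"
  proof
    fix c assume c: "c \<in> ideal_stalk Z (preim Z f V) z"
    then have "stalk_map Y g (pt f z) c \<in> ideal_stalk Y (preim Y g (preim Z f V)) (pt f z)"
      using z by (intro stalk_map_ideal_stalk[OF g.X.section_presheaf_axioms g])
        (simp_all add: f.pt_in pt_gf)
    then have "stalk_map Y g (pt f z) c \<in> ideal_stalk Y V (pt f z)"
      by (simp add: preim_preim[OF V])
    moreover have "c = stalk_map Z f z (stalk_map Y g (pt f z) c)"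
      using stalk_map_gf[OF z subsetD[OF ideal_stalk_subset c]] by simp
    ultimately show "c \<in> stalk_map Z f z ` ideal_stalk Y V (pt f z)" by blast
  qed
qed

lemma pullback_subvariety_iso:
  assumes V: "irreducible_closedin (space_of Y) V"
  shows "pullback_subvariety Z Y f V = frag_of (preim Z f V)"
proof -
  let ?W = "preim Z f V"
  have W: "irreducible_closedin (space_of Z) ?W" using V by (rule irreducible_preim)
  define w where "w = generic_point (space_of Z) ?W"
  have w: "w \<in> points Z" "(space_of Z) closure_of {w} = ?W"
    unfolding w_def by (rule generic_point[OF sober_scheme[OF Z] W])+
  have loc: "local_ring (stalk Z w)" using Z w(1) by (rule scheme_local_ring_stalk)
  interpret R: cring "stalk Z w" using loc by (simp add: local_ring_def)
  have id: "ideal (nonunits (stalk Z w)) (stalk Z w)" using loc by (simp add: local_ring_def)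
  have "stalk_map Z f w ` ideal_stalk Y V (pt f w) = nonunits (stalk Z w)"
    using stalk_map_image_ideal_stalk[OF irreducible_closedin_subset[OF V] w(1)]
      ideal_stalk_generic[OF f.X.section_presheaf_axioms w] by simp
  moreover have "Idl\<^bsub>stalk Z w\<^esub> (nonunits (stalk Z w)) = nonunits (stalk Z w)"
    using id R.genideal_minimal[OF id] R.genideal_self[of "nonunits (stalk Z w)"]
    by (auto simp: nonunits_def)
  ultimately have "pullback_mult Z Y f V ?W = 1"
    using ring_length_local_ring[OF loc]
    by (simp add: pullback_mult_def Let_def one_enat_def flip: w_def)
  then show ?thesis
    by (simp add: pullback_subvariety_eq irreducible_components_of_irreducible[OF W])
qed

lemma pullback_subvariety_comp_iso:
  assumes X: "scheme X" and h: "lrs_morphism X Z h" and V: "V \<subseteq> points Y"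
  shows "pullback_subvariety X Y (mor_comp Z f h) V = pullback_subvariety X Z h (preim Z f V)"
proof -
  interpret h: ringed_morphism X Z h
    using h by (rule lrs_morphism_ringed[OF scheme_section_presheaf[OF X]])
  have pre: "preim X (mor_comp Z f h) V = preim X h (preim Z f V)"
    by (rule preim_mor_comp) (rule h.pt_in)
  have "pullback_mult X Y (mor_comp Z f h) V W = pullback_mult X Z h (preim Z f V) W"
    if "W \<in> irreducible_components (space_of X) (preim X h (preim Z f V))" for W
  proof -
    define w where "w = generic_point (space_of X) W"
    have w: "w \<in> points X"
      unfolding w_def using sober_scheme[OF X] irreducible_components_irreducible[OF that]
      by (rule generic_point)
    have "stalk_map X (mor_comp Z f h) w ` ideal_stalk Y V (pt f (pt h w)) =
        stalk_map X h w ` stalk_map Z f (pt h w) ` ideal_stalk Y V (pt f (pt h w))"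
      unfolding image_image
      by (intro image_cong refl stalk_map_comp[OF h.ringed_morphism_axioms f.ringed_morphism_axioms w])
        (rule subsetD[OF ideal_stalk_subset])
    then show ?thesis
      using stalk_map_image_ideal_stalk[OF V h.pt_in[OF w]]
      by (simp add: pullback_mult_def Let_def flip: w_def)
  qed
  then show ?thesis by (simp add: pullback_subvariety_eq pre)
qed

lemma pullback_mult_iso_comp:
  assumes X: "section_presheaf X" and h: "lrs_morphism Y X h" and W: "irreducible_closedin (space_of Y) W"
  shows "pullback_mult Z X (mor_comp Y h f) V (preim Z f W) = pullback_mult Y X h V W"
proof -
  interpret h: ringed_morphism Y X h
    using h by (rule lrs_morphism_ringed[OF g.X.section_presheaf_axioms])
  define y where "y = generic_point (space_of Y) W"
  have y: "y \<in> points Y" "(space_of Y) closure_of {y} = W"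
    unfolding y_def by (rule generic_point[OF sober_scheme[OF Y] W])+
  let ?z = "pt g y"
  have z: "?z \<in> points Z" using y(1) by (rule g.pt_in)
  have fz: "pt f ?z = y" using y(1) by (rule pt_fg)
  have gen: "generic_point (space_of Z) (preim Z f W) = ?z"
    using homeomorphic_maps_closure_of_singleton[OF homeo y(1)] y(2) z
      preim_eq_image[OF irreducible_closedin_subset[OF W]]
    by (intro generic_point_eqI[OF sober_scheme[OF Z] irreducible_preim[OF W]]) auto
  let ?A = "stalk_map Y h y ` ideal_stalk X V (pt h y)"
  have A: "?A \<subseteq> carrier (stalk Y y)"
    by (intro image_subsetI h.stalk_map_closed[OF y(1)]) (rule subsetD[OF ideal_stalk_subset])
  have img: "stalk_map Z (mor_comp Y h f) ?z ` ideal_stalk X V (pt h y) = stalk_map Z f ?z ` ?A"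
    unfolding image_image
    by (intro image_cong refl
      stalk_map_comp[OF f.ringed_morphism_axioms h.ringed_morphism_axioms z, unfolded fz])
      (rule subsetD[OF ideal_stalk_subset])
  have "ring_length (stalk Z ?z Quot Idl\<^bsub>stalk Z ?z\<^esub> (stalk_map Z f ?z ` ?A)) =
      ring_length (stalk Y y Quot Idl\<^bsub>stalk Y y\<^esub> ?A)"
  proof (rule ring_length_quot_genideal)
    show "ring (stalk Y y)" "ring (stalk Z ?z)"
      using scheme_local_ring_stalk[OF Y y(1)] scheme_local_ring_stalk[OF Z z]
      by (simp_all add: local_ring_def cring.axioms(1))
    show "stalk_map Z f ?z \<in> ring_hom (stalk Y y) (stalk Z ?z)"
      using f.stalk_map_hom[OF g.X.section_presheaf_axioms z] by (simp add: fz)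
    show "stalk_map Y g y \<in> ring_hom (stalk Z ?z) (stalk Y y)"
      using g.stalk_map_hom[OF f.X.section_presheaf_axioms y(1)] .
    show "stalk_map Y g y (stalk_map Z f ?z c) = c" if "c \<in> carrier (stalk Y y)" for c
      using stalk_map_fg[OF z] that by (simp add: fz)
    show "stalk_map Z f ?z (stalk_map Y g y c) = c" if "c \<in> carrier (stalk Z ?z)" for c
      using stalk_map_gf[OF z that] by (simp add: fz)
  qed (rule A)
  then show ?thesis
    by (simp add: pullback_mult_def gen Let_def fz img flip: y_def)
qed

lemma pullback_subvariety_iso_comp:
  assumes X: "section_presheaf X" and h: "lrs_morphism Y X h"
  shows "pullback_subvariety Z X (mor_comp Y h f) V = pullback_cycle Z Y f (pullback_subvariety Y X h V)"
proof -
  interpret h: ringed_morphism Y X h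
    using h by (rule lrs_morphism_ringed[OF g.X.section_presheaf_axioms])
  let ?C = "irreducible_components (space_of Y) (preim Y h V)"
  have irr: "irreducible_closedin (space_of Y) W" if "W \<in> ?C" for W
    using that by (rule irreducible_components_irreducible)
  have sub: "W \<subseteq> points Y" if "W \<in> ?C" for W
    using irr[OF that] by (rule irreducible_closedin_subset)
  have "preim Z (mor_comp Y h f) V = preim Z f (preim Y h V)"
    by (rule preim_mor_comp) (rule f.pt_in)
  also have "\<dots> = pt g ` preim Y h V"
    by (rule preim_eq_image) (auto simp: mem_preim)
  finally have "irreducible_components (space_of Z) (preim Z (mor_comp Y h f) V) = (`) (pt g) ` ?C"
    by (simp add: irreducible_components_image[OF homeo] preim_def)
  also have "\<dots> = preim Z f ` ?C"
    using sub by (intro image_cong) (simp_all add: preim_eq_image)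
  finally have comps: "irreducible_components (space_of Z) (preim Z (mor_comp Y h f) V) = preim Z f ` ?C" .
  have inj: "inj_on (preim Z f) ?C"
    using sub by (intro inj_on_inverseI[where g = "preim Y g"]) (rule preim_preim)
  have "pullback_subvariety Z X (mor_comp Y h f) V =
      (\<Sum>W\<in>?C. frag_cmul (pullback_mult Z X (mor_comp Y h f) V (preim Z f W)) (frag_of (preim Z f W)))"
    by (simp add: pullback_subvariety_eq comps sum.reindex[OF inj])
  also have "\<dots> = (\<Sum>W\<in>?C. frag_cmul (pullback_mult Y X h V W) (pullback_subvariety Z Y f W))"
    by (intro sum.cong) (simp_all add: irr pullback_mult_iso_comp[OF X h] pullback_subvariety_iso)
  also have "\<dots> = pullback_cycle Z Y f (pullback_subvariety Y X h V)"
    by (cases "finite ?C")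
      (simp_all add: pullback_subvariety_eq[of Y] pullback_cycle_def frag_extend_sum frag_extend_cmul comp_def)
  finally show ?thesis .
qed

end

lemma frag_extend_frag_extend:
  "frag_extend F (frag_extend G z) = frag_extend (frag_extend F \<circ> G) z"
  unfolding frag_extend_def[of G] frag_extend_def[of "frag_extend F \<circ> G"]
  by (simp add: frag_extend_sum frag_extend_cmul comp_def)

lemma pullback_subvariety_mor_eq:
  assumes X: "scheme X" and f: "lrs_morphism X Y f" and g: "lrs_morphism X Y g" and eq: "mor_eq X Y f g"
  shows "pullback_subvariety X Y f V = pullback_subvariety X Y g V"
proof -
  note rm = lrs_morphism_ringed[OF scheme_section_presheaf[OF X]]
  have pre: "preim X f V = preim X g V" using eq by (rule mor_eq_preim)
  have "pullback_mult X Y f V W = pullback_mult X Y g V W"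
    if "W \<in> irreducible_components (space_of X) (preim X g V)" for W
  proof -
    define w where "w = generic_point (space_of X) W"
    have w: "w \<in> points X"
      unfolding w_def using sober_scheme[OF X] irreducible_components_irreducible[OF that]
      by (rule generic_point)
    have pt: "pt f w = pt g w" using eq w by (simp add: mor_eq_def)
    have "stalk_map X f w ` ideal_stalk Y V (pt g w) = stalk_map X g w ` ideal_stalk Y V (pt g w)"
      by (intro image_cong refl stalk_map_mor_eq[OF rm[OF f] rm[OF g] eq w, unfolded pt])
        (rule subsetD[OF ideal_stalk_subset])
    then show ?thesis by (simp add: pullback_mult_def Let_def pt flip: w_def)
  qed
  then show ?thesis by (simp add: pullback_subvariety_eq pre)
qed

lemma pullback_cycle_mor_eq:
  assumes "scheme X" "lrs_morphism X Y f" "lrs_morphism X Y g" "mor_eq X Y f g"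
  shows "pullback_cycle X Y f z = pullback_cycle X Y g z"
  unfolding pullback_cycle_def using assms by (intro frag_extend_eq pullback_subvariety_mor_eq)

context scheme_iso
begin

lemma pullback_cycle_comp_iso:
  assumes X: "scheme X" and h: "lrs_morphism X Z h"
    and z: "\<And>V. V \<in> Poly_Mapping.keys z \<Longrightarrow> irreducible_closedin (space_of Y) V"
  shows "pullback_cycle X Z h (pullback_cycle Z Y f z) = pullback_cycle X Y (mor_comp Z f h) z"
  unfolding pullback_cycle_def frag_extend_frag_extend
  by (rule frag_extend_eq)
    (simp add: z pullback_subvariety_iso pullback_subvariety_comp_iso[OF X h] irreducible_closedin_subset)

lemma pullback_cycle_iso_comp:
  assumes "section_presheaf X" "lrs_morphism Y X h"
  shows "pullback_cycle Z Y f (pullback_cycle Y X h z) = pullback_cycle Z X (mor_comp Y h f) z"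
  unfolding pullback_cycle_def[of Z X] pullback_cycle_def[of Y X] pullback_cycle_def[of Z Y]
    frag_extend_frag_extend
  by (rule frag_extend_eq) (simp add: pullback_subvariety_iso_comp[OF assms] pullback_cycle_def)

end

section \<open>Polynomial substitution and the simplex rings\<close>

lemma poly_mapping_eq_sum_single: "p = (\<Sum>m\<in>Poly_Mapping.keys p. Poly_Mapping.single m (Poly_Mapping.lookup p m))"
proof (rule poly_mapping_eqI)
  fix k
  show "Poly_Mapping.lookup p k =
      Poly_Mapping.lookup (\<Sum>m\<in>Poly_Mapping.keys p. Poly_Mapping.single m (Poly_Mapping.lookup p m)) k"
    by (simp add: lookup_sum lookup_single when_def sum.delta' not_in_keys_iff_lookup_eq_zero)
qed

lemma Const_0 [simp]: "Const 0 = 0"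
  by (simp add: Const_def)

lemma Const_1 [simp]: "Const 1 = 1"
  by (simp add: Const_def)

lemma Const_add: "Const (a + b) = Const a + Const b"
  by (simp add: Const_def single_add)

lemma Const_mult: "Const (a * b) = Const a * Const b"
  by (simp add: Const_def mult_single)

definition monomial_subst :: "(nat \<Rightarrow> 'k mpoly) \<Rightarrow> (nat \<Rightarrow>\<^sub>0 nat) \<Rightarrow> 'k::field mpoly" where
  "monomial_subst \<sigma> m = (\<Prod>i\<in>Poly_Mapping.keys m. \<sigma> i ^ Poly_Mapping.lookup m i)"

lemma monomial_subst_superset:
  assumes "finite A" "Poly_Mapping.keys m \<subseteq> A"
  shows "monomial_subst \<sigma> m = (\<Prod>i\<in>A. \<sigma> i ^ Poly_Mapping.lookup m i)"
  unfolding monomial_subst_def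
  using assms by (intro prod.mono_neutral_left) (auto simp: not_in_keys_iff_lookup_eq_zero)

lemma monomial_subst_0 [simp]: "monomial_subst \<sigma> 0 = 1"
  by (simp add: monomial_subst_def)

lemma monomial_subst_single: "monomial_subst \<sigma> (Poly_Mapping.single i k) = \<sigma> i ^ k"
  by (subst monomial_subst_superset[of "{i}"]) auto

lemma monomial_subst_add: "monomial_subst \<sigma> (m + m') = monomial_subst \<sigma> m * monomial_subst \<sigma> m'"
proof -
  let ?A = "Poly_Mapping.keys m \<union> Poly_Mapping.keys m'"
  have "monomial_subst \<sigma> n = (\<Prod>i\<in>?A. \<sigma> i ^ Poly_Mapping.lookup n i)" if "n \<in> {m, m', m + m'}" for n
    using that Poly_Mapping.keys_add[of m m'] by (intro monomial_subst_superset) auto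
  then show ?thesis by (simp add: lookup_add power_add prod.distrib)
qed

lemma subst_superset:
  assumes "finite A" "Poly_Mapping.keys p \<subseteq> A"
  shows "subst \<sigma> p = (\<Sum>m\<in>A. Const (Poly_Mapping.lookup p m) * monomial_subst \<sigma> m)"
  unfolding subst_def monomial_subst_def
  using assms by (intro sum.mono_neutral_left) (auto simp: not_in_keys_iff_lookup_eq_zero)

lemma subst_single: "subst \<sigma> (Poly_Mapping.single m c) = Const c * monomial_subst \<sigma> m"
  by (subst subst_superset[of "{m}"]) auto

lemma subst_0 [simp]: "subst \<sigma> 0 = 0"
  by (simp add: subst_def)

lemma subst_Const [simp]: "subst \<sigma> (Const c) = Const c"
  by (subst Const_def) (simp add: subst_single)

lemma subst_1 [simp]: "subst \<sigma> 1 = 1"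
  using subst_Const[of \<sigma> 1] by simp

lemma subst_Var [simp]: "subst \<sigma> (Var i) = \<sigma> i"
  by (simp add: Var_def subst_single monomial_subst_single)

lemma subst_add: "subst \<sigma> (p + q) = subst \<sigma> p + subst \<sigma> q"
proof -
  let ?A = "Poly_Mapping.keys p \<union> Poly_Mapping.keys q"
  have "subst \<sigma> f = (\<Sum>m\<in>?A. Const (Poly_Mapping.lookup f m) * monomial_subst \<sigma> m)"
    if "f \<in> {p, q, p + q}" for f
    using that Poly_Mapping.keys_add[of p q] by (intro subst_superset) auto
  then show ?thesis by (simp add: lookup_add Const_add distrib_right sum.distrib)
qed

lemma subst_diff: "subst \<sigma> (p - q) = subst \<sigma> p - subst \<sigma> q"
  using subst_add[of \<sigma> "p - q" q] by (simp add: algebra_simps)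

lemma subst_sum: "subst \<sigma> (\<Sum>i\<in>A. f i) = (\<Sum>i\<in>A. subst \<sigma> (f i))"
  by (induction A rule: infinite_finite_induct) (simp_all add: subst_add)

lemma subst_mult: "subst \<sigma> (p * q) = subst \<sigma> p * subst \<sigma> q"
proof -
  have "subst \<sigma> (p * q) = subst \<sigma>
      ((\<Sum>m\<in>Poly_Mapping.keys p. Poly_Mapping.single m (Poly_Mapping.lookup p m)) *
       (\<Sum>m\<in>Poly_Mapping.keys q. Poly_Mapping.single m (Poly_Mapping.lookup q m)))"
    by (simp flip: poly_mapping_eq_sum_single)
  also have "\<dots> = subst \<sigma> (\<Sum>m\<in>Poly_Mapping.keys p. Poly_Mapping.single m (Poly_Mapping.lookup p m)) *
      subst \<sigma> (\<Sum>m\<in>Poly_Mapping.keys q. Poly_Mapping.single m (Poly_Mapping.lookup q m))"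
    by (simp add: sum_product subst_sum mult_single subst_single monomial_subst_add Const_mult mult_ac)
  finally show ?thesis by (simp flip: poly_mapping_eq_sum_single)
qed

lemma subst_power: "subst \<sigma> (p ^ k) = subst \<sigma> p ^ k"
  by (induction k) (simp_all add: subst_mult)

lemma subst_prod: "subst \<sigma> (\<Prod>i\<in>A. f i) = (\<Prod>i\<in>A. subst \<sigma> (f i))"
  by (induction A rule: infinite_finite_induct) (simp_all add: subst_mult)

lemma subst_subst: "subst \<tau> (subst \<sigma> p) = subst (\<lambda>i. subst \<tau> (\<sigma> i)) p"
  by (simp add: subst_def[of \<sigma>] subst_def[of "\<lambda>i. subst \<tau> (\<sigma> i)"] subst_sum subst_mult subst_prod subst_power)

lemma monomial_subst_Var: "monomial_subst Var m = Poly_Mapping.single m 1"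
proof -
  have pow: "(Var i :: 'a::field mpoly) ^ k = Poly_Mapping.single (Poly_Mapping.single i k) 1" for i k
    by (induction k) (simp_all add: Var_def mult_single flip: single_add)
  have "(\<Prod>i\<in>A. Poly_Mapping.single (f i) (1::'a)) = Poly_Mapping.single (\<Sum>i\<in>A. f i) 1"
    for A :: "nat set" and f :: "nat \<Rightarrow> nat \<Rightarrow>\<^sub>0 nat"
    by (induction A rule: infinite_finite_induct) (simp_all add: mult_single)
  then show ?thesis
    by (simp add: monomial_subst_def pow flip: poly_mapping_eq_sum_single)
qed

lemma subst_Var_id: "subst Var p = p"
proof -
  have "subst Var p = (\<Sum>m\<in>Poly_Mapping.keys p. Poly_Mapping.single m (Poly_Mapping.lookup p m))"
    by (subst subst_superset[OF _ subset_refl]) (simp_all add: monomial_subst_Var Const_def mult_single)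
  then show ?thesis by (simp flip: poly_mapping_eq_sum_single)
qed

lemma poly_ring_simps [simp]:
  "a \<otimes>\<^bsub>poly_ring n\<^esub> b = a * b" "a \<oplus>\<^bsub>poly_ring n\<^esub> b = a + b" "\<one>\<^bsub>poly_ring n\<^esub> = 1" "\<zero>\<^bsub>poly_ring n\<^esub> = 0"
  by (simp_all add: poly_ring_def)

lemma poly_ring_carrier_iff:
  "p \<in> carrier (poly_ring n) \<longleftrightarrow> (\<forall>m\<in>Poly_Mapping.keys p. Poly_Mapping.keys m \<subseteq> {..n})"
  by (simp add: poly_ring_def)

lemma poly_ring_add: "p \<in> carrier (poly_ring n) \<Longrightarrow> q \<in> carrier (poly_ring n) \<Longrightarrow> p + q \<in> carrier (poly_ring n)"
  using Poly_Mapping.keys_add[of p q] unfolding poly_ring_carrier_iff by blast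

lemma poly_ring_minus: "p \<in> carrier (poly_ring n) \<Longrightarrow> - p \<in> carrier (poly_ring n)"
  by (simp add: poly_ring_carrier_iff keys_def)

lemma poly_ring_0: "0 \<in> carrier (poly_ring n)"
  by (simp add: poly_ring_carrier_iff)

lemma poly_ring_Const: "Const c \<in> carrier (poly_ring n)"
  by (simp add: poly_ring_carrier_iff Const_def)

lemma poly_ring_1: "1 \<in> carrier (poly_ring n)"
  using poly_ring_Const[of 1] by simp

lemma poly_ring_Var: "i \<le> n \<Longrightarrow> Var i \<in> carrier (poly_ring n)"
  by (simp add: poly_ring_carrier_iff Var_def)

lemma poly_ring_mult:
  assumes "p \<in> carrier (poly_ring n)" "q \<in> carrier (poly_ring n)"
  shows "p * q \<in> carrier (poly_ring n)"
  unfolding poly_ring_carrier_iff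
proof
  fix m assume "m \<in> Poly_Mapping.keys (p * q)"
  then obtain a b where "m = a + b" "a \<in> Poly_Mapping.keys p" "b \<in> Poly_Mapping.keys q"
    using keys_mult[of p q] by blast
  then show "Poly_Mapping.keys m \<subseteq> {..n}"
    using assms Poly_Mapping.keys_add[of a b] unfolding poly_ring_carrier_iff by blast
qed

lemma cring_poly_ring: "cring (poly_ring n :: 'k::field mpoly ring)"
proof (rule cringI)
  show "abelian_group (poly_ring n :: 'k mpoly ring)"
  proof (rule abelian_groupI)
    show "\<exists>y\<in>carrier (poly_ring n). y \<oplus>\<^bsub>poly_ring n\<^esub> x = \<zero>\<^bsub>poly_ring n\<^esub>"
      if "x \<in> carrier (poly_ring n)" for x :: "'k mpoly"
      using poly_ring_minus[OF that] by (intro bexI[of _ "- x"]) simp_all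
  qed (simp_all add: poly_ring_add poly_ring_0 add_ac)
  show "Group.comm_monoid (poly_ring n :: 'k mpoly ring)"
    by (rule comm_monoidI) (simp_all add: poly_ring_mult poly_ring_1 mult_ac)
qed (simp add: distrib_right)

lemma poly_ring_sum: "(\<And>i. i \<in> A \<Longrightarrow> f i \<in> carrier (poly_ring n)) \<Longrightarrow> (\<Sum>i\<in>A. f i) \<in> carrier (poly_ring n)"
  by (induction A rule: infinite_finite_induct) (simp_all add: poly_ring_add poly_ring_0)

lemma poly_ring_prod: "(\<And>i. i \<in> A \<Longrightarrow> f i \<in> carrier (poly_ring n)) \<Longrightarrow> (\<Prod>i\<in>A. f i) \<in> carrier (poly_ring n)"
  by (induction A rule: infinite_finite_induct) (simp_all add: poly_ring_mult poly_ring_1)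

lemma poly_ring_power: "p \<in> carrier (poly_ring n) \<Longrightarrow> p ^ k \<in> carrier (poly_ring n)"
  by (induction k) (simp_all add: poly_ring_mult poly_ring_1)

lemma poly_ring_subst:
  assumes "\<And>i. i \<le> n \<Longrightarrow> \<sigma> i \<in> carrier (poly_ring m)" "p \<in> carrier (poly_ring n)"
  shows "subst \<sigma> p \<in> carrier (poly_ring m)"
  unfolding subst_def
proof (intro poly_ring_sum poly_ring_mult poly_ring_Const poly_ring_prod poly_ring_power assms(1))
  fix i k assume "k \<in> Poly_Mapping.keys p" "i \<in> Poly_Mapping.keys k"
  then show "i \<le> n" using assms(2) unfolding poly_ring_carrier_iff by blast
qed

lemma subst_cong:
  assumes "\<And>i. i \<le> n \<Longrightarrow> \<sigma> i = \<tau> i" "p \<in> carrier (poly_ring n)"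
  shows "subst \<sigma> p = subst \<tau> p"
  unfolding subst_def
proof (intro sum.cong prod.cong arg_cong2[where f = "(*)"] refl)
  fix i k assume "k \<in> Poly_Mapping.keys p" "i \<in> Poly_Mapping.keys k"
  then have "i \<le> n" using assms(2) unfolding poly_ring_carrier_iff by blast
  then show "\<sigma> i ^ Poly_Mapping.lookup k i = \<tau> i ^ Poly_Mapping.lookup k i" by (simp add: assms(1))
qed

lemma subst_ring_hom:
  assumes "\<And>i. i \<le> n \<Longrightarrow> \<sigma> i \<in> carrier (poly_ring m)"
  shows "subst \<sigma> \<in> ring_hom (poly_ring n) (poly_ring m)"
  using poly_ring_subst[OF assms] by (intro ring_hom_memI) (simp_all add: subst_add subst_mult)

lemma simplex_relation_in: "(\<Sum>i\<le>n. Var i) - 1 \<in> carrier (poly_ring n)"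
proof -
  have "(\<Sum>i\<le>n. Var i) + - 1 \<in> carrier (poly_ring n)"
    by (intro poly_ring_add poly_ring_minus poly_ring_1 poly_ring_sum poly_ring_Var) simp
  then show ?thesis by simp
qed

lemma ideal_simplex_ideal: "ideal (simplex_ideal n) (poly_ring n)"
proof -
  interpret cring "poly_ring n" by (rule cring_poly_ring)
  show ?thesis unfolding simplex_ideal_def using simplex_relation_in by (intro genideal_ideal) auto
qed

lemma cring_simplex_ring: "cring (simplex_ring n)"
  unfolding simplex_ring_def by (rule ideal.quotient_is_cring[OF ideal_simplex_ideal cring_poly_ring])

lemma residue_hom: "residue n \<in> ring_hom (poly_ring n) (simplex_ring n)"
  using ideal.rcos_ring_hom[OF ideal_simplex_ideal] by (simp add: simplex_ring_def residue_def[abs_def])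

lemma simplex_ringE:
  assumes "C \<in> carrier (simplex_ring n)"
  obtains p where "p \<in> carrier (poly_ring n)" "C = residue n p"
  using assms by (auto simp: simplex_ring_def FactRing_def A_RCOSETS_defs residue_def a_r_coset_def)

definition simplex_subst :: "nat \<Rightarrow> nat \<Rightarrow> (nat \<Rightarrow> 'k::field mpoly) \<Rightarrow> bool" where
  "simplex_subst n m \<sigma> \<longleftrightarrow>
     (\<forall>i\<le>n. \<sigma> i \<in> carrier (poly_ring m)) \<and> (\<Sum>i\<le>n. \<sigma> i) = (\<Sum>i\<le>m. Var i)"

lemma subst_simplex_ideal:
  fixes \<sigma> :: "nat \<Rightarrow> 'k::field mpoly"
  assumes \<sigma>: "simplex_subst n m \<sigma>" and a: "a \<in> simplex_ideal n"
  shows "subst \<sigma> a \<in> simplex_ideal m"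
proof -
  have h: "subst \<sigma> \<in> ring_hom (poly_ring n) (poly_ring m)"
    using \<sigma> by (intro subst_ring_hom) (simp add: simplex_subst_def)
  have rn: "ring (poly_ring n :: 'k mpoly ring)" and rm: "ring (poly_ring m :: 'k mpoly ring)"
    using cring_poly_ring by (auto intro: cring.axioms(1))
  have "(\<Sum>i\<le>m. Var i :: 'k mpoly) - 1 \<in> simplex_ideal m"
    unfolding simplex_ideal_def using ring.genideal_self'[OF rm simplex_relation_in] .
  then have "{(\<Sum>i\<le>n. Var i) - 1} \<subseteq> {p \<in> carrier (poly_ring n). subst \<sigma> p \<in> simplex_ideal m}"
    using \<sigma> simplex_relation_in by (simp add: simplex_subst_def subst_diff subst_sum)
  then have "simplex_ideal n \<subseteq> {p \<in> carrier (poly_ring n). subst \<sigma> p \<in> simplex_ideal m}"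
    unfolding simplex_ideal_def[of n]
    by (rule ring.genideal_minimal[OF rn ring_hom_ring.ideal_vimage[OF ring_hom_ringI2[OF rn rm h]
      ideal_simplex_ideal]])
  then show ?thesis using a by blast
qed

lemma simplex_hom_residue:
  assumes \<sigma>: "simplex_subst n m \<sigma>" and p: "p \<in> carrier (poly_ring n)"
  shows "simplex_hom m \<sigma> (residue n p) = residue m (subst \<sigma> p)"
proof -
  interpret n: ideal "simplex_ideal n" "poly_ring n" by (rule ideal_simplex_ideal)
  interpret m: ideal "simplex_ideal m" "poly_ring m" by (rule ideal_simplex_ideal)
  have sp: "subst \<sigma> p \<in> carrier (poly_ring m)"
    using \<sigma> p by (intro poly_ring_subst) (auto simp: simplex_subst_def)
  have "residue m (subst \<sigma> q) = residue m (subst \<sigma> p)" if q: "q \<in> residue n p" for q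
  proof -
    obtain a where a: "a \<in> simplex_ideal n" "q = a + p"
      using q by (auto simp: residue_def a_r_coset_def r_coset_def)
    have "subst \<sigma> q \<in> residue m (subst \<sigma> p)"
      using subst_simplex_ideal[OF \<sigma> a(1)] by (auto simp: residue_def a_r_coset_def r_coset_def a(2) subst_add)
    then show ?thesis
      unfolding residue_def using sp by (rule m.a_repr_independence'[symmetric])
  qed
  moreover have "p \<in> residue n p"
    unfolding residue_def using p by (rule n.a_rcos_self)
  ultimately show ?thesis unfolding simplex_hom_def by blast
qed

lemma simplex_hom_ring_hom:
  fixes \<sigma> :: "nat \<Rightarrow> 'k::field mpoly"
  assumes \<sigma>: "simplex_subst n m \<sigma>"
  shows "ring_hom_cring (simplex_ring n) (simplex_ring m) (simplex_hom m \<sigma>)"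
proof (intro ring_hom_cringI cring_simplex_ring)
  have res: "residue n p \<in> carrier (simplex_ring n)" if "p \<in> carrier (poly_ring n)" for n and p :: "'k mpoly"
    using residue_hom that by (rule ring_hom_closed)
  have sub: "subst \<sigma> p \<in> carrier (poly_ring m)" if "p \<in> carrier (poly_ring n)" for p
    using \<sigma> that by (intro poly_ring_subst) (auto simp: simplex_subst_def)
  have mult: "residue n (p * q) = residue n p \<otimes>\<^bsub>simplex_ring n\<^esub> residue n q"
    and add: "residue n (p + q) = residue n p \<oplus>\<^bsub>simplex_ring n\<^esub> residue n q"
    if "p \<in> carrier (poly_ring n)" "q \<in> carrier (poly_ring n)" for n and p q :: "'k mpoly"
    using ring_hom_mult[OF residue_hom that] ring_hom_add[OF residue_hom that] by simp_all
  have one: "\<one>\<^bsub>simplex_ring n\<^esub> = residue n (1 :: 'k mpoly)" for n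
    by (simp add: ring_hom_one[OF residue_hom, symmetric])
  show "simplex_hom m \<sigma> \<in> ring_hom (simplex_ring n) (simplex_ring m)"
  proof (rule ring_hom_memI)
    fix x :: "'k mpoly set" assume "x \<in> carrier (simplex_ring n)"
    then obtain p where p: "p \<in> carrier (poly_ring n)" "x = residue n p" by (rule simplex_ringE)
    then show "simplex_hom m \<sigma> x \<in> carrier (simplex_ring m)"
      by (simp add: simplex_hom_residue[OF \<sigma>] res sub)
    fix y :: "'k mpoly set" assume "y \<in> carrier (simplex_ring n)"
    then obtain q where q: "q \<in> carrier (poly_ring n)" "y = residue n q" by (rule simplex_ringE)
    show "simplex_hom m \<sigma> (x \<otimes>\<^bsub>simplex_ring n\<^esub> y) = simplex_hom m \<sigma> x \<otimes>\<^bsub>simplex_ring m\<^esub> simplex_hom m \<sigma> y"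
      using p q by (simp add: simplex_hom_residue[OF \<sigma>] sub poly_ring_mult subst_mult flip: mult)
    show "simplex_hom m \<sigma> (x \<oplus>\<^bsub>simplex_ring n\<^esub> y) = simplex_hom m \<sigma> x \<oplus>\<^bsub>simplex_ring m\<^esub> simplex_hom m \<sigma> y"
      using p q by (simp add: simplex_hom_residue[OF \<sigma>] sub poly_ring_add subst_add flip: add)
  next
    show "simplex_hom m \<sigma> \<one>\<^bsub>simplex_ring n\<^esub> = \<one>\<^bsub>simplex_ring m\<^esub>"
      by (simp add: one simplex_hom_residue[OF \<sigma>] poly_ring_1)
  qed
qed

lemma Const_residue_ring_hom:
  "ring_hom_cring (field_ring :: 'k::field ring) (simplex_ring n) (\<lambda>c. residue n (Const c))"
proof -
  have field: "cring (field_ring :: 'k ring)"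
  proof (rule cringI)
    show "abelian_group (field_ring :: 'k ring)"
      by (rule abelian_groupI) (auto simp: field_ring_def intro: exI[of _ "- x" for x])
    show "Group.comm_monoid (field_ring :: 'k ring)"
      by (rule comm_monoidI) (auto simp: field_ring_def)
  qed (simp add: field_ring_def distrib_right)
  have "Const \<in> ring_hom (field_ring :: 'k ring) (poly_ring n)"
    by (rule ring_hom_memI) (simp_all add: poly_ring_Const field_ring_def Const_add Const_mult)
  from ring_hom_trans[OF this residue_hom]
  have hom: "(\<lambda>c. residue n (Const c)) \<in> ring_hom (field_ring :: 'k ring) (simplex_ring n)"
    by (simp add: comp_def)
  show ?thesis by (rule ring_hom_cringI[OF field cring_simplex_ring hom])
qed

definition simplex_map :: "nat \<Rightarrow> nat \<Rightarrow> (nat \<Rightarrow> 'k::field mpoly) \<Rightarrow> 'k simplex_mor" where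
  "simplex_map n m \<sigma> = Spec_map (simplex_ring n) (simplex_ring m) (simplex_hom m \<sigma>)"

lemma section_presheaf_simplex: "section_presheaf (simplex n)"
  unfolding simplex_def by (rule section_presheaf_Spec) (rule cring_simplex_ring)

lemma lrs_morphism_simplex_map:
  "simplex_subst n m \<sigma> \<Longrightarrow> lrs_morphism (simplex m) (simplex n) (simplex_map n m \<sigma>)"
  unfolding simplex_def simplex_map_def
  by (rule ring_hom_cring.lrs_morphism_Spec_map) (rule simplex_hom_ring_hom)

lemma simplex_str_simplex_map:
  assumes \<sigma>: "simplex_subst n m (\<sigma> :: nat \<Rightarrow> 'k::field mpoly)"
  shows "mor_eq (simplex m) (Spec (field_ring :: 'k ring))
    (mor_comp (simplex n) (simplex_str n) (simplex_map n m \<sigma>)) (simplex_str m)"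
  unfolding simplex_def simplex_str_def simplex_map_def
  by (intro Spec_map_comp Const_residue_ring_hom simplex_hom_ring_hom \<sigma>)
    (simp add: simplex_hom_residue[OF \<sigma> poly_ring_Const])

lemma simplex_map_comp:
  fixes \<sigma> \<tau> \<rho> :: "nat \<Rightarrow> 'k::field mpoly"
  assumes \<sigma>: "simplex_subst n m \<sigma>" and \<tau>: "simplex_subst m l \<tau>" and \<rho>: "simplex_subst n l \<rho>"
    and \<rho>_eq: "\<And>i. i \<le> n \<Longrightarrow> subst \<tau> (\<sigma> i) = \<rho> i"
  shows "mor_eq (simplex l) (simplex n)
    (mor_comp (simplex m) (simplex_map n m \<sigma>) (simplex_map m l \<tau>)) (simplex_map n l \<rho>)"
  unfolding simplex_def simplex_map_def
proof (intro Spec_map_comp simplex_hom_ring_hom \<sigma> \<tau> \<rho>)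
  fix a :: "'k mpoly set" assume "a \<in> carrier (simplex_ring n)"
  then obtain p where p: "p \<in> carrier (poly_ring n)" "a = residue n p" by (rule simplex_ringE)
  moreover have "subst \<sigma> p \<in> carrier (poly_ring m)"
    using \<sigma> p by (intro poly_ring_subst) (auto simp: simplex_subst_def)
  moreover have "subst \<rho> p = subst \<tau> (subst \<sigma> p)"
    unfolding subst_subst using \<rho>_eq p(1) by (intro subst_cong) auto
  ultimately show "simplex_hom l \<rho> a = simplex_hom l \<tau> (simplex_hom m \<sigma> a)"
    by (simp add: simplex_hom_residue[OF \<sigma>] simplex_hom_residue[OF \<tau>] simplex_hom_residue[OF \<rho>])
qed

lemma simplex_subst_comp:
  assumes \<sigma>: "simplex_subst n m \<sigma>" and \<tau>: "simplex_subst m l \<tau>"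
  shows "simplex_subst n l (\<lambda>i. subst \<tau> (\<sigma> i))"
  unfolding simplex_subst_def
proof
  show "\<forall>i\<le>n. subst \<tau> (\<sigma> i) \<in> carrier (poly_ring l)"
    using \<sigma> \<tau> by (auto simp: simplex_subst_def intro!: poly_ring_subst[of m])
  have "(\<Sum>i\<le>n. subst \<tau> (\<sigma> i)) = subst \<tau> (\<Sum>i\<le>m. Var i)"
    using \<sigma> by (simp add: simplex_subst_def flip: subst_sum)
  then show "(\<Sum>i\<le>n. subst \<tau> (\<sigma> i)) = (\<Sum>i\<le>l. Var i)"
    using \<tau> by (simp add: subst_sum simplex_subst_def)
qed

lemma simplex_subst_Var: "simplex_subst n n Var"
  by (simp add: simplex_subst_def poly_ring_Var)

lemma simplex_map_Var:
  "mor_eq (simplex n) (simplex n) (simplex_map n n (Var :: nat \<Rightarrow> 'k::field mpoly)) mor_id"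
  unfolding simplex_def simplex_map_def
proof (intro Spec_map_id simplex_hom_ring_hom simplex_subst_Var)
  fix a :: "'k mpoly set" assume "a \<in> carrier (simplex_ring n)"
  then obtain p where "p \<in> carrier (poly_ring n)" "a = residue n p" by (rule simplex_ringE)
  then show "simplex_hom n Var a = a"
    by (simp add: simplex_hom_residue[OF simplex_subst_Var] subst_Var_id)
qed

definition coface_subst :: "nat \<Rightarrow> nat \<Rightarrow> 'k::field mpoly" where
  "coface_subst j i = (if i < j then Var i else if i = j then 0 else Var (i - 1))"

definition cyclic_subst :: "nat \<Rightarrow> nat \<Rightarrow> 'k::field mpoly" where
  "cyclic_subst n i = (if i < n then Var (i + 1) else Var 0)"

definition cyclic_inv_subst :: "nat \<Rightarrow> nat \<Rightarrow> 'k::field mpoly" where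
  "cyclic_inv_subst n i = (if i = 0 then Var n else Var (i - 1))"

lemma coface_eq: "coface n j = simplex_map n (n - 1) (coface_subst j)"
  by (simp add: coface_def simplex_map_def coface_subst_def[abs_def])

lemma cyclic_eq: "cyclic n = simplex_map n n (cyclic_subst n)"
  by (simp add: cyclic_def simplex_map_def cyclic_subst_def[abs_def])

lemma simplex_subst_coface:
  assumes "n \<ge> 1" "j \<le> n"
  shows "simplex_subst n (n - 1) (coface_subst j)"
  unfolding simplex_subst_def
proof
  show "\<forall>i\<le>n. coface_subst j i \<in> carrier (poly_ring (n - 1))"
    using assms by (auto simp: coface_subst_def poly_ring_0 intro!: poly_ring_Var)
  show "(\<Sum>i\<le>n. coface_subst j i) = (\<Sum>i\<le>n - 1. Var i)"
    using sum.zero_middle[OF assms, of Var Var] unfolding coface_subst_def One_nat_def by simp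
qed

lemma simplex_subst_cyclic: "simplex_subst n n (cyclic_subst n)"
  unfolding simplex_subst_def
proof
  show "\<forall>i\<le>n. cyclic_subst n i \<in> carrier (poly_ring n)"
    by (auto simp: cyclic_subst_def intro!: poly_ring_Var)
  have "(\<Sum>i\<le>n. cyclic_subst n i) = (\<Sum>i<n. Var (Suc i)) + Var 0"
    by (simp add: cyclic_subst_def flip: lessThan_Suc_atMost)
  then show "(\<Sum>i\<le>n. cyclic_subst n i) = (\<Sum>i\<le>n. Var i)"
    by (simp add: sum.atMost_shift add.commute)
qed

lemma simplex_subst_cyclic_inv: "simplex_subst n n (cyclic_inv_subst n)"
  unfolding simplex_subst_def
proof
  show "\<forall>i\<le>n. cyclic_inv_subst n i \<in> carrier (poly_ring n)"
    by (auto simp: cyclic_inv_subst_def intro!: poly_ring_Var)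
  have "(\<Sum>i\<le>n. cyclic_inv_subst n i) = Var n + (\<Sum>i<n. Var i)"
    by (simp add: sum.atMost_shift cyclic_inv_subst_def)
  also have "\<dots> = (\<Sum>i\<le>n. Var i)"
    by (simp add: add.commute flip: lessThan_Suc_atMost)
  finally show "(\<Sum>i\<le>n. cyclic_inv_subst n i) = (\<Sum>i\<le>n. Var i)" .
qed

lemma subst_cyclic_inv_cyclic: "i \<le> n \<Longrightarrow> subst (cyclic_inv_subst n) (cyclic_subst n i) = Var i"
  by (auto simp: cyclic_subst_def cyclic_inv_subst_def)

lemma subst_cyclic_cyclic_inv: "i \<le> n \<Longrightarrow> subst (cyclic_subst n) (cyclic_inv_subst n i) = Var i"
  by (auto simp: cyclic_subst_def cyclic_inv_subst_def)

lemma subst_coface_0_cyclic: "i \<le> n \<Longrightarrow> subst (coface_subst 0) (cyclic_subst n i) = coface_subst n i"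
  by (auto simp: cyclic_subst_def coface_subst_def)

lemma subst_coface_cyclic:
  assumes "1 \<le> j" "j \<le> n" "i \<le> n"
  shows "subst (coface_subst j) (cyclic_subst n i) = subst (cyclic_subst (n - 1)) (coface_subst (j - 1) i)"
  using assms by (auto simp: cyclic_subst_def coface_subst_def)

section \<open>The cyclic relations\<close>

locale simplex_products =
  fixes X :: "('x, 's) ringed_space"
    and \<pi> :: "('x, 's, 'k::field set, 'k set \<Rightarrow> ('k \<times> 'k) set) mor"
    and Y :: "nat \<Rightarrow> ('y, 't) ringed_space"
    and p :: "nat \<Rightarrow> ('y, 't, 'x, 's) mor"
    and q :: "nat \<Rightarrow> ('y, 't, 'k simplex_point, 'k simplex_section) mor"
  assumes fibre_product: "fibre_product (Spec (field_ring :: 'k ring)) X \<pi> (simplex m) (simplex_str m) (Y m) (p m) (q m)"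
begin

lemma scheme_Y: "scheme (Y m)"
  and lrs_p: "lrs_morphism (Y m) X (p m)"
  and lrs_q: "lrs_morphism (Y m) (simplex m) (q m)"
  and str_commutes: "mor_eq (Y m) (Spec (field_ring :: 'k ring)) (mor_comp X \<pi> (p m)) (mor_comp (simplex m) (simplex_str m) (q m))"
  using fibre_product[of m] unfolding fibre_product_def by auto

lemma presheaf_Y: "section_presheaf (Y m)"
  by (rule scheme_section_presheaf[OF scheme_Y])

lemma ringed_q: "ringed_morphism (Y m) (simplex m) (q m)"
  by (rule lrs_morphism_ringed[OF presheaf_Y lrs_q])

definition is_lift :: "nat \<Rightarrow> nat \<Rightarrow> 'k simplex_mor \<Rightarrow> ('y, 't, 'y, 't) mor \<Rightarrow> bool" where
  "is_lift m n h g \<longleftrightarrow> lrs_morphism (Y m) (Y n) g \<and>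
     mor_eq (Y m) X (mor_comp (Y n) (p n) g) (p m) \<and>
     mor_eq (Y m) (simplex n) (mor_comp (Y n) (q n) g) (mor_comp (simplex m) h (q m))"

lemma is_lift_ringed: "is_lift m n h g \<Longrightarrow> ringed_morphism (Y m) (Y n) g"
  unfolding is_lift_def by (rule lrs_morphism_ringed[OF presheaf_Y]) simp

lemma is_lift_universal:
  assumes \<sigma>: "simplex_subst n m \<sigma>"
  shows "\<exists>g. is_lift m n (simplex_map n m \<sigma>) g \<and>
    (\<forall>g'. is_lift m n (simplex_map n m \<sigma>) g' \<longrightarrow> mor_eq (Y m) (Y n) g' g)"
proof -
  let ?h = "simplex_map n m \<sigma>" and ?S = "Spec (field_ring :: 'k ring)"
  let ?b = "mor_comp (simplex m) ?h (q m)"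
  have h: "lrs_morphism (simplex m) (simplex n) ?h" using \<sigma> by (rule lrs_morphism_simplex_map)
  have b: "lrs_morphism (Y m) (simplex n) ?b"
    by (rule lrs_morphism_comp[OF presheaf_Y section_presheaf_simplex lrs_q h])
  have "mor_comp (simplex n) (simplex_str n) ?b =
      mor_comp (simplex m) (mor_comp (simplex n) (simplex_str n) ?h) (q m)"
    by (rule mor_comp_assoc) (rule lrs_morphism_ringed[OF section_presheaf_simplex h])
  moreover have "mor_eq (Y m) ?S (mor_comp (simplex m) (mor_comp (simplex n) (simplex_str n) ?h) (q m))
      (mor_comp (simplex m) (simplex_str m) (q m))"
    by (rule mor_eq_comp_left[OF ringed_q simplex_str_simplex_map[OF \<sigma>]])
  ultimately have comm: "mor_eq (Y m) ?S (mor_comp X \<pi> (p m)) (mor_comp (simplex n) (simplex_str n) ?b)"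
    using mor_eq_trans[OF str_commutes mor_eq_sym] by simp
  have "\<forall>(T :: ('y, 't) ringed_space) a b.
      scheme T \<and> lrs_morphism T X a \<and> lrs_morphism T (simplex n) b \<and>
      mor_eq T ?S (mor_comp X \<pi> a) (mor_comp (simplex n) (simplex_str n) b) \<longrightarrow>
      (\<exists>h. lrs_morphism T (Y n) h \<and> mor_eq T X (mor_comp (Y n) (p n) h) a \<and>
         mor_eq T (simplex n) (mor_comp (Y n) (q n) h) b \<and>
         (\<forall>h'. lrs_morphism T (Y n) h' \<and> mor_eq T X (mor_comp (Y n) (p n) h') a \<and>
               mor_eq T (simplex n) (mor_comp (Y n) (q n) h') b \<longrightarrow> mor_eq T (Y n) h' h))"
    using fibre_product[of n] unfolding fibre_product_def by (elim conjE)
  from this[rule_format, OF conjI[OF scheme_Y conjI[OF lrs_p conjI[OF b comm]]]]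
  show ?thesis unfolding is_lift_def by (simp add: conj_assoc)
qed

lemma is_lift_unique:
  assumes "simplex_subst n m \<sigma>" "is_lift m n (simplex_map n m \<sigma>) g" "is_lift m n (simplex_map n m \<sigma>) g'"
  shows "mor_eq (Y m) (Y n) g g'"
proof -
  obtain g0 where "\<forall>g'. is_lift m n (simplex_map n m \<sigma>) g' \<longrightarrow> mor_eq (Y m) (Y n) g' g0"
    using is_lift_universal[OF assms(1)] by blast
  then have "mor_eq (Y m) (Y n) g g0" "mor_eq (Y m) (Y n) g' g0" using assms(2,3) by simp_all
  then show ?thesis by (rule mor_eq_trans[OF _ mor_eq_sym])
qed

lemma is_lift_id_times:
  assumes "simplex_subst n m \<sigma>"
  shows "is_lift m n (simplex_map n m \<sigma>) (id_times X Y p q m n (simplex_map n m \<sigma>))"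
proof -
  have "\<exists>g. is_lift m n (simplex_map n m \<sigma>) g" using is_lift_universal[OF assms] by blast
  then show ?thesis unfolding is_lift_def id_times_def by (rule someI_ex)
qed

lemma is_lift_mor_eq:
  assumes g: "is_lift m n h g" and eq: "mor_eq (simplex m) (simplex n) h h'"
  shows "is_lift m n h' g"
  using g mor_eq_trans[OF _ mor_eq_comp_left[OF ringed_q eq]] unfolding is_lift_def by simp

lemma is_lift_id: "is_lift n n mor_id mor_id"
proof -
  have "preim (simplex n) mor_id U = U" if "is_open (simplex n :: (_, 'k simplex_section) ringed_space) U" for U
    using that by (simp add: preim_mor_id openin_subset)
  then show ?thesis
    unfolding is_lift_def using lrs_morphism_id[OF presheaf_Y] by (simp add: mor_eq_def)
qed

lemma is_lift_comp:
  assumes h: "ringed_morphism (simplex m) (simplex n) h" and k: "ringed_morphism (simplex l) (simplex m) k"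
    and g: "is_lift m n h g" and f: "is_lift l m k f"
  shows "is_lift l n (mor_comp (simplex m) h k) (mor_comp (Y m) g f)"
  unfolding is_lift_def
proof (intro conjI)
  note rf = is_lift_ringed[OF f] and rg = is_lift_ringed[OF g]
  show "lrs_morphism (Y l) (Y n) (mor_comp (Y m) g f)"
    using f g unfolding is_lift_def by (intro lrs_morphism_comp presheaf_Y) simp_all
  have "mor_eq (Y l) X (mor_comp (Y m) (mor_comp (Y n) (p n) g) f) (mor_comp (Y m) (p m) f)"
    using g by (intro mor_eq_comp_left[OF rf]) (simp add: is_lift_def)
  also have "mor_comp (Y m) (mor_comp (Y n) (p n) g) f = mor_comp (Y n) (p n) (mor_comp (Y m) g f)"
    by (rule mor_comp_assoc[OF rg, symmetric])
  finally show "mor_eq (Y l) X (mor_comp (Y n) (p n) (mor_comp (Y m) g f)) (p l)"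
    by (rule mor_eq_trans) (use f in \<open>simp add: is_lift_def\<close>)
  have "mor_eq (Y l) (simplex n) (mor_comp (Y n) (q n) (mor_comp (Y m) g f))
      (mor_comp (Y m) (mor_comp (simplex m) h (q m)) f)"
    unfolding mor_comp_assoc[OF rg] using g by (intro mor_eq_comp_left[OF rf]) (simp add: is_lift_def)
  moreover have "mor_eq (Y l) (simplex n) (mor_comp (Y m) (mor_comp (simplex m) h (q m)) f)
      (mor_comp (simplex m) h (mor_comp (simplex l) k (q l)))"
    unfolding mor_comp_assoc[OF ringed_q, symmetric] using f
    by (intro mor_eq_comp_right[OF h]) (simp add: is_lift_def)
  ultimately show "mor_eq (Y l) (simplex n) (mor_comp (Y n) (q n) (mor_comp (Y m) g f))
      (mor_comp (simplex l) (mor_comp (simplex m) h k) (q l))"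
    unfolding mor_comp_assoc[OF k] by (rule mor_eq_trans)
qed

abbreviation lift :: "nat \<Rightarrow> nat \<Rightarrow> (nat \<Rightarrow> 'k mpoly) \<Rightarrow> ('y, 't, 'y, 't) mor" where
  "lift n m \<sigma> \<equiv> id_times X Y p q m n (simplex_map n m \<sigma>)"

lemma lrs_morphism_lift: "simplex_subst n m \<sigma> \<Longrightarrow> lrs_morphism (Y m) (Y n) (lift n m \<sigma>)"
  using is_lift_id_times unfolding is_lift_def by blast

lemma is_lift_lift_comp:
  assumes \<sigma>: "simplex_subst n m \<sigma>" and \<tau>: "simplex_subst m l \<tau>" and \<rho>: "simplex_subst n l \<rho>"
    and \<rho>_eq: "\<And>i. i \<le> n \<Longrightarrow> subst \<tau> (\<sigma> i) = \<rho> i"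
  shows "is_lift l n (simplex_map n l \<rho>) (mor_comp (Y m) (lift n m \<sigma>) (lift m l \<tau>))"
proof (rule is_lift_mor_eq)
  note rm = lrs_morphism_ringed[OF section_presheaf_simplex lrs_morphism_simplex_map]
  show "is_lift l n (mor_comp (simplex m) (simplex_map n m \<sigma>) (simplex_map m l \<tau>))
      (mor_comp (Y m) (lift n m \<sigma>) (lift m l \<tau>))"
    by (rule is_lift_comp[OF rm[OF \<sigma>] rm[OF \<tau>] is_lift_id_times[OF \<sigma>] is_lift_id_times[OF \<tau>]])
  show "mor_eq (simplex l) (simplex n) (mor_comp (simplex m) (simplex_map n m \<sigma>) (simplex_map m l \<tau>))
      (simplex_map n l \<rho>)"
    by (rule simplex_map_comp[OF \<sigma> \<tau> \<rho> \<rho>_eq])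
qed

lemma lift_comp:
  assumes "simplex_subst n m \<sigma>" "simplex_subst m l \<tau>" "simplex_subst n l \<rho>"
    and "\<And>i. i \<le> n \<Longrightarrow> subst \<tau> (\<sigma> i) = \<rho> i"
  shows "mor_eq (Y l) (Y n) (mor_comp (Y m) (lift n m \<sigma>) (lift m l \<tau>)) (lift n l \<rho>)"
  using assms(3) is_lift_lift_comp[OF assms] is_lift_id_times[OF assms(3)] by (rule is_lift_unique)

lemma lift_Var: "mor_eq (Y n) (Y n) (lift n n Var) mor_id"
  by (rule is_lift_unique[OF simplex_subst_Var is_lift_id_times[OF simplex_subst_Var]
    is_lift_mor_eq[OF is_lift_id mor_eq_sym[OF simplex_map_Var]]])

lemma scheme_iso_cyclic:
  "scheme_iso (Y n) (Y n) (lift n n (cyclic_subst n)) (lift n n (cyclic_inv_subst n))"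
proof
  note c = simplex_subst_cyclic[of n] and ci = simplex_subst_cyclic_inv[of n]
  show "lrs_morphism (Y n) (Y n) (lift n n (cyclic_subst n))"
    "lrs_morphism (Y n) (Y n) (lift n n (cyclic_inv_subst n))"
    by (rule lrs_morphism_lift[OF c], rule lrs_morphism_lift[OF ci])
  show "mor_eq (Y n) (Y n) (mor_comp (Y n) (lift n n (cyclic_inv_subst n)) (lift n n (cyclic_subst n))) mor_id"
    by (rule mor_eq_trans[OF lift_comp[OF ci c simplex_subst_Var subst_cyclic_cyclic_inv] lift_Var])
  show "mor_eq (Y n) (Y n) (mor_comp (Y n) (lift n n (cyclic_subst n)) (lift n n (cyclic_inv_subst n))) mor_id"
    by (rule mor_eq_trans[OF lift_comp[OF c ci simplex_subst_Var subst_cyclic_inv_cyclic] lift_Var])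
qed (rule scheme_Y)+

lemma face_map_cyclic_op:
  assumes n: "n \<ge> 1" "j \<le> n" and z: "z \<in> carrier (higher_cycles Y q r n)"
  shows "face_map X Y p q n j (cyclic_op X Y p q n z) =
    pullback_cycle (Y (n - 1)) (Y n)
      (mor_comp (Y n) (lift n n (cyclic_subst n)) (lift n (n - 1) (coface_subst j))) z"
  unfolding face_map_def cyclic_op_def coface_eq cyclic_eq
proof (rule scheme_iso.pullback_cycle_comp_iso[OF scheme_iso_cyclic scheme_Y])
  show "lrs_morphism (Y (n - 1)) (Y n) (lift n (n - 1) (coface_subst j))"
    by (rule lrs_morphism_lift[OF simplex_subst_coface[OF n]])
  show "irreducible_closedin (space_of (Y n)) V" if "V \<in> Poly_Mapping.keys z" for V
    using z that by (auto simp: higher_cycles_def)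
qed

lemma face_map_0_cyclic_op:
  assumes n: "n \<ge> 1" and z: "z \<in> carrier (higher_cycles Y q r n)"
  shows "face_map X Y p q n 0 (cyclic_op X Y p q n z) = face_map X Y p q n n z"
proof -
  note c0 = simplex_subst_coface[OF n le0] and cn = simplex_subst_coface[OF n order_refl]
  show ?thesis
    unfolding face_map_cyclic_op[OF n le0 z] unfolding face_map_def coface_eq
    by (intro pullback_cycle_mor_eq scheme_Y lrs_morphism_comp presheaf_Y lrs_morphism_lift
      lift_comp simplex_subst_cyclic c0 cn subst_coface_0_cyclic)
qed

lemma face_map_Suc_cyclic_op:
  assumes i: "1 \<le> i" "i \<le> n" and z: "z \<in> carrier (higher_cycles Y q r n)"
  shows "face_map X Y p q n i (cyclic_op X Y p q n z) =
    cyclic_op X Y p q (n - 1) (face_map X Y p q n (i - 1) z)"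
proof -
  have n: "n \<ge> 1" "i - 1 \<le> n" using i by simp_all
  note ci = simplex_subst_coface[OF n(1) i(2)] and ci' = simplex_subst_coface[OF n]
    and c = simplex_subst_cyclic[of n] and c' = simplex_subst_cyclic[of "n - 1"]
  let ?f = "mor_comp (Y n) (lift n n (cyclic_subst n)) (lift n (n - 1) (coface_subst i))"
  let ?g = "mor_comp (Y (n - 1)) (lift n (n - 1) (coface_subst (i - 1))) (lift (n - 1) (n - 1) (cyclic_subst (n - 1)))"
  note \<rho> = simplex_subst_comp[OF c ci]
  have "mor_eq (Y (n - 1)) (Y n) ?f ?g"
    by (rule is_lift_unique[OF \<rho> is_lift_lift_comp[OF c ci \<rho> refl]
      is_lift_lift_comp[OF ci' c' \<rho> subst_coface_cyclic[OF i, symmetric]]])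
  then have "pullback_cycle (Y (n - 1)) (Y n) ?f z = pullback_cycle (Y (n - 1)) (Y n) ?g z"
    by (intro pullback_cycle_mor_eq scheme_Y lrs_morphism_comp presheaf_Y lrs_morphism_lift c c' ci ci')
  also have "\<dots> = cyclic_op X Y p q (n - 1) (face_map X Y p q n (i - 1) z)"
    unfolding cyclic_op_def face_map_def coface_eq cyclic_eq
    by (rule scheme_iso.pullback_cycle_iso_comp[OF scheme_iso_cyclic presheaf_Y lrs_morphism_lift[OF ci'], symmetric])
  finally show ?thesis unfolding face_map_cyclic_op[OF n(1) i(2) z] .
qed

end

theorem proposition3p5:
  fixes X :: "('x, 's) ringed_space"
    and \<pi> :: "('x, 's, 'k::field set, 'k set \<Rightarrow> ('k \<times> 'k) set) mor"
    and Y :: "nat \<Rightarrow> ('y, 't) ringed_space"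
    and p :: "nat \<Rightarrow> ('y, 't, 'x, 's) mor"
    and q :: "nat \<Rightarrow> ('y, 't, 'k simplex_point, 'k simplex_section) mor"
    and r :: int
    and n :: nat
    and z :: "'y set \<Rightarrow>\<^sub>0 int"
  assumes "scheme X"
    and "lrs_morphism X (Spec (field_ring :: 'k ring)) \<pi>"
    and "finite_type (field_ring :: 'k ring) X \<pi>"
    and "\<And>m. fibre_product (Spec (field_ring :: 'k ring)) X \<pi> (simplex m) (simplex_str m) (Y m) (p m) (q m)"
    and "n \<ge> 1"
    and "z \<in> carrier (higher_cycles Y q r n)"
  shows "face_map X Y p q n 0 (cyclic_op X Y p q n z) = face_map X Y p q n n z \<and>
    (\<forall>i. 1 \<le> i \<and> i \<le> n \<longrightarrow>
       face_map X Y p q n i (cyclic_op X Y p q n z) =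
       cyclic_op X Y p q (n - 1) (face_map X Y p q n (i - 1) z))"
proof -
  interpret simplex_products X \<pi> Y p q
    using assms(4) by unfold_locales
  show ?thesis
    using face_map_0_cyclic_op[OF assms(5,6)] face_map_Suc_cyclic_op[OF _ _ assms(6)] by blast
qed

end
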